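(* Discrete machines form a $\mathcal{W}_{\widetilde{\mathrm{Int}}_N}$-algebra $\mathsf{Mch}_N\colon\mathcal{W}_{\widetilde{\mathrm{Int}}_N}\to\mathbf{Cat}$ (namely the algebra of $\widetilde{\mathrm{Int}}_N$-span systems). Inertial, total, and deterministic discrete machines form subalgebras $\mathsf{Mch}_N^{\mathrm{in}}$, $\mathsf{Mch}_N^{\mathrm{t}}$, $\mathsf{Mch}_N^{\mathrm{d}}$, and so do the machines that are both total and deterministic, $\mathsf{Mch}_N^{\mathrm{td}}$.
   Context: Discrete interval sheaves. $\mathrm{Int}_N$ is the category with objects $n\in\mathbb{N}$, morphisms $n'\to n$ the symbols $\mathrm{Tr}_p$ with $p\in\mathbb{N}$, $p\le n-n'$, composition $\mathrm{Tr}_p\circ\mathrm{Tr}_{p'}=\mathrm{Tr}_{p+p'}$, identities $\mathrm{Tr}_0$. For a presheaf $X$ and $x\in X(n)$, write $x|_{[p,p+n']}=X(\mathrm{Tr}_p)(x)$. A discrete interval sheaf is a presheaf $X$ on $\mathrm{Int}_N$ such that for all $x_1\in X(n_1)$, $x_2\in X(n_2)$ with $x_1|_{[n_1,n_1]}=x_2|_{[0,0]}$ there is a unique element of $X(n_1+n_2)$ restricting to $x_1$ on $[0,n_1]$ and to $x_2$ on $[n_1,n_1+n_2]$. $\widetilde{\mathrm{Int}}_N$ is the topos of such sheaves. $(\mathsf{Ext}_1A)(n)=A(n+1)$ (restriction along $\mathrm{Tr}_p\colon n'\to n$ being that along $\mathrm{Tr}_p\colon n'+1\to n+1$), and $\lambda\colon\mathsf{Ext}_1A\to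 A$ is left restriction $x\mapsto x|_{[0,n]}$. Machines. A discrete $(A,B)$-machine is a map $p=(p^i,p^o)\colon S\to A\times B$ in $\widetilde{\mathrm{Int}}_N$. A map $p\colon S\to A$ in $\widetilde{\mathrm{Int}}_N$ is total (resp. deterministic) if the induced map $h^1\colon\mathsf{Ext}_1S\to\mathsf{Ext}_1A\times_AS$ (pullback of $\lambda_A$ and $p$; $h^1$ induced by $\mathsf{Ext}_1p$ and $\lambda_S$) is an epimorphism (resp. monomorphism); $p$ is inertial if it factors through $\lambda\colon\mathsf{Ext}_1A\to A$. A discrete machine $(p^i,p^o)$ is inertial if $p^o$ is inertial; it is total (resp. deterministic) if $p^o$ is inertial and $p^i$ is total (resp. deterministic). Wiring diagrams, with $\mathcal{C}=\widetilde{\mathrm{Int}}_N$. A $\mathcal{C}$-typed finite set is a finite set $X$ with $\tau\colon X\to\mathrm{ob}\,\mathcal{C}$; typed functions preserve types; $\widehat{X}=\prod_{x\in X}\tau(x)$; a typed function $f\colon X\to X'$ induces $\widehat{f}\colon\widehat{X'}\to\widehat{X}$ by reindexing. $\mathcal{W}_{\mathcal{C}}$ is the symmetric monoidal category whose objects (boxes) are pairs $X=(X^{\mathrm{in}},X^{\mathrm{out}})$ of $\mathcal{C}$-typed finite sets and whose morphisms (wiring diagrams) $\phi\colon X\to Y$ are pairs of typed functions $\phi^{\mathrm{in}}\colon X^{\mathrm{in}}\to X^{\mathrm{out}}+Y^{\mathrm{in}}$, $\phi^{\mathrm{out}}\colon Y^{\mathrm{out}}\to X^{\mathrm{out}}$.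 The composite $\omega=\psi\circ\phi$ has $\omega^{\mathrm{out}}=\phi^{\mathrm{out}}\circ\psi^{\mathrm{out}}$ and $\omega^{\mathrm{in}}=(\nabla+1)\circ(1+\phi^{\mathrm{out}}+1)\circ(1+\psi^{\mathrm{in}})\circ\phi^{\mathrm{in}}$; the identity is (coproduct inclusion, identity). The tensor $\oplus$ is componentwise disjoint union with unit $0=(\emptyset,\emptyset)$. $\phi$ induces $\widehat{\phi^{\mathrm{in}}}\colon\widehat{Y^{\mathrm{in}}}\times\widehat{X^{\mathrm{out}}}\to\widehat{X^{\mathrm{in}}}$ and $\widehat{\phi^{\mathrm{out}}}\colon\widehat{X^{\mathrm{out}}}\to\widehat{Y^{\mathrm{out}}}$. A $\mathcal{W}_{\mathcal{C}}$-algebra is a symmetric lax monoidal functor $(\mathcal{W}_{\mathcal{C}},\oplus,0)\to(\mathbf{Cat},\times,\mathbf{1})$, in the pseudo sense (axioms up to coherent natural isomorphism). For finitely complete $\mathcal{C}$, the algebra of $\mathcal{C}$-span systems sends $X$ to $\mathcal{C}/(\widehat{X^{\mathrm{in}}}\times\widehat{X^{\mathrm{out}}})$ and $\phi\colon X\to Y$ to pullback along $(\widehat{\phi^{\mathrm{in}}},\pi_2)\colon\widehat{Y^{\mathrm{in}}}\times\widehat{X^{\mathrm{out}}}\to\widehat{X^{\mathrm{in}}}\times\widehat{X^{\mathrm{out}}}$ followed by postcomposition with $1\times\widehat{\phi^{\mathrm{out}}}$; its lax structure is cartesian product of spans. A class of machines forms a subalgebra if the corresponding full subcategories are preserved by the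 functors assigned to all wiring diagrams and by the lax monoidal structure maps (including the unit). *)

theory Defs
  imports Main "HOL-Library.FuncSet"
begin

section \<open>Categories, functors, natural isomorphisms\<close>

record ('o, 'm) cat =
  Obj :: "'o set"
  Arr :: "'m set"
  Dom :: "'m \<Rightarrow> 'o"
  Cod :: "'m \<Rightarrow> 'o"
  Ident :: "'o \<Rightarrow> 'm"
  Comp :: "'m \<Rightarrow> 'm \<Rightarrow> 'm"

definition hom :: "('o, 'm) cat \<Rightarrow> 'o \<Rightarrow> 'o \<Rightarrow> 'm set" where
  "hom C a b = {f \<in> Arr C. Dom C f = a \<and> Cod C f = b}"

locale category =
  fixes C :: "('o, 'm) cat"
  assumes dom_obj: "\<And>f. f \<in> Arr C \<Longrightarrow> Dom C f \<in> Obj C"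
    and cod_obj: "\<And>f. f \<in> Arr C \<Longrightarrow> Cod C f \<in> Obj C"
    and ident_hom: "\<And>a. a \<in> Obj C \<Longrightarrow> Ident C a \<in> hom C a a"
    and comp_hom: "\<And>f g a b c. f \<in> hom C a b \<Longrightarrow> g \<in> hom C b c \<Longrightarrow> Comp C g f \<in> hom C a c"
    and comp_assoc: "\<And>f g h a b c d. f \<in> hom C a b \<Longrightarrow> g \<in> hom C b c \<Longrightarrow> h \<in> hom C c d \<Longrightarrow>
      Comp C h (Comp C g f) = Comp C (Comp C h g) f"
    and comp_ident_right: "\<And>f a b. f \<in> hom C a b \<Longrightarrow> Comp C f (Ident C a) = f"
    and comp_ident_left: "\<And>f a b. f \<in> hom C a b \<Longrightarrow> Comp C (Ident C b) f = f"

definition monic :: "('o, 'm) cat \<Rightarrow> 'm \<Rightarrow> bool" where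
  "monic C f \<longleftrightarrow> f \<in> Arr C \<and>
    (\<forall>c. \<forall>g \<in> hom C c (Dom C f). \<forall>h \<in> hom C c (Dom C f). Comp C f g = Comp C f h \<longrightarrow> g = h)"

definition epic :: "('o, 'm) cat \<Rightarrow> 'm \<Rightarrow> bool" where
  "epic C f \<longleftrightarrow> f \<in> Arr C \<and>
    (\<forall>c. \<forall>g \<in> hom C (Cod C f) c. \<forall>h \<in> hom C (Cod C f) c. Comp C g f = Comp C h f \<longrightarrow> g = h)"

definition is_inverse :: "('o, 'm) cat \<Rightarrow> 'm \<Rightarrow> 'm \<Rightarrow> bool" where
  "is_inverse C f g \<longleftrightarrow> g \<in> hom C (Cod C f) (Dom C f) \<and>
    Comp C g f = Ident C (Dom C f) \<and> Comp C f g = Ident C (Cod C f)"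

definition invertible :: "('o, 'm) cat \<Rightarrow> 'm \<Rightarrow> bool" where
  "invertible C f \<longleftrightarrow> f \<in> Arr C \<and> (\<exists>g. is_inverse C f g)"

definition cinv :: "('o, 'm) cat \<Rightarrow> 'm \<Rightarrow> 'm" where
  "cinv C f = (THE g. is_inverse C f g)"

text \<open>Composite of a nonempty list of arrows, written in diagrammatic order: the head of the
  list is applied first.\<close>

fun chain :: "('o, 'm) cat \<Rightarrow> 'm list \<Rightarrow> 'm" where
  "chain C [] = undefined"
| "chain C [f] = f"
| "chain C (f # g # fs) = Comp C (chain C (g # fs)) f"

definition prod_cat :: "('o1, 'm1) cat \<Rightarrow> ('o2, 'm2) cat \<Rightarrow> ('o1 \<times> 'o2, 'm1 \<times> 'm2) cat" where
  "prod_cat C D =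
    \<lparr>Obj = Obj C \<times> Obj D,
     Arr = Arr C \<times> Arr D,
     Dom = map_prod (Dom C) (Dom D),
     Cod = map_prod (Cod C) (Cod D),
     Ident = map_prod (Ident C) (Ident D),
     Comp = (\<lambda>(g, g') (f, f'). (Comp C g f, Comp D g' f'))\<rparr>"

record ('o1, 'm1, 'o2, 'm2) func =
  fo :: "'o1 \<Rightarrow> 'o2"
  fa :: "'m1 \<Rightarrow> 'm2"

definition is_functor ::
  "('o1, 'm1) cat \<Rightarrow> ('o2, 'm2) cat \<Rightarrow> ('o1, 'm1, 'o2, 'm2) func \<Rightarrow> bool" where
  "is_functor C D F \<longleftrightarrow>
    (\<forall>a \<in> Obj C. fo F a \<in> Obj D) \<and>
    (\<forall>f \<in> Arr C. fa F f \<in> hom D (fo F (Dom C f)) (fo F (Cod C f))) \<and>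
    (\<forall>a \<in> Obj C. fa F (Ident C a) = Ident D (fo F a)) \<and>
    (\<forall>f \<in> Arr C. \<forall>g \<in> Arr C. Cod C f = Dom C g \<longrightarrow>
       fa F (Comp C g f) = Comp D (fa F g) (fa F f))"

definition id_func :: "('o, 'm, 'o, 'm) func" where
  "id_func = \<lparr>fo = id, fa = id\<rparr>"

definition comp_func ::
  "('o2, 'm2, 'o3, 'm3) func \<Rightarrow> ('o1, 'm1, 'o2, 'm2) func \<Rightarrow> ('o1, 'm1, 'o3, 'm3) func"
  (infixr "\<circ>\<^sub>f" 55) where
  "G \<circ>\<^sub>f F = \<lparr>fo = fo G \<circ> fo F, fa = fa G \<circ> fa F\<rparr>"

definition prod_func ::
  "('o1, 'm1, 'o2, 'm2) func \<Rightarrow> ('o3, 'm3, 'o4, 'm4) func \<Rightarrow>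
   ('o1 \<times> 'o3, 'm1 \<times> 'm3, 'o2 \<times> 'o4, 'm2 \<times> 'm4) func"
  (infixr "\<times>\<^sub>f" 60) where
  "F \<times>\<^sub>f G = \<lparr>fo = map_prod (fo F) (fo G), fa = map_prod (fa F) (fa G)\<rparr>"

definition assoc_func ::
  "(('o1 \<times> 'o2) \<times> 'o3, ('m1 \<times> 'm2) \<times> 'm3, 'o1 \<times> 'o2 \<times> 'o3, 'm1 \<times> 'm2 \<times> 'm3) func" where
  "assoc_func = \<lparr>fo = \<lambda>((a, b), c). (a, b, c), fa = \<lambda>((f, g), h). (f, g, h)\<rparr>"

definition swap_func :: "('o1 \<times> 'o2, 'm1 \<times> 'm2, 'o2 \<times> 'o1, 'm2 \<times> 'm1) func" where
  "swap_func = \<lparr>fo = prod.swap, fa = prod.swap\<rparr>"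

definition pair_left :: "('o1, 'm1) cat \<Rightarrow> 'o1 \<Rightarrow> ('o2, 'm2, 'o1 \<times> 'o2, 'm1 \<times> 'm2) func" where
  "pair_left C a = \<lparr>fo = \<lambda>b. (a, b), fa = \<lambda>f. (Ident C a, f)\<rparr>"

definition pair_right :: "('o1, 'm1) cat \<Rightarrow> 'o1 \<Rightarrow> ('o2, 'm2, 'o2 \<times> 'o1, 'm2 \<times> 'm1) func" where
  "pair_right C a = \<lparr>fo = \<lambda>b. (b, a), fa = \<lambda>f. (f, Ident C a)\<rparr>"

definition nat_iso :: "('o1, 'm1) cat \<Rightarrow> ('o2, 'm2) cat \<Rightarrow>
   ('o1, 'm1, 'o2, 'm2) func \<Rightarrow> ('o1, 'm1, 'o2, 'm2) func \<Rightarrow> ('o1 \<Rightarrow> 'm2) \<Rightarrow> bool" where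
  "nat_iso C D F G \<eta> \<longleftrightarrow>
    (\<forall>a \<in> Obj C. \<eta> a \<in> hom D (fo F a) (fo G a) \<and> invertible D (\<eta> a)) \<and>
    (\<forall>f \<in> Arr C. Comp D (\<eta> (Cod C f)) (fa F f) = Comp D (fa G f) (\<eta> (Dom C f)))"

definition slice :: "('o, 'm) cat \<Rightarrow> 'o \<Rightarrow> ('m, 'm \<times> 'm \<times> 'm) cat" where
  "slice C b =
    \<lparr>Obj = {p \<in> Arr C. Cod C p = b},
     Arr = {(p, f, q). p \<in> Arr C \<and> Cod C p = b \<and> q \<in> Arr C \<and> Cod C q = b \<and>
                       f \<in> hom C (Dom C p) (Dom C q) \<and> Comp C q f = p},
     Dom = (\<lambda>(p, f, q). p),
     Cod = (\<lambda>(p, f, q). q),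
     Ident = (\<lambda>p. (p, Ident C (Dom C p), p)),
     Comp = (\<lambda>(_, g, r) (p, f, _). (p, Comp C g f, r))\<rparr>"


section \<open>Symmetric monoidal categories\<close>

record ('b, 'w) smcat =
  Cat :: "('b, 'w) cat"
  Tens :: "('b \<times> 'b, 'w \<times> 'w, 'b, 'w) func"
  Unit :: 'b
  Assoc :: "'b \<Rightarrow> 'b \<Rightarrow> 'b \<Rightarrow> 'w"  \<comment> \<open>\<open>(X \<otimes> Y) \<otimes> Z \<rightarrow> X \<otimes> (Y \<otimes> Z)\<close>\<close>
  Lunit :: "'b \<Rightarrow> 'w"  \<comment> \<open>\<open>I \<otimes> X \<rightarrow> X\<close>\<close>
  Runit :: "'b \<Rightarrow> 'w"  \<comment> \<open>\<open>X \<otimes> I \<rightarrow> X\<close>\<close>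
  Braid :: "'b \<Rightarrow> 'b \<Rightarrow> 'w"  \<comment> \<open>\<open>X \<otimes> Y \<rightarrow> Y \<otimes> X\<close>\<close>

locale smcat_data =
  fixes W :: "('b, 'w) smcat"
begin

abbreviation WC where "WC \<equiv> Cat W"
abbreviation tens_obj (infixr "\<otimes>" 70) where "X \<otimes> Y \<equiv> fo (Tens W) (X, Y)"
abbreviation tens_arr (infixr "\<boxtimes>" 70) where "f \<boxtimes> g \<equiv> fa (Tens W) (f, g)"
abbreviation comp_arr (infixr "\<cdot>" 65) where "g \<cdot> f \<equiv> Comp (Cat W) g f"
abbreviation one ("\<one>") where "\<one> X \<equiv> Ident (Cat W) X"
abbreviation unit_obj ("\<I>") where "\<I> \<equiv> Unit W"
abbreviation assoc ("\<a>") where "\<a> \<equiv> Assoc W"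
abbreviation lunit ("\<l>") where "\<l> \<equiv> Lunit W"
abbreviation runit ("\<r>") where "\<r> \<equiv> Runit W"
abbreviation braid ("\<s>") where "\<s> \<equiv> Braid W"

end

locale symmetric_monoidal_category = smcat_data W for W :: "('b, 'w) smcat" +
  assumes cat: "category WC"
    and tens_functor: "is_functor (prod_cat WC WC) WC (Tens W)"
    and unit_obj: "\<I> \<in> Obj WC"
    and assoc_nat: "nat_iso (prod_cat (prod_cat WC WC) WC) WC
          (Tens W \<circ>\<^sub>f (Tens W \<times>\<^sub>f id_func))
          (Tens W \<circ>\<^sub>f (id_func \<times>\<^sub>f Tens W) \<circ>\<^sub>f assoc_func) (\<lambda>((X, Y), Z). \<a> X Y Z)"
    and lunit_nat: "nat_iso WC WC (Tens W \<circ>\<^sub>f pair_left WC \<I>) id_func \<l>"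
    and runit_nat: "nat_iso WC WC (Tens W \<circ>\<^sub>f pair_right WC \<I>) id_func \<r>"
    and braid_nat: "nat_iso (prod_cat WC WC) WC (Tens W) (Tens W \<circ>\<^sub>f swap_func) (\<lambda>(X, Y). \<s> X Y)"
    and pentagon: "\<And>X Y Z V. X \<in> Obj WC \<Longrightarrow> Y \<in> Obj WC \<Longrightarrow> Z \<in> Obj WC \<Longrightarrow> V \<in> Obj WC \<Longrightarrow>
          \<a> X Y (Z \<otimes> V) \<cdot> \<a> (X \<otimes> Y) Z V =
          (\<one> X \<boxtimes> \<a> Y Z V) \<cdot> \<a> X (Y \<otimes> Z) V \<cdot> (\<a> X Y Z \<boxtimes> \<one> V)"
    and triangle: "\<And>X Y. X \<in> Obj WC \<Longrightarrow> Y \<in> Obj WC \<Longrightarrow>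
          (\<one> X \<boxtimes> \<l> Y) \<cdot> \<a> X \<I> Y = \<r> X \<boxtimes> \<one> Y"
    and hexagon: "\<And>X Y Z. X \<in> Obj WC \<Longrightarrow> Y \<in> Obj WC \<Longrightarrow> Z \<in> Obj WC \<Longrightarrow>
          \<a> Y Z X \<cdot> \<s> X (Y \<otimes> Z) \<cdot> \<a> X Y Z =
          (\<one> Y \<boxtimes> \<s> X Z) \<cdot> \<a> Y X Z \<cdot> (\<s> X Y \<boxtimes> \<one> Z)"
    and symmetry: "\<And>X Y. X \<in> Obj WC \<Longrightarrow> Y \<in> Obj WC \<Longrightarrow> \<s> Y X \<cdot> \<s> X Y = \<one> (X \<otimes> Y)"


section \<open>Symmetric lax monoidal pseudofunctors to \<open>Cat\<close>\<close>

text \<open>The \<open>1\<close>-cells of a lax monoidal functor \<open>(W, \<otimes>, I) \<rightarrow> (Cat, \<times>, 1)\<close>. A functor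
  \<open>1 \<rightarrow> F I\<close> is the same as an object of \<open>F I\<close>; this is \<^term>\<open>eta\<close>.\<close>

record ('b, 'w, 'o, 'm) lax_data =
  FO :: "'b \<Rightarrow> ('o, 'm) cat"
  FA :: "'w \<Rightarrow> ('o, 'm, 'o, 'm) func"
  mu :: "'b \<Rightarrow> 'b \<Rightarrow> ('o \<times> 'o, 'm \<times> 'm, 'o, 'm) func"  \<comment> \<open>\<open>F X \<times> F Y \<rightarrow> F (X \<otimes> Y)\<close>\<close>
  eta :: 'o

text \<open>The \<open>2\<close>-cells, given by their components:
  \<^item> \<open>cmp g f S : F g (F f S) \<rightarrow> F (g \<cdot> f) S\<close>
  \<^item> \<open>unt X S : S \<rightarrow> F (1 X) S\<close>
  \<^item> \<open>mun f g S T : F (f \<otimes> g) (mu (S, T)) \<rightarrow> mu (F f S, F g T)\<close>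
  \<^item> \<open>asc X Y Z S T U : F a (mu (mu (S, T), U)) \<rightarrow> mu (S, mu (T, U))\<close>
  \<^item> \<open>lun X S : F l (mu (eta, S)) \<rightarrow> S\<close>
  \<^item> \<open>run X S : F r (mu (S, eta)) \<rightarrow> S\<close>
  \<^item> \<open>brd X Y S T : F s (mu (S, T)) \<rightarrow> mu (T, S)\<close>\<close>

record ('b, 'w, 'o, 'm) lax_cells =
  cmp :: "'w \<Rightarrow> 'w \<Rightarrow> 'o \<Rightarrow> 'm"
  unt :: "'b \<Rightarrow> 'o \<Rightarrow> 'm"
  mun :: "'w \<Rightarrow> 'w \<Rightarrow> 'o \<Rightarrow> 'o \<Rightarrow> 'm"
  asc :: "'b \<Rightarrow> 'b \<Rightarrow> 'b \<Rightarrow> 'o \<Rightarrow> 'o \<Rightarrow> 'o \<Rightarrow> 'm"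
  lun :: "'b \<Rightarrow> 'o \<Rightarrow> 'm"
  run :: "'b \<Rightarrow> 'o \<Rightarrow> 'm"
  brd :: "'b \<Rightarrow> 'b \<Rightarrow> 'o \<Rightarrow> 'o \<Rightarrow> 'm"

locale lax_functor_data = smcat_data W for W :: "('b, 'w) smcat" +
  fixes F :: "('b, 'w, 'o, 'm) lax_data"
    and K :: "('b, 'w, 'o, 'm) lax_cells"
begin

abbreviation F0 where "F0 X \<equiv> FO F X"
abbreviation Fo where "Fo f S \<equiv> fo (FA F f) S"
abbreviation Fa where "Fa f k \<equiv> fa (FA F f) k"
abbreviation M where "M X Y S T \<equiv> fo (mu F X Y) (S, T)"
abbreviation Ma where "Ma X Y k l \<equiv> fa (mu F X Y) (k, l)"
abbreviation e where "e \<equiv> eta F"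
abbreviation i where "i X S \<equiv> Ident (FO F X) S"

abbreviation c where "c g f S \<equiv> cmp K g f S"
abbreviation c3 where \<comment> \<open>\<open>F h (F g (F f S)) \<rightarrow> F (h \<cdot> g \<cdot> f) S\<close>\<close>
  "c3 h g f S \<equiv> Comp (FO F (Cod WC h)) (c h (g \<cdot> f) S) (Fa h (c g f S))"
abbreviation c_inv where "c_inv g f S \<equiv> cinv (FO F (Cod WC g)) (c g f S)"
abbreviation c3_inv where "c3_inv h g f S \<equiv> cinv (FO F (Cod WC h)) (c3 h g f S)"
abbreviation u where "u X S \<equiv> unt K X S"
abbreviation u_inv where "u_inv X S \<equiv> cinv (FO F X) (u X S)"
abbreviation m where "m f g S T \<equiv> mun K f g S T"
abbreviation A where "A X Y Z S T U \<equiv> asc K X Y Z S T U"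
abbreviation L where "L X S \<equiv> lun K X S"
abbreviation R where "R X S \<equiv> run K X S"
abbreviation B where "B X Y S T \<equiv> brd K X Y S T"

end

text \<open>The axioms are those of a symmetric weak monoidal homomorphism between symmetric monoidal
  bicategories (Gordon--Power--Street, Day--Street, McCrudden), specialised to a domain without
  nonidentity \<open>2\<close>-cells and to the codomain \<open>Cat\<close>. Equalities between composite arrows of the
  domain are witnessed by inverses of \<^term>\<open>cmp\<close>. As in a symmetric monoidal functor, the second
  hexagon follows from the first one and the symmetry axiom.\<close>

locale symmetric_lax_monoidal_pseudofunctor = lax_functor_data W F K
  for W :: "('b, 'w) smcat"
    and F :: "('b, 'w, 'o, 'm) lax_data"
    and K :: "('b, 'w, 'o, 'm) lax_cells" +
  assumes domain: "symmetric_monoidal_category W"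
    \<comment> \<open>data\<close>
    and F0_category: "\<And>X. X \<in> Obj WC \<Longrightarrow> category (F0 X)"
    and FA_functor: "\<And>f X Y. f \<in> hom WC X Y \<Longrightarrow> is_functor (F0 X) (F0 Y) (FA F f)"
    and mu_functor: "\<And>X Y. X \<in> Obj WC \<Longrightarrow> Y \<in> Obj WC \<Longrightarrow>
          is_functor (prod_cat (F0 X) (F0 Y)) (F0 (X \<otimes> Y)) (mu F X Y)"
    and eta_obj: "e \<in> Obj (F0 \<I>)"
    and cmp_nat: "\<And>f g X Y Z. f \<in> hom WC X Y \<Longrightarrow> g \<in> hom WC Y Z \<Longrightarrow>
          nat_iso (F0 X) (F0 Z) (FA F g \<circ>\<^sub>f FA F f) (FA F (g \<cdot> f)) (c g f)"
    and unt_nat: "\<And>X. X \<in> Obj WC \<Longrightarrow> nat_iso (F0 X) (F0 X) id_func (FA F (\<one> X)) (u X)"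
    and mun_nat: "\<And>f g X X' Y Y'. f \<in> hom WC X X' \<Longrightarrow> g \<in> hom WC Y Y' \<Longrightarrow>
          nat_iso (prod_cat (F0 X) (F0 Y)) (F0 (X' \<otimes> Y'))
            (FA F (f \<boxtimes> g) \<circ>\<^sub>f mu F X Y) (mu F X' Y' \<circ>\<^sub>f (FA F f \<times>\<^sub>f FA F g)) (\<lambda>(S, T). m f g S T)"
    and asc_nat: "\<And>X Y Z. X \<in> Obj WC \<Longrightarrow> Y \<in> Obj WC \<Longrightarrow> Z \<in> Obj WC \<Longrightarrow>
          nat_iso (prod_cat (prod_cat (F0 X) (F0 Y)) (F0 Z)) (F0 (X \<otimes> Y \<otimes> Z))
            (FA F (\<a> X Y Z) \<circ>\<^sub>f mu F (X \<otimes> Y) Z \<circ>\<^sub>f (mu F X Y \<times>\<^sub>f id_func))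
            (mu F X (Y \<otimes> Z) \<circ>\<^sub>f (id_func \<times>\<^sub>f mu F Y Z) \<circ>\<^sub>f assoc_func)
            (\<lambda>((S, T), U). A X Y Z S T U)"
    and lun_nat: "\<And>X. X \<in> Obj WC \<Longrightarrow>
          nat_iso (F0 X) (F0 X) (FA F (\<l> X) \<circ>\<^sub>f mu F \<I> X \<circ>\<^sub>f pair_left (F0 \<I>) e) id_func (L X)"
    and run_nat: "\<And>X. X \<in> Obj WC \<Longrightarrow>
          nat_iso (F0 X) (F0 X) (FA F (\<r> X) \<circ>\<^sub>f mu F X \<I> \<circ>\<^sub>f pair_right (F0 \<I>) e) id_func (R X)"
    and brd_nat: "\<And>X Y. X \<in> Obj WC \<Longrightarrow> Y \<in> Obj WC \<Longrightarrow>
          nat_iso (prod_cat (F0 X) (F0 Y)) (F0 (Y \<otimes> X))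
            (FA F (\<s> X Y) \<circ>\<^sub>f mu F X Y) (mu F Y X \<circ>\<^sub>f swap_func) (\<lambda>(S, T). B X Y S T)"
    \<comment> \<open>\<open>F\<close> is a pseudofunctor\<close>
    and cmp_assoc: "\<And>f g h V X Y Z S.
          f \<in> hom WC V X \<Longrightarrow> g \<in> hom WC X Y \<Longrightarrow> h \<in> hom WC Y Z \<Longrightarrow> S \<in> Obj (F0 V) \<Longrightarrow>
          chain (F0 Z) [c h g (Fo f S), c (h \<cdot> g) f S] =
          chain (F0 Z) [Fa h (c g f S), c h (g \<cdot> f) S]"
    and cmp_unit_right: "\<And>f X Y S. f \<in> hom WC X Y \<Longrightarrow> S \<in> Obj (F0 X) \<Longrightarrow>
          chain (F0 Y) [Fa f (u X S), c f (\<one> X) S] = i Y (Fo f S)"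
    and cmp_unit_left: "\<And>f X Y S. f \<in> hom WC X Y \<Longrightarrow> S \<in> Obj (F0 X) \<Longrightarrow>
          chain (F0 Y) [u Y (Fo f S), c (\<one> Y) f S] = i Y (Fo f S)"
    \<comment> \<open>\<^term>\<open>mu\<close> is pseudonatural\<close>
    and mun_comp: "\<And>f f' g g' X X' X'' Y Y' Y'' S T.
          f \<in> hom WC X X' \<Longrightarrow> f' \<in> hom WC X' X'' \<Longrightarrow> g \<in> hom WC Y Y' \<Longrightarrow> g' \<in> hom WC Y' Y'' \<Longrightarrow>
          S \<in> Obj (F0 X) \<Longrightarrow> T \<in> Obj (F0 Y) \<Longrightarrow>
          chain (F0 (X'' \<otimes> Y''))
            [c (f' \<boxtimes> g') (f \<boxtimes> g) (M X Y S T), m (f' \<cdot> f) (g' \<cdot> g) S T] =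
          chain (F0 (X'' \<otimes> Y''))
            [Fa (f' \<boxtimes> g') (m f g S T), m f' g' (Fo f S) (Fo g T), Ma X'' Y'' (c f' f S) (c g' g T)]"
    and mun_unit: "\<And>X Y S T. X \<in> Obj WC \<Longrightarrow> Y \<in> Obj WC \<Longrightarrow> S \<in> Obj (F0 X) \<Longrightarrow> T \<in> Obj (F0 Y) \<Longrightarrow>
          chain (F0 (X \<otimes> Y)) [u (X \<otimes> Y) (M X Y S T), m (\<one> X) (\<one> Y) S T] = Ma X Y (u X S) (u Y T)"
    \<comment> \<open>\<^term>\<open>asc\<close>, \<^term>\<open>lun\<close>, \<^term>\<open>run\<close>, \<^term>\<open>brd\<close> are modifications\<close>
    and asc_modification: "\<And>f g h X X' Y Y' Z Z' S T U.
          f \<in> hom WC X X' \<Longrightarrow> g \<in> hom WC Y Y' \<Longrightarrow> h \<in> hom WC Z Z' \<Longrightarrow>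
          S \<in> Obj (F0 X) \<Longrightarrow> T \<in> Obj (F0 Y) \<Longrightarrow> U \<in> Obj (F0 Z) \<Longrightarrow>
          chain (F0 (X' \<otimes> Y' \<otimes> Z'))
            [c_inv (f \<boxtimes> g \<boxtimes> h) (\<a> X Y Z) (M (X \<otimes> Y) Z (M X Y S T) U),
             Fa (f \<boxtimes> g \<boxtimes> h) (A X Y Z S T U),
             m f (g \<boxtimes> h) S (M Y Z T U),
             Ma X' (Y' \<otimes> Z') (i X' (Fo f S)) (m g h T U)] =
          chain (F0 (X' \<otimes> Y' \<otimes> Z'))
            [c_inv (\<a> X' Y' Z') ((f \<boxtimes> g) \<boxtimes> h) (M (X \<otimes> Y) Z (M X Y S T) U),
             Fa (\<a> X' Y' Z') (m (f \<boxtimes> g) h (M X Y S T) U),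
             Fa (\<a> X' Y' Z') (Ma (X' \<otimes> Y') Z' (m f g S T) (i Z' (Fo h U))),
             A X' Y' Z' (Fo f S) (Fo g T) (Fo h U)]"
    and lun_modification: "\<And>f X Y S. f \<in> hom WC X Y \<Longrightarrow> S \<in> Obj (F0 X) \<Longrightarrow>
          chain (F0 Y)
            [c_inv f (\<l> X) (M \<I> X e S),
             Fa f (L X S)] =
          chain (F0 Y)
            [c_inv (\<l> Y) (\<one> \<I> \<boxtimes> f) (M \<I> X e S),
             Fa (\<l> Y) (m (\<one> \<I>) f e S),
             Fa (\<l> Y) (Ma \<I> Y (u_inv \<I> e) (i Y (Fo f S))),
             L Y (Fo f S)]"
    and run_modification: "\<And>f X Y S. f \<in> hom WC X Y \<Longrightarrow> S \<in> Obj (F0 X) \<Longrightarrow>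
          chain (F0 Y)
            [c_inv f (\<r> X) (M X \<I> S e),
             Fa f (R X S)] =
          chain (F0 Y)
            [c_inv (\<r> Y) (f \<boxtimes> \<one> \<I>) (M X \<I> S e),
             Fa (\<r> Y) (m f (\<one> \<I>) S e),
             Fa (\<r> Y) (Ma Y \<I> (i Y (Fo f S)) (u_inv \<I> e)),
             R Y (Fo f S)]"
    and brd_modification: "\<And>f g X X' Y Y' S T.
          f \<in> hom WC X X' \<Longrightarrow> g \<in> hom WC Y Y' \<Longrightarrow> S \<in> Obj (F0 X) \<Longrightarrow> T \<in> Obj (F0 Y) \<Longrightarrow>
          chain (F0 (Y' \<otimes> X'))
            [c_inv (g \<boxtimes> f) (\<s> X Y) (M X Y S T),
             Fa (g \<boxtimes> f) (B X Y S T),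
             m g f T S] =
          chain (F0 (Y' \<otimes> X'))
            [c_inv (\<s> X' Y') (f \<boxtimes> g) (M X Y S T),
             Fa (\<s> X' Y') (m f g S T),
             B X' Y' (Fo f S) (Fo g T)]"
    \<comment> \<open>coherence\<close>
    and asc_pentagon: "\<And>X Y Z V S T U P.
          X \<in> Obj WC \<Longrightarrow> Y \<in> Obj WC \<Longrightarrow> Z \<in> Obj WC \<Longrightarrow> V \<in> Obj WC \<Longrightarrow>
          S \<in> Obj (F0 X) \<Longrightarrow> T \<in> Obj (F0 Y) \<Longrightarrow> U \<in> Obj (F0 Z) \<Longrightarrow> P \<in> Obj (F0 V) \<Longrightarrow>
          chain (F0 (X \<otimes> Y \<otimes> Z \<otimes> V))
            [c_inv (\<a> X Y (Z \<otimes> V)) (\<a> (X \<otimes> Y) Z V)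
               (M ((X \<otimes> Y) \<otimes> Z) V (M (X \<otimes> Y) Z (M X Y S T) U) P),
             Fa (\<a> X Y (Z \<otimes> V)) (A (X \<otimes> Y) Z V (M X Y S T) U P),
             A X Y (Z \<otimes> V) S T (M Z V U P)] =
          chain (F0 (X \<otimes> Y \<otimes> Z \<otimes> V))
            [c3_inv (\<one> X \<boxtimes> \<a> Y Z V) (\<a> X (Y \<otimes> Z) V) (\<a> X Y Z \<boxtimes> \<one> V)
               (M ((X \<otimes> Y) \<otimes> Z) V (M (X \<otimes> Y) Z (M X Y S T) U) P),
             Fa (\<one> X \<boxtimes> \<a> Y Z V) (Fa (\<a> X (Y \<otimes> Z) V)
               (m (\<a> X Y Z) (\<one> V) (M (X \<otimes> Y) Z (M X Y S T) U) P)),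
             Fa (\<one> X \<boxtimes> \<a> Y Z V) (Fa (\<a> X (Y \<otimes> Z) V)
               (Ma (X \<otimes> Y \<otimes> Z) V (A X Y Z S T U) (u_inv V P))),
             Fa (\<one> X \<boxtimes> \<a> Y Z V) (A X (Y \<otimes> Z) V S (M Y Z T U) P),
             m (\<one> X) (\<a> Y Z V) S (M (Y \<otimes> Z) V (M Y Z T U) P),
             Ma X (Y \<otimes> Z \<otimes> V) (u_inv X S) (A Y Z V T U P)]"
    and unit_triangle: "\<And>X Y S T.
          X \<in> Obj WC \<Longrightarrow> Y \<in> Obj WC \<Longrightarrow> S \<in> Obj (F0 X) \<Longrightarrow> T \<in> Obj (F0 Y) \<Longrightarrow>
          chain (F0 (X \<otimes> Y))
            [c_inv (\<one> X \<boxtimes> \<l> Y) (\<a> X \<I> Y) (M (X \<otimes> \<I>) Y (M X \<I> S e) T),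
             Fa (\<one> X \<boxtimes> \<l> Y) (A X \<I> Y S e T),
             m (\<one> X) (\<l> Y) S (M \<I> Y e T),
             Ma X Y (u_inv X S) (L Y T)] =
          chain (F0 (X \<otimes> Y))
            [m (\<r> X) (\<one> Y) (M X \<I> S e) T,
             Ma X Y (R X S) (u_inv Y T)]"
    and brd_hexagon: "\<And>X Y Z S T U.
          X \<in> Obj WC \<Longrightarrow> Y \<in> Obj WC \<Longrightarrow> Z \<in> Obj WC \<Longrightarrow>
          S \<in> Obj (F0 X) \<Longrightarrow> T \<in> Obj (F0 Y) \<Longrightarrow> U \<in> Obj (F0 Z) \<Longrightarrow>
          chain (F0 (Y \<otimes> Z \<otimes> X))
            [c3_inv (\<a> Y Z X) (\<s> X (Y \<otimes> Z)) (\<a> X Y Z) (M (X \<otimes> Y) Z (M X Y S T) U),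
             Fa (\<a> Y Z X) (Fa (\<s> X (Y \<otimes> Z)) (A X Y Z S T U)),
             Fa (\<a> Y Z X) (B X (Y \<otimes> Z) S (M Y Z T U)),
             A Y Z X T U S] =
          chain (F0 (Y \<otimes> Z \<otimes> X))
            [c3_inv (\<one> Y \<boxtimes> \<s> X Z) (\<a> Y X Z) (\<s> X Y \<boxtimes> \<one> Z) (M (X \<otimes> Y) Z (M X Y S T) U),
             Fa (\<one> Y \<boxtimes> \<s> X Z) (Fa (\<a> Y X Z) (m (\<s> X Y) (\<one> Z) (M X Y S T) U)),
             Fa (\<one> Y \<boxtimes> \<s> X Z) (Fa (\<a> Y X Z) (Ma (Y \<otimes> X) Z (B X Y S T) (u_inv Z U))),
             Fa (\<one> Y \<boxtimes> \<s> X Z) (A Y X Z T S U),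
             m (\<one> Y) (\<s> X Z) T (M X Z S U),
             Ma Y (Z \<otimes> X) (u_inv Y T) (B X Z S U)]"
    and brd_symmetry: "\<And>X Y S T.
          X \<in> Obj WC \<Longrightarrow> Y \<in> Obj WC \<Longrightarrow> S \<in> Obj (F0 X) \<Longrightarrow> T \<in> Obj (F0 Y) \<Longrightarrow>
          chain (F0 (X \<otimes> Y)) [Fa (\<s> Y X) (B X Y S T), B Y X T S] =
          chain (F0 (X \<otimes> Y)) [c (\<s> Y X) (\<s> X Y) (M X Y S T), u_inv (X \<otimes> Y) (M X Y S T)]"

text \<open>A family \<open>P X\<close> of classes of objects of \<open>F X\<close>, regarded as full subcategories, is a
  subalgebra if it is preserved by all \<open>1\<close>-cells; the \<open>2\<close>-cells restrict by fullness.\<close>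

definition subalgebra ::
  "('b, 'w) smcat \<Rightarrow> ('b, 'w, 'o, 'm) lax_data \<Rightarrow> ('b \<Rightarrow> 'o set) \<Rightarrow> bool" where
  "subalgebra W F P \<longleftrightarrow>
    (\<forall>X \<in> Obj (Cat W). P X \<subseteq> Obj (FO F X)) \<and>
    (\<forall>f \<in> Arr (Cat W). \<forall>S \<in> P (Dom (Cat W) f). fo (FA F f) S \<in> P (Cod (Cat W) f)) \<and>
    (\<forall>X \<in> Obj (Cat W). \<forall>Y \<in> Obj (Cat W). \<forall>S \<in> P X. \<forall>T \<in> P Y.
       fo (mu F X Y) (S, T) \<in> P (fo (Tens W) (X, Y))) \<and>
    eta F \<in> P (Unit W)"


section \<open>Typed finite sets and wiring diagrams\<close>

text \<open>A universe of elements for finite sets, closed under disjoint unions.\<close>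

datatype 'a port = Port 'a | PL "'a port" | PR "'a port"

fun pcase :: "('a port \<Rightarrow> 'b) \<Rightarrow> ('a port \<Rightarrow> 'b) \<Rightarrow> 'a port \<Rightarrow> 'b" where
  "pcase f g (PL x) = f x"
| "pcase f g (PR y) = g y"
| "pcase f g (Port _) = undefined"

record ('a, 'o) tset =
  ports :: "'a port set"
  ty :: "'a port \<Rightarrow> 'o"

definition typed_finite_set :: "('o, 'm) cat \<Rightarrow> ('a, 'o) tset \<Rightarrow> bool" where
  "typed_finite_set C X \<longleftrightarrow> finite (ports X) \<and> (\<forall>x \<in> ports X. ty X x \<in> Obj C)"

definition typed_fun :: "('a, 'o) tset \<Rightarrow> ('a, 'o) tset \<Rightarrow> ('a port \<Rightarrow> 'a port) set" where
  "typed_fun X Y = {f \<in> ports X \<rightarrow>\<^sub>E ports Y. \<forall>x \<in> ports X. ty Y (f x) = ty X x}"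

definition tempty :: "('a, 'o) tset" where
  "tempty = \<lparr>ports = {}, ty = \<lambda>_. undefined\<rparr>"

definition tsum :: "('a, 'o) tset \<Rightarrow> ('a, 'o) tset \<Rightarrow> ('a, 'o) tset"  (infixr "\<uplus>" 65) where
  "X \<uplus> Y = \<lparr>ports = PL ` ports X \<union> PR ` ports Y, ty = pcase (ty X) (ty Y)\<rparr>"

record ('a, 'o) box =
  bin :: "('a, 'o) tset"
  bout :: "('a, 'o) tset"

record ('a, 'o) wiring =
  wdom :: "('a, 'o) box"
  wcod :: "('a, 'o) box"
  win :: "'a port \<Rightarrow> 'a port"
  wout :: "'a port \<Rightarrow> 'a port"

definition WD_cat :: "('o, 'm) cat \<Rightarrow> (('a, 'o) box, ('a, 'o) wiring) cat" where
  "WD_cat C =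
    \<lparr>Obj = {X. typed_finite_set C (bin X) \<and> typed_finite_set C (bout X)},
     Arr = {\<phi>. typed_finite_set C (bin (wdom \<phi>)) \<and> typed_finite_set C (bout (wdom \<phi>)) \<and>
               typed_finite_set C (bin (wcod \<phi>)) \<and> typed_finite_set C (bout (wcod \<phi>)) \<and>
               win \<phi> \<in> typed_fun (bin (wdom \<phi>)) (bout (wdom \<phi>) \<uplus> bin (wcod \<phi>)) \<and>
               wout \<phi> \<in> typed_fun (bout (wcod \<phi>)) (bout (wdom \<phi>))},
     Dom = wdom,
     Cod = wcod,
     Ident = (\<lambda>X. \<lparr>wdom = X, wcod = X, win = \<lambda>x \<in> ports (bin X). PR x,
                   wout = \<lambda>x \<in> ports (bout X). x\<rparr>),
     Comp = (\<lambda>\<psi> \<phi>. \<lparr>wdom = wdom \<phi>, wcod = wcod \<psi>,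
               win = \<lambda>x \<in> ports (bin (wdom \<phi>)).
                 pcase PL (\<lambda>y. pcase (\<lambda>y'. PL (wout \<phi> y')) PR (win \<psi> y)) (win \<phi> x),
               wout = \<lambda>z \<in> ports (bout (wcod \<psi>)). wout \<phi> (wout \<psi> z)\<rparr>)\<rparr>"

definition box_sum :: "('a, 'o) box \<Rightarrow> ('a, 'o) box \<Rightarrow> ('a, 'o) box" where
  "box_sum X Y = \<lparr>bin = bin X \<uplus> bin Y, bout = bout X \<uplus> bout Y\<rparr>"

definition wiring_sum :: "('a, 'o) wiring \<Rightarrow> ('a, 'o) wiring \<Rightarrow> ('a, 'o) wiring" where
  "wiring_sum \<phi> \<psi> =
    \<lparr>wdom = box_sum (wdom \<phi>) (wdom \<psi>),
     wcod = box_sum (wcod \<phi>) (wcod \<psi>),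
     win = \<lambda>x \<in> ports (bin (wdom \<phi>) \<uplus> bin (wdom \<psi>)).
       pcase (\<lambda>x. pcase (PL \<circ> PL) (PR \<circ> PL) (win \<phi> x))
             (\<lambda>x. pcase (PL \<circ> PR) (PR \<circ> PR) (win \<psi> x)) x,
     wout = \<lambda>y \<in> ports (bout (wcod \<phi>) \<uplus> bout (wcod \<psi>)).
       pcase (PL \<circ> wout \<phi>) (PR \<circ> wout \<psi>) y\<rparr>"

text \<open>The wiring diagram \<open>X \<rightarrow> Y\<close> induced by typed functions \<open>f\<close> from the inputs of \<open>X\<close> to those
  of \<open>Y\<close> and \<open>g\<close> from the outputs of \<open>Y\<close> to those of \<open>X\<close>.\<close>

definition relabel :: "('a, 'o) box \<Rightarrow> ('a, 'o) box \<Rightarrow> ('a port \<Rightarrow> 'a port) \<Rightarrow>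
    ('a port \<Rightarrow> 'a port) \<Rightarrow> ('a, 'o) wiring" where
  "relabel X Y f g =
    \<lparr>wdom = X, wcod = Y, win = \<lambda>x \<in> ports (bin X). PR (f x), wout = \<lambda>y \<in> ports (bout Y). g y\<rparr>"

definition WD :: "('o, 'm) cat \<Rightarrow> (('a, 'o) box, ('a, 'o) wiring) smcat" where
  "WD C =
    \<lparr>Cat = WD_cat C,
     Tens = \<lparr>fo = \<lambda>(X, Y). box_sum X Y, fa = \<lambda>(\<phi>, \<psi>). wiring_sum \<phi> \<psi>\<rparr>,
     Unit = \<lparr>bin = tempty, bout = tempty\<rparr>,
     Assoc = (\<lambda>X Y Z. relabel (box_sum (box_sum X Y) Z) (box_sum X (box_sum Y Z))
                (pcase (pcase PL (PR \<circ> PL)) (PR \<circ> PR))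
                (pcase (PL \<circ> PL) (pcase (PL \<circ> PR) PR))),
     Lunit = (\<lambda>X. relabel (box_sum \<lparr>bin = tempty, bout = tempty\<rparr> X) X (pcase (\<lambda>_. undefined) id) PR),
     Runit = (\<lambda>X. relabel (box_sum X \<lparr>bin = tempty, bout = tempty\<rparr>) X (pcase id (\<lambda>_. undefined)) PL),
     Braid = (\<lambda>X Y. relabel (box_sum X Y) (box_sum Y X) (pcase PR PL) (pcase PR PL))\<rparr>"

definition WD_algebra ::
  "('c, 'd) cat \<Rightarrow> (('a, 'c) box, ('a, 'c) wiring, 'o, 'm) lax_data \<Rightarrow> bool" where
  "WD_algebra C F \<longleftrightarrow> (\<exists>K. symmetric_lax_monoidal_pseudofunctor (WD C) F K)"


section \<open>Discrete interval sheaves\<close>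

text \<open>\<open>Tr n' p n\<close> is the morphism \<open>Tr_p : n' \<rightarrow> n\<close>.\<close>

datatype trans = Tr (tsrc: nat) (toff: nat) (ttgt: nat)

definition IntN :: "(nat, trans) cat" where
  "IntN =
    \<lparr>Obj = UNIV,
     Arr = {t. tsrc t + toff t \<le> ttgt t},
     Dom = tsrc,
     Cod = ttgt,
     Ident = (\<lambda>n. Tr n 0 n),
     Comp = (\<lambda>t t'. Tr (tsrc t') (toff t + toff t') (ttgt t))\<rparr>"

text \<open>Presheaves on \<^term>\<open>IntN\<close>; for \<open>x \<in> Sec X n\<close>, the restriction of \<open>x\<close> to \<open>[p, p + n']\<close> is
  \<open>Res X (Tr n' p n) x\<close>. The values of \<open>Res X t\<close> for \<open>t\<close> not an arrow, and outside of the set of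
  sections over the codomain of \<open>t\<close>, are irrelevant.\<close>

record 'u psh =
  Sec :: "nat \<Rightarrow> 'u set"
  Res :: "trans \<Rightarrow> 'u \<Rightarrow> 'u"

definition presheaf :: "'u psh \<Rightarrow> bool" where
  "presheaf X \<longleftrightarrow>
    (\<forall>t \<in> Arr IntN. Res X t \<in> Sec X (Cod IntN t) \<rightarrow> Sec X (Dom IntN t)) \<and>
    (\<forall>n. \<forall>x \<in> Sec X n. Res X (Ident IntN n) x = x) \<and>
    (\<forall>t \<in> Arr IntN. \<forall>t' \<in> Arr IntN. Cod IntN t' = Dom IntN t \<longrightarrow>
       (\<forall>x \<in> Sec X (Cod IntN t). Res X (Comp IntN t t') x = Res X t' (Res X t x)))"

definition interval_sheaf :: "'u psh \<Rightarrow> bool" where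
  "interval_sheaf X \<longleftrightarrow> presheaf X \<and>
    (\<forall>n1 n2. \<forall>x1 \<in> Sec X n1. \<forall>x2 \<in> Sec X n2.
       Res X (Tr 0 n1 n1) x1 = Res X (Tr 0 0 n2) x2 \<longrightarrow>
       (\<exists>!x. x \<in> Sec X (n1 + n2) \<and>
             Res X (Tr n1 0 (n1 + n2)) x = x1 \<and> Res X (Tr n2 n1 (n1 + n2)) x = x2))"

text \<open>Maps of presheaves. The components are extensional functions so that equality of maps is
  equality of HOL terms.\<close>

record 'u pmap =
  mdom :: "'u psh"
  mcod :: "'u psh"
  app :: "nat \<Rightarrow> 'u \<Rightarrow> 'u"

definition natural :: "'u pmap \<Rightarrow> bool" where
  "natural f \<longleftrightarrow>
    (\<forall>n. app f n \<in> Sec (mdom f) n \<rightarrow>\<^sub>E Sec (mcod f) n) \<and>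
    (\<forall>t \<in> Arr IntN. \<forall>x \<in> Sec (mdom f) (Cod IntN t).
       app f (Dom IntN t) (Res (mdom f) t x) = Res (mcod f) t (app f (Cod IntN t) x))"

definition mk_map :: "'u psh \<Rightarrow> 'u psh \<Rightarrow> (nat \<Rightarrow> 'u \<Rightarrow> 'u) \<Rightarrow> 'u pmap" where
  "mk_map X Y h = \<lparr>mdom = X, mcod = Y, app = \<lambda>n. restrict (h n) (Sec X n)\<rparr>"

definition ShN :: "('u psh, 'u pmap) cat" where
  "ShN =
    \<lparr>Obj = {X. interval_sheaf X},
     Arr = {f. interval_sheaf (mdom f) \<and> interval_sheaf (mcod f) \<and> natural f},
     Dom = mdom,
     Cod = mcod,
     Ident = (\<lambda>X. mk_map X X (\<lambda>n x. x)),
     Comp = (\<lambda>g f. mk_map (mdom f) (mcod g) (\<lambda>n x. app g n (app f n x)))\<rparr>"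

abbreviation comp_map :: "'u pmap \<Rightarrow> 'u pmap \<Rightarrow> 'u pmap"  (infixr "\<odot>" 75) where
  "g \<odot> f \<equiv> Comp ShN g f"

definition Ext1 :: "'u psh \<Rightarrow> 'u psh" where
  "Ext1 X = \<lparr>Sec = \<lambda>n. Sec X (n + 1), Res = \<lambda>t. Res X (Tr (tsrc t + 1) (toff t) (ttgt t + 1))\<rparr>"

definition Ext1_map :: "'u pmap \<Rightarrow> 'u pmap" where
  "Ext1_map f = \<lparr>mdom = Ext1 (mdom f), mcod = Ext1 (mcod f), app = \<lambda>n. app f (n + 1)\<rparr>"

definition lam :: "'u psh \<Rightarrow> 'u pmap" where
  "lam X = mk_map (Ext1 X) X (\<lambda>n x. Res X (Tr n 0 (n + 1)) x)"


section \<open>Products and pullbacks of sheaves\<close>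

text \<open>A universe of sections, closed under pairing and families indexed by ports. Sheaves with
  sections in this type thus have finite limits, computed pointwise.\<close>

datatype 'a val = Atom 'a | VPair (vfst: "'a val") (vsnd: "'a val") | Fam (fam: "'a port \<Rightarrow> 'a val")

type_synonym 'a sh = "'a val psh"
type_synonym 'a shmap = "'a val pmap"

definition prod_sh :: "'a sh \<Rightarrow> 'a sh \<Rightarrow> 'a sh"  (infixr "\<times>\<^sub>S" 70) where
  "X \<times>\<^sub>S Y =
    \<lparr>Sec = \<lambda>n. {VPair x y | x y. x \<in> Sec X n \<and> y \<in> Sec Y n},
     Res = \<lambda>t v. VPair (Res X t (vfst v)) (Res Y t (vsnd v))\<rparr>"

definition prj1 :: "'a sh \<Rightarrow> 'a sh \<Rightarrow> 'a shmap" where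
  "prj1 X Y = mk_map (X \<times>\<^sub>S Y) X (\<lambda>n. vfst)"

definition prj2 :: "'a sh \<Rightarrow> 'a sh \<Rightarrow> 'a shmap" where
  "prj2 X Y = mk_map (X \<times>\<^sub>S Y) Y (\<lambda>n. vsnd)"

definition pair_map :: "'a shmap \<Rightarrow> 'a shmap \<Rightarrow> 'a shmap" where
  "pair_map f g = mk_map (mdom f) (mcod f \<times>\<^sub>S mcod g) (\<lambda>n x. VPair (app f n x) (app g n x))"

definition prod_map :: "'a shmap \<Rightarrow> 'a shmap \<Rightarrow> 'a shmap" where
  "prod_map f g = mk_map (mdom f \<times>\<^sub>S mdom g) (mcod f \<times>\<^sub>S mcod g)
     (\<lambda>n v. VPair (app f n (vfst v)) (app g n (vsnd v)))"

definition pb :: "'a shmap \<Rightarrow> 'a shmap \<Rightarrow> 'a sh" where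
  "pb f g =
    \<lparr>Sec = \<lambda>n. {VPair x y | x y. x \<in> Sec (mdom f) n \<and> y \<in> Sec (mdom g) n \<and> app f n x = app g n y},
     Res = \<lambda>t v. VPair (Res (mdom f) t (vfst v)) (Res (mdom g) t (vsnd v))\<rparr>"

definition pb_prj2 :: "'a shmap \<Rightarrow> 'a shmap \<Rightarrow> 'a shmap" where
  "pb_prj2 f g = mk_map (pb f g) (mdom g) (\<lambda>n. vsnd)"

definition hat :: "('a, 'a sh) tset \<Rightarrow> 'a sh" where
  "hat X =
    \<lparr>Sec = \<lambda>n. Fam ` (\<Pi>\<^sub>E x \<in> ports X. Sec (ty X x) n),
     Res = \<lambda>t v. Fam (\<lambda>x \<in> ports X. Res (ty X x) t (fam v x))\<rparr>"

definition hat_map :: "('a, 'a sh) tset \<Rightarrow> ('a, 'a sh) tset \<Rightarrow> ('a port \<Rightarrow> 'a port) \<Rightarrow> 'a shmap" where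
  "hat_map X X' f = mk_map (hat X') (hat X) (\<lambda>n v. Fam (\<lambda>x \<in> ports X. fam v (f x)))"

text \<open>The isomorphism \<open>hat X \<times> hat Y \<rightarrow> hat (X + Y)\<close>.\<close>

definition hat_join :: "('a, 'a sh) tset \<Rightarrow> ('a, 'a sh) tset \<Rightarrow> 'a shmap" where
  "hat_join X Y = mk_map (hat X \<times>\<^sub>S hat Y) (hat (X \<uplus> Y))
     (\<lambda>n v. Fam (\<lambda>x \<in> ports (X \<uplus> Y). pcase (fam (vfst v)) (fam (vsnd v)) x))"

definition swap_map :: "'a sh \<Rightarrow> 'a sh \<Rightarrow> 'a shmap" where
  "swap_map X Y = pair_map (prj2 X Y) (prj1 X Y)"

text \<open>The isomorphism \<open>(A \<times> B) \<times> (A' \<times> B') \<rightarrow> (A \<times> A') \<times> (B \<times> B')\<close>.\<close>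

definition interchange :: "'a sh \<Rightarrow> 'a sh \<Rightarrow> 'a sh \<Rightarrow> 'a sh \<Rightarrow> 'a shmap" where
  "interchange A B A' B' =
     pair_map (prod_map (prj1 A B) (prj1 A' B')) (prod_map (prj2 A B) (prj2 A' B'))"


section \<open>The algebra of span systems\<close>

type_synonym 'a sbox = "('a, 'a sh) box"
type_synonym 'a swiring = "('a, 'a sh) wiring"

text \<open>\<open>hat_in \<phi> : hat Y\<^sup>i\<^sup>n \<times> hat X\<^sup>o\<^sup>u\<^sup>t \<rightarrow> hat X\<^sup>i\<^sup>n\<close> and \<open>hat_out \<phi> : hat X\<^sup>o\<^sup>u\<^sup>t \<rightarrow> hat Y\<^sup>o\<^sup>u\<^sup>t\<close> for
  \<open>\<phi> : X \<rightarrow> Y\<close>.\<close>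

definition hat_in :: "'a swiring \<Rightarrow> 'a shmap" where
  "hat_in \<phi> = (let X = wdom \<phi>; Y = wcod \<phi> in
     hat_map (bin X) (bout X \<uplus> bin Y) (win \<phi>) \<odot> hat_join (bout X) (bin Y) \<odot>
     swap_map (hat (bin Y)) (hat (bout X)))"

definition hat_out :: "'a swiring \<Rightarrow> 'a shmap" where
  "hat_out \<phi> = hat_map (bout (wcod \<phi>)) (bout (wdom \<phi>)) (wout \<phi>)"

definition span_base :: "'a sbox \<Rightarrow> 'a sh" where
  "span_base X = hat (bin X) \<times>\<^sub>S hat (bout X)"

definition pull_leg :: "'a swiring \<Rightarrow> 'a shmap" where
  "pull_leg \<phi> = pair_map (hat_in \<phi>) (prj2 (hat (bin (wcod \<phi>))) (hat (bout (wdom \<phi>))))"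

definition push_leg :: "'a swiring \<Rightarrow> 'a shmap" where
  "push_leg \<phi> = prod_map (Ident ShN (hat (bin (wcod \<phi>)))) (hat_out \<phi>)"

definition span_act_obj :: "'a swiring \<Rightarrow> 'a shmap \<Rightarrow> 'a shmap" where
  "span_act_obj \<phi> p = push_leg \<phi> \<odot> pb_prj2 p (pull_leg \<phi>)"

definition span_act :: "'a swiring \<Rightarrow>
    ('a shmap, 'a shmap \<times> 'a shmap \<times> 'a shmap, 'a shmap, 'a shmap \<times> 'a shmap \<times> 'a shmap) func" where
  "span_act \<phi> =
    \<lparr>fo = span_act_obj \<phi>,
     fa = \<lambda>(p, f, q).
       (span_act_obj \<phi> p,
        mk_map (pb p (pull_leg \<phi>)) (pb q (pull_leg \<phi>)) (\<lambda>n v. VPair (app f n (vfst v)) (vsnd v)),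
        span_act_obj \<phi> q)\<rparr>"

definition span_mu_obj :: "'a sbox \<Rightarrow> 'a sbox \<Rightarrow> 'a shmap \<Rightarrow> 'a shmap \<Rightarrow> 'a shmap" where
  "span_mu_obj X Y p q =
     prod_map (hat_join (bin X) (bin Y)) (hat_join (bout X) (bout Y)) \<odot>
     interchange (hat (bin X)) (hat (bout X)) (hat (bin Y)) (hat (bout Y)) \<odot> prod_map p q"

definition Mch_N :: "('a sbox, 'a swiring, 'a shmap, 'a shmap \<times> 'a shmap \<times> 'a shmap) lax_data" where
  "Mch_N =
    \<lparr>FO = \<lambda>X. slice ShN (span_base X),
     FA = span_act,
     mu = \<lambda>X Y.
       \<lparr>fo = \<lambda>(p, q). span_mu_obj X Y p q,
        fa = \<lambda>((p, f, p'), (q, g, q')). (span_mu_obj X Y p q, prod_map f g, span_mu_obj X Y p' q')\<rparr>,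
     eta = pair_map (Ident ShN (hat tempty)) (Ident ShN (hat tempty))\<rparr>"


section \<open>Classes of machines\<close>

definition h1 :: "'a shmap \<Rightarrow> 'a shmap" where
  "h1 p = mk_map (Ext1 (mdom p)) (pb (lam (mcod p)) p)
     (\<lambda>n x. VPair (app (Ext1_map p) n x) (app (lam (mdom p)) n x))"

definition total_map :: "'a shmap \<Rightarrow> bool" where
  "total_map p \<longleftrightarrow> epic ShN (h1 p)"

definition deterministic_map :: "'a shmap \<Rightarrow> bool" where
  "deterministic_map p \<longleftrightarrow> monic ShN (h1 p)"

definition inertial_map :: "'a shmap \<Rightarrow> bool" where
  "inertial_map p \<longleftrightarrow> (\<exists>q \<in> hom ShN (mdom p) (Ext1 (mcod p)). p = lam (mcod p) \<odot> q)"

definition machine :: "'a sh \<Rightarrow> 'a sh \<Rightarrow> 'a shmap \<Rightarrow> bool" where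
  "machine A B p \<longleftrightarrow> A \<in> Obj ShN \<and> B \<in> Obj ShN \<and> p \<in> Arr ShN \<and> Cod ShN p = A \<times>\<^sub>S B"

definition inertial_machine :: "'a sh \<Rightarrow> 'a sh \<Rightarrow> 'a shmap \<Rightarrow> bool" where
  "inertial_machine A B p \<longleftrightarrow> machine A B p \<and> inertial_map (prj2 A B \<odot> p)"

definition total_machine :: "'a sh \<Rightarrow> 'a sh \<Rightarrow> 'a shmap \<Rightarrow> bool" where
  "total_machine A B p \<longleftrightarrow>
     machine A B p \<and> inertial_map (prj2 A B \<odot> p) \<and> total_map (prj1 A B \<odot> p)"

definition deterministic_machine :: "'a sh \<Rightarrow> 'a sh \<Rightarrow> 'a shmap \<Rightarrow> bool" where
  "deterministic_machine A B p \<longleftrightarrow>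
     machine A B p \<and> inertial_map (prj2 A B \<odot> p) \<and> deterministic_map (prj1 A B \<odot> p)"

definition Mch_in :: "'a sbox \<Rightarrow> 'a shmap set" where
  "Mch_in X = {p. inertial_machine (hat (bin X)) (hat (bout X)) p}"

definition Mch_t :: "'a sbox \<Rightarrow> 'a shmap set" where
  "Mch_t X = {p. total_machine (hat (bin X)) (hat (bout X)) p}"

definition Mch_d :: "'a sbox \<Rightarrow> 'a shmap set" where
  "Mch_d X = {p. deterministic_machine (hat (bin X)) (hat (bout X)) p}"

definition Mch_td :: "'a sbox \<Rightarrow> 'a shmap set" where
  "Mch_td X = Mch_t X \<inter> Mch_d X"

end

theory Submission
  imports Defs
begin

text \<open>Every section of a composite of machines is built from sections of the constituent machines,
  collected in its label, and from an input; the label alone determines its output. Forgetting all but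
  label, input and output, a composite machine becomes a relation, and on relations the structure of
  the algebra is strict. Hence there is exactly one label-preserving isomorphism between two ways of
  forming the same composite. These isomorphisms are the \<open>2\<close>-cells, and every coherence axiom holds
  because both of its sides preserve labels.

  A map is total (deterministic) if and only if each of its states has a lifting (at most one lifting)
  along each compatible input of length \<open>1\<close>. An inertial machine determines its output on \<open>[0, 1]\<close>
  from its state at \<open>0\<close>. Hence, even with feedback, its input on \<open>[0, 1]\<close> is known before the state
  is lifted.\<close>

section \<open>Interval sheaves\<close>

text \<open>Composites are nested pullbacks and products of sheaves, so two ways of forming the same
  composite differ by re-bracketing of sections, and the axioms combine these isomorphisms with
  their inverses. Uniqueness replaces calculation: an arrow of machines preserves inputs, and label
  and input together fix a state. Tags distinguish constituents that may have states in common;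
  without them the label of a parallel composite could not be split into its parts. A naturality
  square also contains an arrow without a given label; its source receives the label pulled back
  from its target.

  For the classes of machines the obstacle is that \<open>epic\<close> and \<open>monic\<close> are
  defined by cancellation, so test sheaves have to be built inside \<open>'a val\<close>. An
  epimorphism need not be surjective on sections of every length: the pieces of a path may have
  preimages that do not fit together. Only length 0 is therefore tested. This suffices for
  \<open>h1\<close>, because a section of its codomain is a state together with an input that is one
  unit longer, and gluing reduces the lifting to that last unit.\<close>

lemma Arr_IntN [simp]: "t \<in> Arr IntN \<longleftrightarrow> tsrc t + toff t \<le> ttgt t"
  and Dom_IntN [simp]: "Dom IntN = tsrc"
  and Cod_IntN [simp]: "Cod IntN = ttgt"
  and Ident_IntN [simp]: "Ident IntN n = Tr n 0 n"
  and Comp_IntN [simp]: "Comp IntN t t' = Tr (tsrc t') (toff t + toff t') (ttgt t)"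
  by (simp_all add: IntN_def)

lemma presheafI:
  assumes "\<And>n' p n x. n' + p \<le> n \<Longrightarrow> x \<in> Sec X n \<Longrightarrow> Res X (Tr n' p n) x \<in> Sec X n'"
    and "\<And>n x. x \<in> Sec X n \<Longrightarrow> Res X (Tr n 0 n) x = x"
    and "\<And>n'' p' n' p n x. n'' + p' \<le> n' \<Longrightarrow> n' + p \<le> n \<Longrightarrow> x \<in> Sec X n \<Longrightarrow>
      Res X (Tr n'' (p + p') n) x = Res X (Tr n'' p' n') (Res X (Tr n' p n) x)"
  shows "presheaf X"
  unfolding presheaf_def
proof (intro conjI ballI allI impI funcsetI)
  fix t x assume "t \<in> Arr IntN" "x \<in> Sec X (Cod IntN t)"
  then show "Res X t x \<in> Sec X (Dom IntN t)"
    using assms(1) by (cases t) auto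
next
  fix t t' x assume "t \<in> Arr IntN" "t' \<in> Arr IntN" "Cod IntN t' = Dom IntN t" "x \<in> Sec X (Cod IntN t)"
  then show "Res X (Comp IntN t t') x = Res X t' (Res X t x)"
    using assms(3) by (cases t; cases t') auto
qed (use assms(2) in auto)

lemma presheaf_Res:
  assumes "presheaf X" "n' + p \<le> n" "x \<in> Sec X n"
  shows "Res X (Tr n' p n) x \<in> Sec X n'"
proof -
  have "Res X (Tr n' p n) \<in> Sec X n \<rightarrow> Sec X n'"
    using assms(1,2) unfolding presheaf_def
    by (metis Arr_IntN Cod_IntN Dom_IntN trans.sel)
  then show ?thesis using assms(3) by blast
qed

lemma presheaf_Res_id:
  assumes "presheaf X" "x \<in> Sec X n"
  shows "Res X (Tr n 0 n) x = x"
  using assms unfolding presheaf_def by simp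

lemma presheaf_Res_Res:
  assumes "presheaf X" "n'' + p' \<le> n'" "n' + p \<le> n" "x \<in> Sec X n"
  shows "Res X (Tr n'' p' n') (Res X (Tr n' p n) x) = Res X (Tr n'' (p + p') n) x"
proof -
  have "\<forall>t \<in> Arr IntN. \<forall>t' \<in> Arr IntN. Cod IntN t' = Dom IntN t \<longrightarrow>
       (\<forall>x \<in> Sec X (Cod IntN t). Res X (Comp IntN t t') x = Res X t' (Res X t x))"
    using assms(1) unfolding presheaf_def by blast
  from this[rule_format, of "Tr n' p n" "Tr n'' p' n'" x] show ?thesis using assms by simp
qed

text \<open>Unique gluing is split into existence and separation, the two halves that are checked
  componentwise for products, pullbacks and families.\<close>

lemma interval_sheafI:
  assumes "presheaf X"
    and "\<And>n1 n2 x1 x2. x1 \<in> Sec X n1 \<Longrightarrow> x2 \<in> Sec X n2 \<Longrightarrow>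
      Res X (Tr 0 n1 n1) x1 = Res X (Tr 0 0 n2) x2 \<Longrightarrow>
      \<exists>x \<in> Sec X (n1 + n2). Res X (Tr n1 0 (n1 + n2)) x = x1 \<and> Res X (Tr n2 n1 (n1 + n2)) x = x2"
    and "\<And>n1 n2 x y. x \<in> Sec X (n1 + n2) \<Longrightarrow> y \<in> Sec X (n1 + n2) \<Longrightarrow>
      Res X (Tr n1 0 (n1 + n2)) x = Res X (Tr n1 0 (n1 + n2)) y \<Longrightarrow>
      Res X (Tr n2 n1 (n1 + n2)) x = Res X (Tr n2 n1 (n1 + n2)) y \<Longrightarrow> x = y"
  shows "interval_sheaf X"
  unfolding interval_sheaf_def using assms by (intro conjI allI ballI impI) (blast, metis)

lemma sheaf_presheaf: "interval_sheaf X \<Longrightarrow> presheaf X"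
  by (simp add: interval_sheaf_def)

lemmas sheaf_Res = presheaf_Res[OF sheaf_presheaf]
lemmas sheaf_Res_id = presheaf_Res_id[OF sheaf_presheaf]
lemmas sheaf_Res_Res = presheaf_Res_Res[OF sheaf_presheaf]

lemma sheaf_glue:
  assumes "interval_sheaf X" "x1 \<in> Sec X n1" "x2 \<in> Sec X n2"
    "Res X (Tr 0 n1 n1) x1 = Res X (Tr 0 0 n2) x2"
  obtains x where "x \<in> Sec X (n1 + n2)" "Res X (Tr n1 0 (n1 + n2)) x = x1"
    "Res X (Tr n2 n1 (n1 + n2)) x = x2"
  using assms unfolding interval_sheaf_def by metis

lemma sheaf_separated:
  assumes X: "interval_sheaf X" and x: "x \<in> Sec X (n1 + n2)" and y: "y \<in> Sec X (n1 + n2)"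
    and 1: "Res X (Tr n1 0 (n1 + n2)) x = Res X (Tr n1 0 (n1 + n2)) y"
    and 2: "Res X (Tr n2 n1 (n1 + n2)) x = Res X (Tr n2 n1 (n1 + n2)) y"
  shows "x = y"
proof -
  let ?x1 = "Res X (Tr n1 0 (n1 + n2)) x" and ?x2 = "Res X (Tr n2 n1 (n1 + n2)) x"
  have "?x1 \<in> Sec X n1" "?x2 \<in> Sec X n2" "Res X (Tr 0 n1 n1) ?x1 = Res X (Tr 0 0 n2) ?x2"
    using X x by (simp_all add: sheaf_Res sheaf_Res_Res)
  then have "\<exists>!z. z \<in> Sec X (n1 + n2) \<and> Res X (Tr n1 0 (n1 + n2)) z = ?x1 \<and>
      Res X (Tr n2 n1 (n1 + n2)) z = ?x2"
    using X unfolding interval_sheaf_def by blast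
  then show ?thesis using x y 1 2 by metis
qed

section \<open>Maps of sheaves, their category and its slices\<close>

lemma natural_app:
  "natural f \<Longrightarrow> x \<in> Sec (mdom f) n \<Longrightarrow> app f n x \<in> Sec (mcod f) n"
  unfolding natural_def by blast

lemma natural_Res:
  assumes "natural f" "n' + p \<le> n" "x \<in> Sec (mdom f) n"
  shows "app f n' (Res (mdom f) (Tr n' p n) x) = Res (mcod f) (Tr n' p n) (app f n x)"
proof -
  have "Tr n' p n \<in> Arr IntN" "x \<in> Sec (mdom f) (Cod IntN (Tr n' p n))" using assms by simp_all
  then show ?thesis using assms(1) unfolding natural_def by fastforce
qed

lemma hom_ShN:
  "f \<in> hom ShN X Y \<longleftrightarrow>
    interval_sheaf X \<and> interval_sheaf Y \<and> mdom f = X \<and> mcod f = Y \<and> natural f"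
  by (auto simp: hom_def ShN_def)

lemma Arr_ShN: "f \<in> Arr ShN \<longleftrightarrow> interval_sheaf (mdom f) \<and> interval_sheaf (mcod f) \<and> natural f"
  and Dom_ShN [simp]: "Dom ShN = mdom"
  and Cod_ShN [simp]: "Cod ShN = mcod"
  and Obj_ShN: "X \<in> Obj ShN \<longleftrightarrow> interval_sheaf X"
  by (auto simp: ShN_def)

lemma mdom_hom: "f \<in> hom ShN X Y \<Longrightarrow> mdom f = X" and mcod_hom: "f \<in> hom ShN X Y \<Longrightarrow> mcod f = Y"
  and hom_sheaf_dom: "f \<in> hom ShN X Y \<Longrightarrow> interval_sheaf X"
  and hom_sheaf_cod: "f \<in> hom ShN X Y \<Longrightarrow> interval_sheaf Y"
  by (auto simp: hom_ShN)

lemma hom_app_PiE: "f \<in> hom ShN X Y \<Longrightarrow> app f n \<in> Sec X n \<rightarrow>\<^sub>E Sec Y n"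
  unfolding hom_ShN natural_def by metis

lemma hom_app: "f \<in> hom ShN X Y \<Longrightarrow> x \<in> Sec X n \<Longrightarrow> app f n x \<in> Sec Y n"
  using natural_app by (auto simp: hom_ShN)

lemma hom_Res:
  "f \<in> hom ShN X Y \<Longrightarrow> n' + p \<le> n \<Longrightarrow> x \<in> Sec X n \<Longrightarrow>
    app f n' (Res X (Tr n' p n) x) = Res Y (Tr n' p n) (app f n x)"
  using natural_Res by (auto simp: hom_ShN)

lemma map_eqI:
  assumes f: "f \<in> hom ShN X Y" and g: "g \<in> hom ShN X Y"
    and eq: "\<And>n x. x \<in> Sec X n \<Longrightarrow> app f n x = app g n x"
  shows "f = g"
proof -
  have "app f n \<in> Sec X n \<rightarrow>\<^sub>E Sec Y n" "app g n \<in> Sec X n \<rightarrow>\<^sub>E Sec Y n" for n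
    using f g by (simp_all add: hom_app_PiE)
  then have "app f n = app g n" for n
    using eq by (rule PiE_ext)
  then have "app f = app g" by (rule ext)
  then show ?thesis
    by (intro pmap.equality) (simp_all add: mdom_hom[OF f] mdom_hom[OF g] mcod_hom[OF f] mcod_hom[OF g])
qed

lemma mdom_mk_map [simp]: "mdom (mk_map X Y h) = X"
  and mcod_mk_map [simp]: "mcod (mk_map X Y h) = Y"
  and app_mk_map: "x \<in> Sec X n \<Longrightarrow> app (mk_map X Y h) n x = h n x"
  by (simp_all add: mk_map_def)

lemma mk_map_hom:
  assumes "interval_sheaf X" "interval_sheaf Y"
    and "\<And>n x. x \<in> Sec X n \<Longrightarrow> h n x \<in> Sec Y n"
    and "\<And>n' p n x. n' + p \<le> n \<Longrightarrow> x \<in> Sec X n \<Longrightarrow>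
      h n' (Res X (Tr n' p n) x) = Res Y (Tr n' p n) (h n x)"
  shows "mk_map X Y h \<in> hom ShN X Y"
  unfolding hom_ShN natural_def
proof (intro conjI allI ballI)
  fix t x assume t: "t \<in> Arr IntN" and x: "x \<in> Sec (mdom (mk_map X Y h)) (Cod IntN t)"
  obtain n' p n where "t = Tr n' p n" by (cases t)
  then show "app (mk_map X Y h) (Dom IntN t) (Res (mdom (mk_map X Y h)) t x) =
      Res (mcod (mk_map X Y h)) t (app (mk_map X Y h) (Cod IntN t) x)"
    using t x assms by (simp add: app_mk_map sheaf_Res)
qed (use assms in \<open>auto simp: mk_map_def\<close>)

lemma Ident_ShN: "Ident ShN X = mk_map X X (\<lambda>n x. x)"
  and Comp_ShN: "g \<odot> f = mk_map (mdom f) (mcod g) (\<lambda>n x. app g n (app f n x))"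
  by (simp_all add: ShN_def)

lemma app_Ident: "x \<in> Sec X n \<Longrightarrow> app (Ident ShN X) n x = x"
  by (simp add: Ident_ShN app_mk_map)

lemma app_Comp: "x \<in> Sec (mdom f) n \<Longrightarrow> app (g \<odot> f) n x = app g n (app f n x)"
  by (simp add: Comp_ShN app_mk_map)

lemma mdom_Comp [simp]: "mdom (g \<odot> f) = mdom f" and mcod_Comp [simp]: "mcod (g \<odot> f) = mcod g"
  and mdom_Ident [simp]: "mdom (Ident ShN X) = X" and mcod_Ident [simp]: "mcod (Ident ShN X) = X"
  by (simp_all add: Ident_ShN Comp_ShN)

lemma Ident_hom: "interval_sheaf X \<Longrightarrow> Ident ShN X \<in> hom ShN X X"
  unfolding Ident_ShN by (rule mk_map_hom) auto

lemma Comp_hom: "f \<in> hom ShN X Y \<Longrightarrow> g \<in> hom ShN Y Z \<Longrightarrow> g \<odot> f \<in> hom ShN X Z"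
  unfolding Comp_ShN mdom_hom[of f X Y] mcod_hom[of g Y Z]
  by (rule mk_map_hom) (auto simp: hom_sheaf_dom hom_sheaf_cod hom_app hom_Res)

lemma category_ShN: "category ShN"
proof
  fix f g h and a b c d :: "'a psh"
  assume f: "f \<in> hom ShN a b"
  show "f \<odot> Ident ShN a = f"
    by (rule map_eqI[OF Comp_hom[OF Ident_hom f] f])
      (use f in \<open>auto simp: app_Comp app_Ident hom_ShN\<close>)
  show "Ident ShN b \<odot> f = f"
    by (rule map_eqI[OF Comp_hom[OF f Ident_hom] f])
      (use f in \<open>auto simp: app_Comp app_Ident hom_ShN natural_app\<close>)
  assume g: "g \<in> hom ShN b c"
  show "g \<odot> f \<in> hom ShN a c" by (rule Comp_hom[OF f g])
  assume h: "h \<in> hom ShN c d"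
  show "h \<odot> g \<odot> f = (h \<odot> g) \<odot> f"
    by (rule map_eqI[OF Comp_hom[OF Comp_hom[OF f g] h] Comp_hom[OF f Comp_hom[OF g h]]])
      (use mdom_hom[OF f] mdom_hom[OF g] mdom_hom[OF h] hom_app[OF f] hom_app[OF g]
        in \<open>auto simp: app_Comp\<close>)
qed (auto simp: Arr_ShN Obj_ShN Ident_hom)

lemma category_slice:
  assumes "category C"
  shows "category (slice C b)"
proof -
  interpret category C by fact
  show ?thesis
  proof
    fix f g h and p q r s
    assume f: "f \<in> hom (slice C b) p q"
    then obtain f0 where f0: "f = (p, f0, q)" "f0 \<in> hom C (Dom C p) (Dom C q)"
      by (auto simp: hom_def slice_def)
    show "Comp (slice C b) f (Ident (slice C b) p) = f"
      using comp_ident_right[OF f0(2)] f0(1) by (simp add: slice_def)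
    show "Comp (slice C b) (Ident (slice C b) q) f = f"
      using comp_ident_left[OF f0(2)] f0(1) by (simp add: slice_def)
    assume g: "g \<in> hom (slice C b) q r"
    then obtain g0 where g0: "g = (q, g0, r)" "g0 \<in> hom C (Dom C q) (Dom C r)"
      by (auto simp: hom_def slice_def)
    have "r \<in> hom C (Dom C r) b" using g by (auto simp: hom_def slice_def)
    from comp_assoc[OF f0(2) g0(2) this] comp_hom[OF f0(2) g0(2)] f g
    show "Comp (slice C b) g f \<in> hom (slice C b) p r"
      by (auto simp: slice_def hom_def f0(1) g0(1))
    assume h: "h \<in> hom (slice C b) r s"
    then obtain h0 where "h = (r, h0, s)" "h0 \<in> hom C (Dom C r) (Dom C s)"
      by (auto simp: hom_def slice_def)
    then show "Comp (slice C b) h (Comp (slice C b) g f) = Comp (slice C b) (Comp (slice C b) h g) f"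
      using comp_assoc[OF f0(2) g0(2)] by (simp add: slice_def f0(1) g0(1))
  next
    fix p assume "p \<in> Obj (slice C b)"
    then have p: "p \<in> hom C (Dom C p) b" by (simp add: slice_def hom_def)
    with ident_hom[OF dom_obj, of p] comp_ident_right[OF p]
    show "Ident (slice C b) p \<in> hom (slice C b) p p"
      by (auto simp: slice_def hom_def)
  qed (auto simp: slice_def)
qed

text \<open>Sections of \<open>Ext1 X\<close> that match at a point are sections of \<open>X\<close>
  that agree on a whole unit interval. They are glued after the overlap has been removed from the
  second one.\<close>

lemma sheaf_Ext1:
  assumes X: "interval_sheaf X"
  shows "interval_sheaf (Ext1 X)"
proof (rule interval_sheafI)
  show "presheaf (Ext1 X)"
    by (rule presheafI) (auto simp: Ext1_def sheaf_Res[OF X] sheaf_Res_id[OF X] sheaf_Res_Res[OF X])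
next
  fix n1 n2 x1 x2
  assume x1: "x1 \<in> Sec (Ext1 X) n1" and x2: "x2 \<in> Sec (Ext1 X) n2"
    and "Res (Ext1 X) (Tr 0 n1 n1) x1 = Res (Ext1 X) (Tr 0 0 n2) x2"
  then have x: "x1 \<in> Sec X (n1 + 1)" "x2 \<in> Sec X (n2 + 1)"
    and eq: "Res X (Tr 1 n1 (n1 + 1)) x1 = Res X (Tr 1 0 (n2 + 1)) x2"
    by (simp_all add: Ext1_def)
  \<comment> \<open>Dropping the first unit of \<open>x2\<close> leaves a section that starts at n1
    + 1, exactly where \<open>x1\<close> ends.\<close>
  let ?y = "Res X (Tr n2 1 (n2 + 1)) x2"
  have y: "?y \<in> Sec X n2" using x by (simp add: sheaf_Res[OF X])
  have "Res X (Tr 0 (n1 + 1) (n1 + 1)) x1 = Res X (Tr 0 1 1) (Res X (Tr 1 n1 (n1 + 1)) x1)"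
    using x by (simp add: sheaf_Res_Res[OF X])
  also have "\<dots> = Res X (Tr 0 0 n2) ?y"
    unfolding eq using x by (simp add: sheaf_Res_Res[OF X])
  finally obtain z where z: "z \<in> Sec X (n1 + 1 + n2)" "Res X (Tr (n1 + 1) 0 (n1 + 1 + n2)) z = x1"
      "Res X (Tr n2 (n1 + 1) (n1 + 1 + n2)) z = ?y"
    using sheaf_glue[OF X x(1) y] by blast
  \<comment> \<open>The removed overlap is recovered: the two sections agree on their first unit by
    \<open>eq\<close> and on the rest by construction, and \<open>X\<close> is separated.\<close>
  have "Res X (Tr (1 + n2) n1 (n1 + 1 + n2)) z = x2"
  proof (rule sheaf_separated[OF X, of _ 1 n2])
    show "Res X (Tr (1 + n2) n1 (n1 + 1 + n2)) z \<in> Sec X (1 + n2)"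
      using z by (simp add: sheaf_Res[OF X])
    show "x2 \<in> Sec X (1 + n2)" using x by simp
    have "Res X (Tr 1 0 (1 + n2)) (Res X (Tr (1 + n2) n1 (n1 + 1 + n2)) z) =
        Res X (Tr 1 n1 (n1 + 1)) (Res X (Tr (n1 + 1) 0 (n1 + 1 + n2)) z)"
      using z(1) by (subst (1 2) sheaf_Res_Res[OF X]) auto
    then show "Res X (Tr 1 0 (1 + n2)) (Res X (Tr (1 + n2) n1 (n1 + 1 + n2)) z) =
        Res X (Tr 1 0 (1 + n2)) x2"
      using eq z(2) by simp
    show "Res X (Tr n2 1 (1 + n2)) (Res X (Tr (1 + n2) n1 (n1 + 1 + n2)) z) =
        Res X (Tr n2 1 (1 + n2)) x2"
      using z(1,3) by (subst sheaf_Res_Res[OF X]) auto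
  qed
  with z show "\<exists>x \<in> Sec (Ext1 X) (n1 + n2). Res (Ext1 X) (Tr n1 0 (n1 + n2)) x = x1 \<and>
      Res (Ext1 X) (Tr n2 n1 (n1 + n2)) x = x2"
    by (intro bexI[of _ z]) (simp_all add: Ext1_def)
next
  fix n1 n2 x y
  assume "x \<in> Sec (Ext1 X) (n1 + n2)" "y \<in> Sec (Ext1 X) (n1 + n2)"
    "Res (Ext1 X) (Tr n1 0 (n1 + n2)) x = Res (Ext1 X) (Tr n1 0 (n1 + n2)) y"
    "Res (Ext1 X) (Tr n2 n1 (n1 + n2)) x = Res (Ext1 X) (Tr n2 n1 (n1 + n2)) y"
  then have x: "x \<in> Sec X (n1 + (1 + n2))" "y \<in> Sec X (n1 + (1 + n2))"
    and eq: "Res X (Tr (1 + n1) 0 (n1 + (1 + n2))) x = Res X (Tr (1 + n1) 0 (n1 + (1 + n2))) y"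
      "Res X (Tr (1 + n2) n1 (n1 + (1 + n2))) x = Res X (Tr (1 + n2) n1 (n1 + (1 + n2))) y"
    by (simp_all add: Ext1_def)
  \<comment> \<open>Separation in \<open>X\<close> cuts at a single point, so the left halves, which
    overlap the right halves by one unit, are shortened by that unit.\<close>
  have "Res X (Tr n1 0 (n1 + (1 + n2))) z =
      Res X (Tr n1 0 (1 + n1)) (Res X (Tr (1 + n1) 0 (n1 + (1 + n2))) z)"
    if "z \<in> Sec X (n1 + (1 + n2))" for z
    using that by (simp add: sheaf_Res_Res[OF X])
  then show "x = y" using sheaf_separated[OF X x] x eq by simp
qed

lemma lam_hom: "interval_sheaf X \<Longrightarrow> lam X \<in> hom ShN (Ext1 X) X"
  unfolding lam_def
  by (rule mk_map_hom[OF sheaf_Ext1]) (auto simp: Ext1_def sheaf_Res sheaf_Res_Res)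

section \<open>Products and pullbacks of sheaves\<close>

lemma prod_sh_simps:
  "Sec (X \<times>\<^sub>S Y) n = {VPair x y | x y. x \<in> Sec X n \<and> y \<in> Sec Y n}"
  "Res (X \<times>\<^sub>S Y) t v = VPair (Res X t (vfst v)) (Res Y t (vsnd v))"
  by (simp_all add: prod_sh_def)

lemma pb_simps:
  "Sec (pb f g) n =
    {VPair x y | x y. x \<in> Sec (mdom f) n \<and> y \<in> Sec (mdom g) n \<and> app f n x = app g n y}"
  "Res (pb f g) t v = VPair (Res (mdom f) t (vfst v)) (Res (mdom g) t (vsnd v))"
  by (simp_all add: pb_def)

lemma sheaf_prod:
  assumes X: "interval_sheaf X" and Y: "interval_sheaf Y"
  shows "interval_sheaf (X \<times>\<^sub>S Y)"
proof (rule interval_sheafI)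
  show "presheaf (X \<times>\<^sub>S Y)"
    by (rule presheafI)
      (use X Y in \<open>auto simp: prod_sh_simps sheaf_Res sheaf_Res_id sheaf_Res_Res\<close>)
next
  fix n1 n2 v1 v2
  assume "v1 \<in> Sec (X \<times>\<^sub>S Y) n1" "v2 \<in> Sec (X \<times>\<^sub>S Y) n2"
    and "Res (X \<times>\<^sub>S Y) (Tr 0 n1 n1) v1 = Res (X \<times>\<^sub>S Y) (Tr 0 0 n2) v2"
  then obtain x1 y1 x2 y2 where v: "v1 = VPair x1 y1" "v2 = VPair x2 y2"
    and x: "x1 \<in> Sec X n1" "x2 \<in> Sec X n2" "Res X (Tr 0 n1 n1) x1 = Res X (Tr 0 0 n2) x2"
    and y: "y1 \<in> Sec Y n1" "y2 \<in> Sec Y n2" "Res Y (Tr 0 n1 n1) y1 = Res Y (Tr 0 0 n2) y2"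
    by (auto simp: prod_sh_simps)
  obtain x' where x': "x' \<in> Sec X (n1 + n2)" "Res X (Tr n1 0 (n1 + n2)) x' = x1"
      "Res X (Tr n2 n1 (n1 + n2)) x' = x2"
    using sheaf_glue[OF X x] by blast
  obtain y' where y': "y' \<in> Sec Y (n1 + n2)" "Res Y (Tr n1 0 (n1 + n2)) y' = y1"
      "Res Y (Tr n2 n1 (n1 + n2)) y' = y2"
    using sheaf_glue[OF Y y] by blast
  from x' y' show "\<exists>x \<in> Sec (X \<times>\<^sub>S Y) (n1 + n2). Res (X \<times>\<^sub>S Y) (Tr n1 0 (n1 + n2)) x = v1 \<and>
      Res (X \<times>\<^sub>S Y) (Tr n2 n1 (n1 + n2)) x = v2"
    by (intro bexI[of _ "VPair x' y'"]) (auto simp: prod_sh_simps v)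
next
  fix n1 n2 x y
  assume "x \<in> Sec (X \<times>\<^sub>S Y) (n1 + n2)" "y \<in> Sec (X \<times>\<^sub>S Y) (n1 + n2)"
    "Res (X \<times>\<^sub>S Y) (Tr n1 0 (n1 + n2)) x = Res (X \<times>\<^sub>S Y) (Tr n1 0 (n1 + n2)) y"
    "Res (X \<times>\<^sub>S Y) (Tr n2 n1 (n1 + n2)) x = Res (X \<times>\<^sub>S Y) (Tr n2 n1 (n1 + n2)) y"
  then show "x = y"
    by (auto simp: prod_sh_simps dest: sheaf_separated[OF X] sheaf_separated[OF Y])
qed

lemma sheaf_pb:
  assumes f: "f \<in> hom ShN X Z" and g: "g \<in> hom ShN Y Z"
  shows "interval_sheaf (pb f g)"
proof (rule interval_sheafI)
  note X = hom_sheaf_dom[OF f] and Y = hom_sheaf_dom[OF g] and Z = hom_sheaf_cod[OF f]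
  note simps = pb_simps mdom_hom[OF f] mdom_hom[OF g] sheaf_Res[OF X] sheaf_Res[OF Y]
    hom_Res[OF f] hom_Res[OF g]
  show "presheaf (pb f g)"
    by (rule presheafI)
      (use X Y in \<open>auto simp: simps sheaf_Res_id sheaf_Res_Res\<close>)
  fix n1 n2 v1 v2
  assume "v1 \<in> Sec (pb f g) n1" "v2 \<in> Sec (pb f g) n2"
    and "Res (pb f g) (Tr 0 n1 n1) v1 = Res (pb f g) (Tr 0 0 n2) v2"
  then obtain x1 y1 x2 y2 where v: "v1 = VPair x1 y1" "v2 = VPair x2 y2"
    and x: "x1 \<in> Sec X n1" "x2 \<in> Sec X n2" "Res X (Tr 0 n1 n1) x1 = Res X (Tr 0 0 n2) x2"
    and y: "y1 \<in> Sec Y n1" "y2 \<in> Sec Y n2" "Res Y (Tr 0 n1 n1) y1 = Res Y (Tr 0 0 n2) y2"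
    and eq: "app f n1 x1 = app g n1 y1" "app f n2 x2 = app g n2 y2"
    by (auto simp: simps)
  obtain x' where x': "x' \<in> Sec X (n1 + n2)" "Res X (Tr n1 0 (n1 + n2)) x' = x1"
      "Res X (Tr n2 n1 (n1 + n2)) x' = x2"
    using sheaf_glue[OF X x] by blast
  obtain y' where y': "y' \<in> Sec Y (n1 + n2)" "Res Y (Tr n1 0 (n1 + n2)) y' = y1"
      "Res Y (Tr n2 n1 (n1 + n2)) y' = y2"
    using sheaf_glue[OF Y y] by blast
  \<comment> \<open>The pair of gluings lies in the pullback: its two images in \<open>Z\<close>
    have the same restrictions to both intervals, and \<open>Z\<close> is separated.\<close>
  have "app f (n1 + n2) x' = app g (n1 + n2) y'"
    by (rule sheaf_separated[OF Z])
      (use x' y' eq hom_app[OF f] hom_app[OF g] in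
        \<open>auto simp flip: hom_Res[OF f] hom_Res[OF g]\<close>)
  with x' y' show "\<exists>x \<in> Sec (pb f g) (n1 + n2). Res (pb f g) (Tr n1 0 (n1 + n2)) x = v1 \<and>
      Res (pb f g) (Tr n2 n1 (n1 + n2)) x = v2"
    by (intro bexI[of _ "VPair x' y'"]) (auto simp: simps v)
next
  note X = hom_sheaf_dom[OF f] and Y = hom_sheaf_dom[OF g]
  fix n1 n2 x y
  assume "x \<in> Sec (pb f g) (n1 + n2)" "y \<in> Sec (pb f g) (n1 + n2)"
    "Res (pb f g) (Tr n1 0 (n1 + n2)) x = Res (pb f g) (Tr n1 0 (n1 + n2)) y"
    "Res (pb f g) (Tr n2 n1 (n1 + n2)) x = Res (pb f g) (Tr n2 n1 (n1 + n2)) y"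
  then show "x = y"
    by (auto simp: pb_simps mdom_hom[OF f] mdom_hom[OF g]
      dest: sheaf_separated[OF X] sheaf_separated[OF Y])
qed

section \<open>Families of sections indexed by ports\<close>

text \<open>The elements of \<open>hat X\<close> without the constructor \<open>Fam\<close>, so that
  inputs and outputs can be compared port by port as extensional functions.\<close>

definition sections :: "('a, 'a sh) tset \<Rightarrow> nat \<Rightarrow> ('a port \<Rightarrow> 'a val) set" where
  "sections X n = (\<Pi>\<^sub>E x \<in> ports X. Sec (ty X x) n)"

lemma Sec_hat: "Sec (hat X) n = Fam ` sections X n"
  and Res_hat: "Res (hat X) t v = Fam (\<lambda>x \<in> ports X. Res (ty X x) t (fam v x))"
  by (simp_all add: hat_def sections_def)

lemma sections_app: "v \<in> sections X n \<Longrightarrow> x \<in> ports X \<Longrightarrow> v x \<in> Sec (ty X x) n"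
  by (auto simp: sections_def)

lemma sections_eqI:
  "v \<in> sections X n \<Longrightarrow> w \<in> sections X n \<Longrightarrow> (\<And>x. x \<in> ports X \<Longrightarrow> v x = w x) \<Longrightarrow> v = w"
  unfolding sections_def by (rule PiE_ext)

lemma restrict_sections:
  "(\<And>x. x \<in> ports X \<Longrightarrow> v x \<in> Sec (ty X x) n) \<Longrightarrow> restrict v (ports X) \<in> sections X n"
  by (auto simp: sections_def)

lemma restrict_sections_id [simp]: "v \<in> sections X n \<Longrightarrow> restrict v (ports X) = v"
  by (auto simp: sections_def intro: PiE_restrict)

text \<open>The matching condition decouples over the ports, so gluing takes place in each type
  separately, and the chosen gluings form a family again.\<close>

lemma sheaf_hat:
  assumes "typed_finite_set ShN X"
  shows "interval_sheaf (hat X)"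
proof (rule interval_sheafI)
  have ty: "interval_sheaf (ty X x)" if "x \<in> ports X" for x
    using assms that by (simp add: typed_finite_set_def Obj_ShN)
  note Res = sheaf_Res[OF ty] sheaf_Res_id[OF ty] sheaf_Res_Res[OF ty]
  show "presheaf (hat X)"
    by (rule presheafI)
      (auto simp: Sec_hat Res_hat Res sections_app cong: restrict_cong
        intro!: restrict_sections imageI)
  fix n1 n2 v1 v2
  assume "v1 \<in> Sec (hat X) n1" "v2 \<in> Sec (hat X) n2"
    and "Res (hat X) (Tr 0 n1 n1) v1 = Res (hat X) (Tr 0 0 n2) v2"
  then obtain x1 x2 where v: "v1 = Fam x1" "v2 = Fam x2" "x1 \<in> sections X n1" "x2 \<in> sections X n2"
    and *: "(\<lambda>x\<in>ports X. Res (ty X x) (Tr 0 n1 n1) (x1 x)) =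
      (\<lambda>x\<in>ports X. Res (ty X x) (Tr 0 0 n2) (x2 x))"
    by (auto simp: Sec_hat Res_hat)
  have "Res (ty X x) (Tr 0 n1 n1) (x1 x) = Res (ty X x) (Tr 0 0 n2) (x2 x)" if "x \<in> ports X" for x
    using fun_cong[OF *, of x] that by simp
  then have "\<exists>z. z \<in> Sec (ty X x) (n1 + n2) \<and> Res (ty X x) (Tr n1 0 (n1 + n2)) z = x1 x \<and>
      Res (ty X x) (Tr n2 n1 (n1 + n2)) z = x2 x" if "x \<in> ports X" for x
    using sheaf_glue[OF ty[OF that] sections_app sections_app] v that by metis
  then obtain z where z: "\<And>x. x \<in> ports X \<Longrightarrow> z x \<in> Sec (ty X x) (n1 + n2)"
      "\<And>x. x \<in> ports X \<Longrightarrow> Res (ty X x) (Tr n1 0 (n1 + n2)) (z x) = x1 x"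
      "\<And>x. x \<in> ports X \<Longrightarrow> Res (ty X x) (Tr n2 n1 (n1 + n2)) (z x) = x2 x"
    by metis
  then show "\<exists>x \<in> Sec (hat X) (n1 + n2). Res (hat X) (Tr n1 0 (n1 + n2)) x = v1 \<and>
      Res (hat X) (Tr n2 n1 (n1 + n2)) x = v2"
    using v by (intro bexI[of _ "Fam (restrict z (ports X))"])
      (auto simp: Sec_hat Res_hat cong: restrict_cong intro!: restrict_sections imageI)
next
  have ty: "interval_sheaf (ty X x)" if "x \<in> ports X" for x
    using assms that by (simp add: typed_finite_set_def Obj_ShN)
  fix n1 n2 v w
  assume "v \<in> Sec (hat X) (n1 + n2)" "w \<in> Sec (hat X) (n1 + n2)"
    "Res (hat X) (Tr n1 0 (n1 + n2)) v = Res (hat X) (Tr n1 0 (n1 + n2)) w"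
    "Res (hat X) (Tr n2 n1 (n1 + n2)) v = Res (hat X) (Tr n2 n1 (n1 + n2)) w"
  then obtain x y where v: "v = Fam x" "w = Fam y" "x \<in> sections X (n1 + n2)" "y \<in> sections X (n1 + n2)"
    and *: "(\<lambda>i\<in>ports X. Res (ty X i) (Tr n1 0 (n1 + n2)) (x i)) =
        (\<lambda>i\<in>ports X. Res (ty X i) (Tr n1 0 (n1 + n2)) (y i))"
      "(\<lambda>i\<in>ports X. Res (ty X i) (Tr n2 n1 (n1 + n2)) (x i)) =
        (\<lambda>i\<in>ports X. Res (ty X i) (Tr n2 n1 (n1 + n2)) (y i))"
    by (auto simp: Sec_hat Res_hat)
  have "x = y"
  proof (rule sections_eqI[OF v(3,4)])
    fix i assume i: "i \<in> ports X"
    show "x i = y i"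
      by (rule sheaf_separated[OF ty[OF i] sections_app[OF v(3) i] sections_app[OF v(4) i]])
        (use fun_cong[OF *(1), of i] fun_cong[OF *(2), of i] i in simp_all)
  qed
  then show "v = w" by (simp add: v)
qed

section \<open>Structural maps between products and families\<close>

lemma prj1_hom: "interval_sheaf X \<Longrightarrow> interval_sheaf Y \<Longrightarrow> prj1 X Y \<in> hom ShN (X \<times>\<^sub>S Y) X"
  and prj2_hom: "interval_sheaf X \<Longrightarrow> interval_sheaf Y \<Longrightarrow> prj2 X Y \<in> hom ShN (X \<times>\<^sub>S Y) Y"
  unfolding prj1_def prj2_def
  by (rule mk_map_hom; auto simp: sheaf_prod prod_sh_simps)+

lemma pair_map_hom:
  assumes "f \<in> hom ShN X Y" "g \<in> hom ShN X Z"
  shows "pair_map f g \<in> hom ShN X (Y \<times>\<^sub>S Z)"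
  unfolding pair_map_def mdom_hom[OF assms(1)] mcod_hom[OF assms(1)] mcod_hom[OF assms(2)]
  by (rule mk_map_hom)
    (use assms in \<open>auto simp: sheaf_prod prod_sh_simps hom_app hom_Res
      hom_sheaf_dom[OF assms(1)] hom_sheaf_cod[OF assms(1)] hom_sheaf_cod[OF assms(2)]\<close>)

lemma prod_map_hom:
  assumes "f \<in> hom ShN X Y" "g \<in> hom ShN X' Y'"
  shows "prod_map f g \<in> hom ShN (X \<times>\<^sub>S X') (Y \<times>\<^sub>S Y')"
  unfolding prod_map_def mdom_hom[OF assms(1)] mcod_hom[OF assms(1)]
    mdom_hom[OF assms(2)] mcod_hom[OF assms(2)]
  by (rule mk_map_hom)
    (use assms in \<open>auto simp: sheaf_prod prod_sh_simps hom_app hom_Res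
      hom_sheaf_dom[OF assms(1)] hom_sheaf_cod[OF assms(1)]
      hom_sheaf_dom[OF assms(2)] hom_sheaf_cod[OF assms(2)]\<close>)

lemma pb_prj2_hom:
  assumes "f \<in> hom ShN X Z" "g \<in> hom ShN Y Z"
  shows "pb_prj2 f g \<in> hom ShN (pb f g) Y"
  unfolding pb_prj2_def mdom_hom[OF assms(2)]
  by (rule mk_map_hom)
    (use assms hom_sheaf_dom[OF assms(2)] in \<open>auto simp: sheaf_pb pb_simps mdom_hom\<close>)

lemma typed_fun_app:
  "f \<in> typed_fun X Y \<Longrightarrow> x \<in> ports X \<Longrightarrow> f x \<in> ports Y \<and> ty Y (f x) = ty X x"
  by (auto simp: typed_fun_def)

lemma hat_map_hom:
  assumes "typed_finite_set ShN X" "typed_finite_set ShN Y" "f \<in> typed_fun X Y"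
  shows "hat_map X Y f \<in> hom ShN (hat Y) (hat X)"
proof -
  have "v (f x) \<in> Sec (ty X x) n" if "v \<in> sections Y n" "x \<in> ports X" for v x n
    using sections_app[OF that(1)] typed_fun_app[OF assms(3) that(2)] by metis
  then show ?thesis
    unfolding hat_map_def
    by (intro mk_map_hom)
      (auto simp: sheaf_hat assms(1,2) Sec_hat Res_hat typed_fun_app[OF assms(3)]
        cong: restrict_cong intro!: imageI restrict_sections)
qed

lemma ports_tsum [simp]: "ports (X \<uplus> Y) = PL ` ports X \<union> PR ` ports Y"
  and ty_tsum [simp]: "ty (X \<uplus> Y) = pcase (ty X) (ty Y)"
  by (simp_all add: tsum_def)

lemma typed_finite_set_tsum:
  "typed_finite_set C X \<Longrightarrow> typed_finite_set C Y \<Longrightarrow> typed_finite_set C (X \<uplus> Y)"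
  by (auto simp: typed_finite_set_def)

lemma typed_finite_set_tempty: "typed_finite_set C tempty"
  by (auto simp: typed_finite_set_def tempty_def)

text \<open>The family computed by \<open>hat_join\<close>, without \<open>Fam\<close>. The
  restriction to the ports of the sum makes it extensional; with \<open>join_cases\<close> and
  \<open>join_inject\<close> it is a bijection from pairs of families to families over the disjoint
  union.\<close>

definition join :: "('a, 'a sh) tset \<Rightarrow> ('a, 'a sh) tset \<Rightarrow> ('a port \<Rightarrow> 'a val) \<Rightarrow>
    ('a port \<Rightarrow> 'a val) \<Rightarrow> 'a port \<Rightarrow> 'a val" where
  "join X Y v w = (\<lambda>x \<in> ports (X \<uplus> Y). pcase v w x)"

lemma join_PL [simp]: "x \<in> ports X \<Longrightarrow> join X Y v w (PL x) = v x"
  and join_PR [simp]: "y \<in> ports Y \<Longrightarrow> join X Y v w (PR y) = w y"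
  by (auto simp: join_def)

lemma join_sections: "v \<in> sections X n \<Longrightarrow> w \<in> sections Y n \<Longrightarrow> join X Y v w \<in> sections (X \<uplus> Y) n"
  unfolding join_def by (rule restrict_sections) (auto simp: sections_app)

lemma join_cases:
  assumes v: "v \<in> sections (X \<uplus> Y) n"
  obtains v1 v2 where "v1 \<in> sections X n" "v2 \<in> sections Y n" "v = join X Y v1 v2"
proof
  show 1: "(\<lambda>x\<in>ports X. v (PL x)) \<in> sections X n" and 2: "(\<lambda>x\<in>ports Y. v (PR x)) \<in> sections Y n"
    using sections_app[OF v, of "PL _"] sections_app[OF v, of "PR _"]
    by (auto intro!: restrict_sections)
  show "v = join X Y (\<lambda>x\<in>ports X. v (PL x)) (\<lambda>x\<in>ports Y. v (PR x))"
    by (rule sections_eqI[OF v join_sections[OF 1 2]]) auto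
qed

lemma join_inject:
  assumes "v \<in> sections X n" "v' \<in> sections X n" "w \<in> sections Y n" "w' \<in> sections Y n"
    and eq: "join X Y v w = join X Y v' w'"
  shows "v = v' \<and> w = w'"
proof
  show "v = v'"
    by (rule sections_eqI[OF assms(1,2)]) (metis eq join_PL)
  show "w = w'"
    by (rule sections_eqI[OF assms(3,4)]) (metis eq join_PR)
qed

lemma hat_join_hom:
  assumes "typed_finite_set ShN X" "typed_finite_set ShN Y"
  shows "hat_join X Y \<in> hom ShN (hat X \<times>\<^sub>S hat Y) (hat (X \<uplus> Y))"
  unfolding hat_join_def join_def[symmetric]
proof (rule mk_map_hom)
  fix n' p n v assume "n' + p \<le> n" "v \<in> Sec (hat X \<times>\<^sub>S hat Y) n"
  then show "Fam (join X Y (fam (vfst (Res (hat X \<times>\<^sub>S hat Y) (Tr n' p n) v)))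
        (fam (vsnd (Res (hat X \<times>\<^sub>S hat Y) (Tr n' p n) v)))) =
      Res (hat (X \<uplus> Y)) (Tr n' p n) (Fam (join X Y (fam (vfst v)) (fam (vsnd v))))"
    by (auto simp: Sec_hat Res_hat prod_sh_simps join_def fun_eq_iff restrict_def)
qed (auto simp: assms typed_finite_set_tsum sheaf_prod sheaf_hat prod_sh_simps Sec_hat join_sections)

lemma app_hat_join:
  "v \<in> sections X n \<Longrightarrow> w \<in> sections Y n \<Longrightarrow>
    app (hat_join X Y) n (VPair (Fam v) (Fam w)) = Fam (join X Y v w)"
  unfolding hat_join_def join_def[symmetric]
  by (subst app_mk_map) (auto simp: prod_sh_simps Sec_hat)

lemma app_prod_map:
  "x \<in> Sec (mdom f) n \<Longrightarrow> y \<in> Sec (mdom g) n \<Longrightarrow>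
    app (prod_map f g) n (VPair x y) = VPair (app f n x) (app g n y)"
  unfolding prod_map_def by (subst app_mk_map) (auto simp: prod_sh_simps)

lemma app_pair_map:
  "x \<in> Sec (mdom f) n \<Longrightarrow> app (pair_map f g) n x = VPair (app f n x) (app g n x)"
  unfolding pair_map_def by (subst app_mk_map) auto

lemma app_prj1: "x \<in> Sec X n \<Longrightarrow> y \<in> Sec Y n \<Longrightarrow> app (prj1 X Y) n (VPair x y) = x"
  and app_prj2: "x \<in> Sec X n \<Longrightarrow> y \<in> Sec Y n \<Longrightarrow> app (prj2 X Y) n (VPair x y) = y"
  unfolding prj1_def prj2_def by (subst app_mk_map; auto simp: prod_sh_simps)+

lemma app_hat_map:
  "v \<in> sections Y n \<Longrightarrow> app (hat_map X Y f) n (Fam v) = Fam (\<lambda>x \<in> ports X. v (f x))"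
  unfolding hat_map_def by (subst app_mk_map) (auto simp: Sec_hat)

section \<open>Machines as spans\<close>

text \<open>Sections of \<open>span_base X\<close> are pairs of families; \<open>inp\<close> and
  \<open>outp\<close> strip the constructors, and \<open>app_machine\<close> puts them back.\<close>

definition inp :: "'a shmap \<Rightarrow> nat \<Rightarrow> 'a val \<Rightarrow> 'a port \<Rightarrow> 'a val" where
  "inp p n s = fam (vfst (app p n s))"

definition outp :: "'a shmap \<Rightarrow> nat \<Rightarrow> 'a val \<Rightarrow> 'a port \<Rightarrow> 'a val" where
  "outp p n s = fam (vsnd (app p n s))"

text \<open>The action of \<open>hat_in\<close> on bare families: \<open>y\<close> is the external
  input of the outer box, and \<open>x\<close> is the output of the inner box, which is fed back
  along the wires marked \<open>PL\<close>.\<close>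

definition feed :: "'a swiring \<Rightarrow> ('a port \<Rightarrow> 'a val) \<Rightarrow> ('a port \<Rightarrow> 'a val) \<Rightarrow> 'a port \<Rightarrow> 'a val" where
  "feed \<phi> y x = (\<lambda>i \<in> ports (bin (wdom \<phi>)). pcase x y (win \<phi> i))"

definition readout :: "'a swiring \<Rightarrow> ('a port \<Rightarrow> 'a val) \<Rightarrow> 'a port \<Rightarrow> 'a val" where
  "readout \<phi> x = (\<lambda>i \<in> ports (bout (wcod \<phi>)). x (wout \<phi> i))"

lemma Obj_WD: "X \<in> Obj (WD_cat C) \<longleftrightarrow> typed_finite_set C (bin X) \<and> typed_finite_set C (bout X)"
  and Arr_WD: "\<phi> \<in> Arr (WD_cat C) \<longleftrightarrow> wdom \<phi> \<in> Obj (WD_cat C) \<and> wcod \<phi> \<in> Obj (WD_cat C) \<and>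
    win \<phi> \<in> typed_fun (bin (wdom \<phi>)) (bout (wdom \<phi>) \<uplus> bin (wcod \<phi>)) \<and>
    wout \<phi> \<in> typed_fun (bout (wcod \<phi>)) (bout (wdom \<phi>))"
  and Dom_WD [simp]: "Dom (WD_cat C) = wdom"
  and Cod_WD [simp]: "Cod (WD_cat C) = wcod"
  by (auto simp: WD_cat_def)

lemma hom_WD: "\<phi> \<in> hom (WD_cat C) X Y \<longleftrightarrow> \<phi> \<in> Arr (WD_cat C) \<and> wdom \<phi> = X \<and> wcod \<phi> = Y"
  by (simp add: hom_def)

lemma box_sum_simps [simp]:
  "bin (box_sum X Y) = bin X \<uplus> bin Y" "bout (box_sum X Y) = bout X \<uplus> bout Y"
  by (simp_all add: box_sum_def)

lemma box_sum_Obj: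
  "X \<in> Obj (WD_cat C) \<Longrightarrow> Y \<in> Obj (WD_cat C) \<Longrightarrow> box_sum X Y \<in> Obj (WD_cat C)"
  by (simp add: Obj_WD typed_finite_set_tsum)

lemma win_sections:
  assumes "\<phi> \<in> Arr (WD_cat C)" "y \<in> sections (bin (wcod \<phi>)) n" "x \<in> sections (bout (wdom \<phi>)) n"
  shows "feed \<phi> y x \<in> sections (bin (wdom \<phi>)) n"
  unfolding feed_def
proof (rule restrict_sections)
  fix i assume "i \<in> ports (bin (wdom \<phi>))"
  then have "win \<phi> i \<in> ports (bout (wdom \<phi>) \<uplus> bin (wcod \<phi>))"
    "ty (bin (wdom \<phi>)) i = ty (bout (wdom \<phi>) \<uplus> bin (wcod \<phi>)) (win \<phi> i)"
    using assms(1) typed_fun_app unfolding Arr_WD by metis+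
  then show "pcase x y (win \<phi> i) \<in> Sec (ty (bin (wdom \<phi>)) i) n"
    using assms(2,3) by (auto simp: sections_app)
qed

lemma wout_sections:
  assumes "\<phi> \<in> Arr (WD_cat C)" "x \<in> sections (bout (wdom \<phi>)) n"
  shows "readout \<phi> x \<in> sections (bout (wcod \<phi>)) n"
  unfolding readout_def
proof (rule restrict_sections)
  fix i assume "i \<in> ports (bout (wcod \<phi>))"
  then have "wout \<phi> i \<in> ports (bout (wdom \<phi>))"
    "ty (bout (wcod \<phi>)) i = ty (bout (wdom \<phi>)) (wout \<phi> i)"
    using assms(1) typed_fun_app unfolding Arr_WD by metis+
  then show "x (wout \<phi> i) \<in> Sec (ty (bout (wcod \<phi>)) i) n"
    using assms(2) by (auto simp: sections_app)
qed

lemma sheaf_box: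
  assumes "X \<in> Obj (WD_cat ShN)"
  shows "interval_sheaf (hat (bin X))" "interval_sheaf (hat (bout X))" "interval_sheaf (span_base X)"
  using assms by (auto simp: Obj_WD span_base_def intro!: sheaf_hat sheaf_prod)

lemma Sec_span_base:
  "Sec (span_base X) n =
    {VPair (Fam y) (Fam x) | y x. y \<in> sections (bin X) n \<and> x \<in> sections (bout X) n}"
  by (auto simp: span_base_def prod_sh_simps Sec_hat)

lemma hat_in_hom:
  assumes "\<phi> \<in> Arr (WD_cat ShN)"
  shows "hat_in \<phi> \<in> hom ShN (hat (bin (wcod \<phi>)) \<times>\<^sub>S hat (bout (wdom \<phi>))) (hat (bin (wdom \<phi>)))"
proof -
  have 1: "swap_map (hat (bin (wcod \<phi>))) (hat (bout (wdom \<phi>))) \<in>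
      hom ShN (hat (bin (wcod \<phi>)) \<times>\<^sub>S hat (bout (wdom \<phi>))) (hat (bout (wdom \<phi>)) \<times>\<^sub>S hat (bin (wcod \<phi>)))"
    unfolding swap_map_def
    using assms by (intro pair_map_hom prj1_hom prj2_hom) (auto simp: Arr_WD sheaf_box)
  show ?thesis
    unfolding hat_in_def Let_def
    using assms by (intro Comp_hom[OF Comp_hom[OF 1 hat_join_hom] hat_map_hom])
      (auto simp: Arr_WD Obj_WD typed_finite_set_tsum)
qed

lemma mdom_hat_join [simp]: "mdom (hat_join X Y) = hat X \<times>\<^sub>S hat Y"
  by (simp add: hat_join_def)

lemma app_hat_in:
  assumes "\<phi> \<in> Arr (WD_cat ShN)" "y \<in> sections (bin (wcod \<phi>)) n" "x \<in> sections (bout (wdom \<phi>)) n"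
  shows "app (hat_in \<phi>) n (VPair (Fam y) (Fam x)) = Fam (feed \<phi> y x)"
proof -
  have v: "Fam y \<in> Sec (hat (bin (wcod \<phi>))) n" "Fam x \<in> Sec (hat (bout (wdom \<phi>))) n"
    using assms by (auto simp: Sec_hat)
  then have vp: "VPair (Fam y) (Fam x) \<in> Sec (hat (bin (wcod \<phi>)) \<times>\<^sub>S hat (bout (wdom \<phi>))) n"
    by (auto simp: prod_sh_simps)
  \<comment> \<open>A wire ends at a port of the sum, where the extensional \<open>join\<close> and
    the plain case distinction have the same value.\<close>
  have "join (bout (wdom \<phi>)) (bin (wcod \<phi>)) x y (win \<phi> i) = pcase x y (win \<phi> i)"
    if "i \<in> ports (bin (wdom \<phi>))" for i
  proof -
    have "win \<phi> i \<in> ports (bout (wdom \<phi>) \<uplus> bin (wcod \<phi>))"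
      using assms(1) that typed_fun_app unfolding Arr_WD by metis
    then show ?thesis by (simp add: join_def)
  qed
  then show ?thesis
    using v vp assms
    by (simp add: hat_in_def Let_def app_Comp swap_map_def pair_map_def prj1_def prj2_def app_mk_map
      app_hat_join app_hat_map join_sections feed_def cong: restrict_cong)
qed

lemma hat_out_hom:
  assumes "\<phi> \<in> Arr (WD_cat ShN)"
  shows "hat_out \<phi> \<in> hom ShN (hat (bout (wdom \<phi>))) (hat (bout (wcod \<phi>)))"
  unfolding hat_out_def using assms by (intro hat_map_hom) (auto simp: Arr_WD Obj_WD)

lemma app_hat_out:
  "x \<in> sections (bout (wdom \<phi>)) n \<Longrightarrow> app (hat_out \<phi>) n (Fam x) = Fam (readout \<phi> x)"
  unfolding hat_out_def readout_def by (rule app_hat_map)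

lemma pull_leg_hom:
  assumes "\<phi> \<in> Arr (WD_cat ShN)"
  shows "pull_leg \<phi> \<in>
    hom ShN (hat (bin (wcod \<phi>)) \<times>\<^sub>S hat (bout (wdom \<phi>))) (span_base (wdom \<phi>))"
  unfolding pull_leg_def span_base_def
  using assms by (intro pair_map_hom hat_in_hom prj2_hom) (auto simp: Arr_WD sheaf_box)

lemma app_pull_leg:
  assumes "\<phi> \<in> Arr (WD_cat ShN)" "y \<in> sections (bin (wcod \<phi>)) n" "x \<in> sections (bout (wdom \<phi>)) n"
  shows "app (pull_leg \<phi>) n (VPair (Fam y) (Fam x)) = VPair (Fam (feed \<phi> y x)) (Fam x)"
  unfolding pull_leg_def
  using assms mdom_hom[OF hat_in_hom[OF assms(1)]]
  by (subst app_pair_map) (auto simp: prod_sh_simps Sec_hat app_hat_in app_prj2)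

lemma push_leg_hom:
  assumes "\<phi> \<in> Arr (WD_cat ShN)"
  shows "push_leg \<phi> \<in>
    hom ShN (hat (bin (wcod \<phi>)) \<times>\<^sub>S hat (bout (wdom \<phi>))) (span_base (wcod \<phi>))"
  unfolding push_leg_def span_base_def
  using assms by (intro prod_map_hom hat_out_hom Ident_hom) (auto simp: Arr_WD sheaf_box)

lemma app_push_leg:
  assumes "\<phi> \<in> Arr (WD_cat ShN)" "y \<in> sections (bin (wcod \<phi>)) n" "x \<in> sections (bout (wdom \<phi>)) n"
  shows "app (push_leg \<phi>) n (VPair (Fam y) (Fam x)) = VPair (Fam y) (Fam (readout \<phi> x))"
  unfolding push_leg_def
  using assms mdom_hom[OF hat_out_hom[OF assms(1)]]
  by (subst app_prod_map) (auto simp: Sec_hat app_hat_out app_Ident)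

abbreviation machines :: "'a sbox \<Rightarrow> 'a shmap set" where
  "machines X \<equiv> Obj (slice ShN (span_base X))"

lemma machines_iff: "p \<in> machines X \<longleftrightarrow> p \<in> hom ShN (mdom p) (span_base X)"
  by (auto simp: slice_def hom_ShN Arr_ShN)

lemma app_machine:
  assumes "p \<in> machines X" "s \<in> Sec (mdom p) n"
  shows "app p n s = VPair (Fam (inp p n s)) (Fam (outp p n s))"
    and "inp p n s \<in> sections (bin X) n" and "outp p n s \<in> sections (bout X) n"
proof -
  have "app p n s \<in> Sec (span_base X) n"
    using assms by (auto simp: machines_iff hom_app)
  then show "app p n s = VPair (Fam (inp p n s)) (Fam (outp p n s))"
    "inp p n s \<in> sections (bin X) n" "outp p n s \<in> sections (bout X) n"
    by (auto simp: Sec_span_base inp_def outp_def)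
qed

lemma mdom_span_act_obj [simp]: "mdom (span_act_obj \<phi> p) = pb p (pull_leg \<phi>)"
  by (simp add: span_act_obj_def pb_prj2_def)

lemma span_act_obj_hom:
  assumes "\<phi> \<in> Arr (WD_cat ShN)" "p \<in> machines (wdom \<phi>)"
  shows "span_act_obj \<phi> p \<in> machines (wcod \<phi>)"
  unfolding machines_iff mdom_span_act_obj
  unfolding span_act_obj_def
  by (rule Comp_hom[OF pb_prj2_hom push_leg_hom])
    (use assms in \<open>auto simp: machines_iff pull_leg_hom\<close>)

text \<open>In the pullback the output recorded next to \<open>y\<close> is forced to be
  \<open>outp p n s\<close>. So a state of the new machine amounts to an old state and an external
  input, subject to the feedback equation
  \<open>inp p n s = feed \<phi> y (outp p n s)\<close>.\<close>

lemma Sec_pb_pull_leg: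
  assumes "\<phi> \<in> Arr (WD_cat ShN)" "p \<in> machines (wdom \<phi>)"
  shows "Sec (pb p (pull_leg \<phi>)) n =
    {VPair s (VPair (Fam y) (Fam (outp p n s))) | s y. s \<in> Sec (mdom p) n \<and>
      y \<in> sections (bin (wcod \<phi>)) n \<and> inp p n s = feed \<phi> y (outp p n s)}"
  unfolding pb_simps mdom_hom[OF pull_leg_hom[OF assms(1)]]
  using app_machine[OF assms(2)] app_pull_leg[OF assms(1)]
  by (fastforce simp: prod_sh_simps Sec_hat)

lemma app_span_act_obj:
  assumes "\<phi> \<in> Arr (WD_cat ShN)" "p \<in> machines (wdom \<phi>)"
    and s: "s \<in> Sec (mdom p) n" and y: "y \<in> sections (bin (wcod \<phi>)) n"
    and eq: "inp p n s = feed \<phi> y (outp p n s)"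
  shows "inp (span_act_obj \<phi> p) n (VPair s (VPair (Fam y) (Fam (outp p n s)))) = y"
    and "outp (span_act_obj \<phi> p) n (VPair s (VPair (Fam y) (Fam (outp p n s)))) =
      readout \<phi> (outp p n s)"
proof -
  have "VPair s (VPair (Fam y) (Fam (outp p n s))) \<in> Sec (pb p (pull_leg \<phi>)) n"
    unfolding Sec_pb_pull_leg[OF assms(1,2)] using s y eq by blast
  moreover from this have "VPair s (VPair (Fam y) (Fam (outp p n s))) \<in> Sec (mdom (pb_prj2 p (pull_leg \<phi>))) n"
    by (simp add: pb_prj2_def)
  ultimately have "app (span_act_obj \<phi> p) n (VPair s (VPair (Fam y) (Fam (outp p n s)))) =
      VPair (Fam y) (Fam (readout \<phi> (outp p n s)))"
    using app_push_leg[OF assms(1) y app_machine(3)[OF assms(2) s]]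
    by (simp add: span_act_obj_def app_Comp pb_prj2_def app_mk_map)
  then show "inp (span_act_obj \<phi> p) n (VPair s (VPair (Fam y) (Fam (outp p n s)))) = y"
    "outp (span_act_obj \<phi> p) n (VPair s (VPair (Fam y) (Fam (outp p n s)))) = readout \<phi> (outp p n s)"
    by (simp_all add: inp_def outp_def)
qed

section \<open>Parallel composition and the unit machine\<close>

lemma interchange_hom:
  assumes "interval_sheaf A" "interval_sheaf B" "interval_sheaf A'" "interval_sheaf B'"
  shows "interchange A B A' B' \<in>
    hom ShN ((A \<times>\<^sub>S B) \<times>\<^sub>S (A' \<times>\<^sub>S B')) ((A \<times>\<^sub>S A') \<times>\<^sub>S (B \<times>\<^sub>S B'))"
  unfolding interchange_def by (intro pair_map_hom prod_map_hom prj1_hom prj2_hom assms)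

lemma app_interchange:
  assumes "a \<in> Sec A n" "b \<in> Sec B n" "a' \<in> Sec A' n" "b' \<in> Sec B' n"
  shows "app (interchange A B A' B') n (VPair (VPair a b) (VPair a' b')) =
    VPair (VPair a a') (VPair b b')"
proof -
  have "VPair a b \<in> Sec (A \<times>\<^sub>S B) n" "VPair a' b' \<in> Sec (A' \<times>\<^sub>S B') n"
    using assms by (auto simp: prod_sh_simps)
  moreover from this have "VPair (VPair a b) (VPair a' b') \<in> Sec ((A \<times>\<^sub>S B) \<times>\<^sub>S (A' \<times>\<^sub>S B')) n"
    by (auto simp: prod_sh_simps)
  ultimately show ?thesis
    using assms unfolding interchange_def
    by (simp add: pair_map_def prod_map_def prj1_def prj2_def app_mk_map)
qed

lemma mdom_span_mu_obj [simp]: "mdom (span_mu_obj X Y p q) = mdom p \<times>\<^sub>S mdom q"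
  by (simp add: span_mu_obj_def prod_map_def)

lemma Sec_span_mu_obj:
  "Sec (mdom (span_mu_obj X Y p q)) n = {VPair s t | s t. s \<in> Sec (mdom p) n \<and> t \<in> Sec (mdom q) n}"
  by (simp add: prod_sh_simps)

lemma span_mu_obj_hom:
  assumes "X \<in> Obj (WD_cat ShN)" "Y \<in> Obj (WD_cat ShN)" "p \<in> machines X" "q \<in> machines Y"
  shows "span_mu_obj X Y p q \<in> machines (box_sum X Y)"
proof -
  have "prod_map p q \<in> hom ShN (mdom p \<times>\<^sub>S mdom q) (span_base X \<times>\<^sub>S span_base Y)"
    using assms by (intro prod_map_hom) (auto simp: machines_iff)
  moreover have "interchange (hat (bin X)) (hat (bout X)) (hat (bin Y)) (hat (bout Y)) \<in>
      hom ShN (span_base X \<times>\<^sub>S span_base Y)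
        ((hat (bin X) \<times>\<^sub>S hat (bin Y)) \<times>\<^sub>S (hat (bout X) \<times>\<^sub>S hat (bout Y)))"
    unfolding span_base_def using assms by (intro interchange_hom sheaf_box)
  moreover have "prod_map (hat_join (bin X) (bin Y)) (hat_join (bout X) (bout Y)) \<in>
      hom ShN ((hat (bin X) \<times>\<^sub>S hat (bin Y)) \<times>\<^sub>S (hat (bout X) \<times>\<^sub>S hat (bout Y)))
        (span_base (box_sum X Y))"
    unfolding span_base_def box_sum_simps
    using assms by (intro prod_map_hom hat_join_hom) (auto simp: Obj_WD)
  ultimately show ?thesis
    unfolding machines_iff mdom_span_mu_obj unfolding span_mu_obj_def by (intro Comp_hom)
qed

lemma app_span_mu_obj:
  assumes X: "X \<in> Obj (WD_cat ShN)" "Y \<in> Obj (WD_cat ShN)" and p: "p \<in> machines X" and q: "q \<in> machines Y"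
    and s: "s \<in> Sec (mdom p) n" and t: "t \<in> Sec (mdom q) n"
  shows "inp (span_mu_obj X Y p q) n (VPair s t) = join (bin X) (bin Y) (inp p n s) (inp q n t)"
    and "outp (span_mu_obj X Y p q) n (VPair s t) = join (bout X) (bout Y) (outp p n s) (outp q n t)"
proof -
  note ps = app_machine[OF p s] and qt = app_machine[OF q t]
  have st: "VPair s t \<in> Sec (mdom p \<times>\<^sub>S mdom q) n" using s t by (auto simp: prod_sh_simps)
  have *: "Fam (inp p n s) \<in> Sec (hat (bin X)) n" "Fam (outp p n s) \<in> Sec (hat (bout X)) n"
    "Fam (inp q n t) \<in> Sec (hat (bin Y)) n" "Fam (outp q n t) \<in> Sec (hat (bout Y)) n"
    using ps qt by (auto simp: Sec_hat)
  have "mdom (interchange (hat (bin X)) (hat (bout X)) (hat (bin Y)) (hat (bout Y)) \<odot> prod_map p q) =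
      mdom p \<times>\<^sub>S mdom q"
    by (simp add: prod_map_def)
  with st have "app (span_mu_obj X Y p q) n (VPair s t) =
    app (prod_map (hat_join (bin X) (bin Y)) (hat_join (bout X) (bout Y))) n
      (app (interchange (hat (bin X)) (hat (bout X)) (hat (bin Y)) (hat (bout Y))) n
        (app (prod_map p q) n (VPair s t)))"
    unfolding span_mu_obj_def by (simp add: app_Comp prod_map_def)
  also have "app (prod_map p q) n (VPair s t) =
      VPair (VPair (Fam (inp p n s)) (Fam (outp p n s))) (VPair (Fam (inp q n t)) (Fam (outp q n t)))"
    using s t ps qt by (simp add: app_prod_map)
  also have "app (interchange (hat (bin X)) (hat (bout X)) (hat (bin Y)) (hat (bout Y))) n \<dots> =
      VPair (VPair (Fam (inp p n s)) (Fam (inp q n t))) (VPair (Fam (outp p n s)) (Fam (outp q n t)))"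
    using * by (simp add: app_interchange)
  also have "app (prod_map (hat_join (bin X) (bin Y)) (hat_join (bout X) (bout Y))) n \<dots> =
      VPair (Fam (join (bin X) (bin Y) (inp p n s) (inp q n t)))
        (Fam (join (bout X) (bout Y) (outp p n s) (outp q n t)))"
    using * ps qt
    by (subst app_prod_map) (auto simp: app_hat_join prod_sh_simps)
  finally show "inp (span_mu_obj X Y p q) n (VPair s t) = join (bin X) (bin Y) (inp p n s) (inp q n t)"
    "outp (span_mu_obj X Y p q) n (VPair s t) = join (bout X) (bout Y) (outp p n s) (outp q n t)"
    by (simp_all add: inp_def outp_def)
qed

abbreviation unit_machine :: "'a shmap" where
  "unit_machine \<equiv> pair_map (Ident ShN (hat tempty)) (Ident ShN (hat tempty))"

abbreviation unit_box :: "'a sbox" where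
  "unit_box \<equiv> \<lparr>bin = tempty, bout = tempty\<rparr>"

lemma sections_tempty: "sections tempty n = {\<lambda>_. undefined}"
  by (simp add: sections_def tempty_def)

lemma mdom_unit_machine [simp]: "mdom unit_machine = hat tempty"
  by (simp add: pair_map_def)

lemma unit_machine_hom: "unit_machine \<in> machines unit_box"
  unfolding machines_iff mdom_unit_machine
  unfolding span_base_def box.simps
  by (intro pair_map_hom) (auto intro!: Ident_hom sheaf_hat typed_finite_set_tempty)

lemma Sec_unit_machine: "Sec (hat tempty) n = {Fam (\<lambda>_. undefined)}"
  by (simp add: Sec_hat sections_tempty)

lemma app_unit_machine:
  assumes "s \<in> Sec (hat tempty) n"
  shows "inp unit_machine n s = (\<lambda>_. undefined)" "outp unit_machine n s = (\<lambda>_. undefined)"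
  using assms by (auto simp: inp_def outp_def app_pair_map app_Ident Sec_unit_machine)

section \<open>Labelled machines\<close>

text \<open>A label records, as a set of tagged states, which states of the constituent machines a state
  of a composite machine consists of. Taking sets makes labels insensitive to bracketing and order,
  so that all structural isomorphisms between composite machines preserve them strictly.\<close>

type_synonym 'a label = "nat \<Rightarrow> 'a val \<Rightarrow> (nat \<times> 'a val) set"

definition leaf :: "nat \<Rightarrow> 'a label" where
  "leaf i = (\<lambda>n s. {(i, s)})"

text \<open>The external input is left out of the label although it is part of the state: the
  isomorphism \<open>cmp\<close> has to preserve labels, and the states in its source record the
  input of the intermediate box while those in its target do not. The definition of
  \<open>determined\<close> therefore takes inputs into account separately.\<close>

definition act_label :: "'a label \<Rightarrow> 'a label" where
  "act_label \<sigma> = (\<lambda>n v. \<sigma> n (vfst v))"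

definition mu_label :: "'a label \<Rightarrow> 'a label \<Rightarrow> 'a label" where
  "mu_label \<sigma> \<tau> = (\<lambda>n v. \<sigma> n (vfst v) \<union> \<tau> n (vsnd v))"

definition unit_label :: "'a label" where
  "unit_label = (\<lambda>n v. {})"

text \<open>The set \<open>I\<close> bounds the tags that occur. That the output depends on the
  label alone is what makes the property stable under feedback: label and external input then fix
  the internal input as well.\<close>

definition determined :: "'a shmap \<Rightarrow> 'a label \<Rightarrow> nat set \<Rightarrow> bool" where
  "determined p \<sigma> I \<longleftrightarrow>
    (\<forall>n. \<forall>s \<in> Sec (mdom p) n. \<sigma> n s \<subseteq> I \<times> UNIV) \<and>
    (\<forall>n. \<forall>s \<in> Sec (mdom p) n. \<forall>s' \<in> Sec (mdom p) n. \<sigma> n s = \<sigma> n s' \<longrightarrow>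
      outp p n s = outp p n s' \<and> (inp p n s = inp p n s' \<longrightarrow> s = s'))"

text \<open>\<open>E i\<close> is the state sheaf of the constituent with tag \<open>i\<close>, so
  each tagged state is restricted in its own sheaf.\<close>

definition label_natural :: "(nat \<Rightarrow> 'a sh) \<Rightarrow> 'a shmap \<Rightarrow> 'a label \<Rightarrow> bool" where
  "label_natural E p \<sigma> \<longleftrightarrow> (\<forall>n' k n. \<forall>s \<in> Sec (mdom p) n. n' + k \<le> n \<longrightarrow>
    \<sigma> n' (Res (mdom p) (Tr n' k n) s) = (\<lambda>(i, v). (i, Res (E i) (Tr n' k n) v)) ` \<sigma> n s)"

text \<open>The relation that remains of a labelled machine when its states are forgotten. The way
  in which states are bracketed is no longer visible in it, so composites can be compared by
  equality of sets.\<close>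

definition graph :: "'a shmap \<Rightarrow> 'a label \<Rightarrow> nat \<Rightarrow>
    ((nat \<times> 'a val) set \<times> ('a port \<Rightarrow> 'a val) \<times> ('a port \<Rightarrow> 'a val)) set" where
  "graph p \<sigma> n = {(\<sigma> n s, inp p n s, outp p n s) | s. s \<in> Sec (mdom p) n}"

lemma determined_leaf: "determined p (leaf i) {i}"
  by (auto simp: determined_def leaf_def)

lemma label_natural_leaf: "E i = mdom p \<Longrightarrow> label_natural E p (leaf i)"
  by (simp add: label_natural_def leaf_def)

lemma Sec_span_act_obj:
  assumes "\<phi> \<in> Arr (WD_cat ShN)" "p \<in> machines (wdom \<phi>)" "v \<in> Sec (mdom (span_act_obj \<phi> p)) n"
  obtains s y where "s \<in> Sec (mdom p) n" "y \<in> sections (bin (wcod \<phi>)) n"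
    "inp p n s = feed \<phi> y (outp p n s)" "v = VPair s (VPair (Fam y) (Fam (outp p n s)))"
    "inp (span_act_obj \<phi> p) n v = y" "outp (span_act_obj \<phi> p) n v = readout \<phi> (outp p n s)"
proof -
  obtain s y where sy: "s \<in> Sec (mdom p) n" "y \<in> sections (bin (wcod \<phi>)) n"
    "inp p n s = feed \<phi> y (outp p n s)" "v = VPair s (VPair (Fam y) (Fam (outp p n s)))"
    using assms(3) unfolding mdom_span_act_obj Sec_pb_pull_leg[OF assms(1,2)] by auto
  show thesis
    by (rule that[OF sy]) (simp_all only: sy(4) app_span_act_obj[OF assms(1,2) sy(1-3)])
qed

text \<open>Equal labels give equal inner outputs. If the external inputs agree as well, the
  feedback equation gives equal inner inputs, and the inner states coincide.\<close>

lemma determined_act: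
  assumes \<phi>: "\<phi> \<in> Arr (WD_cat ShN)" "p \<in> machines (wdom \<phi>)" and d: "determined p \<sigma> I"
  shows "determined (span_act_obj \<phi> p) (act_label \<sigma>) I"
  unfolding determined_def
proof (intro conjI allI ballI impI)
  fix n v assume "v \<in> Sec (mdom (span_act_obj \<phi> p)) n"
  then obtain s where "vfst v = s" "s \<in> Sec (mdom p) n"
    using Sec_span_act_obj[OF \<phi>] by (metis val.sel(2))
  then show "act_label \<sigma> n v \<subseteq> I \<times> UNIV" using d by (simp add: determined_def act_label_def)
  fix v' assume "v' \<in> Sec (mdom (span_act_obj \<phi> p)) n" and eq: "act_label \<sigma> n v = act_label \<sigma> n v'"
  from \<open>v \<in> _\<close> obtain s y where s: "s \<in> Sec (mdom p) n" "inp p n s = feed \<phi> y (outp p n s)"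
      "v = VPair s (VPair (Fam y) (Fam (outp p n s)))"
      "inp (span_act_obj \<phi> p) n v = y" "outp (span_act_obj \<phi> p) n v = readout \<phi> (outp p n s)"
    by (rule Sec_span_act_obj[OF \<phi>])
  from \<open>v' \<in> _\<close> obtain s' y' where s': "s' \<in> Sec (mdom p) n" "inp p n s' = feed \<phi> y' (outp p n s')"
      "v' = VPair s' (VPair (Fam y') (Fam (outp p n s')))"
      "inp (span_act_obj \<phi> p) n v' = y'" "outp (span_act_obj \<phi> p) n v' = readout \<phi> (outp p n s')"
    by (rule Sec_span_act_obj[OF \<phi>])
  have "\<sigma> n s = \<sigma> n s'" using eq unfolding act_label_def s(3) s'(3) by simp
  then have *: "outp p n s = outp p n s'" "inp p n s = inp p n s' \<Longrightarrow> s = s'"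
    using d s(1) s'(1) unfolding determined_def by metis+
  then show "outp (span_act_obj \<phi> p) n v = outp (span_act_obj \<phi> p) n v'"
    using s s' by simp
  assume "inp (span_act_obj \<phi> p) n v = inp (span_act_obj \<phi> p) n v'"
  with * s s' show "v = v'" by simp
qed

lemma label_natural_act:
  assumes \<phi>: "\<phi> \<in> Arr (WD_cat ShN)" "p \<in> machines (wdom \<phi>)" and l: "label_natural E p \<sigma>"
  shows "label_natural E (span_act_obj \<phi> p) (act_label \<sigma>)"
  unfolding label_natural_def
proof (intro allI ballI impI)
  fix n' k n v assume v: "v \<in> Sec (mdom (span_act_obj \<phi> p)) n" and "n' + k \<le> n"
  from v obtain s where "vfst v = s" "s \<in> Sec (mdom p) n"
    using Sec_span_act_obj[OF \<phi>] by (metis val.sel(2))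
  with l \<open>n' + k \<le> n\<close> show "act_label \<sigma> n' (Res (mdom (span_act_obj \<phi> p)) (Tr n' k n) v) =
      (\<lambda>(i, v). (i, Res (E i) (Tr n' k n) v)) ` act_label \<sigma> n v"
    by (simp add: label_natural_def act_label_def pb_simps)
qed

lemma graph_act:
  assumes \<phi>: "\<phi> \<in> Arr (WD_cat ShN)" "p \<in> machines (wdom \<phi>)"
  shows "graph (span_act_obj \<phi> p) (act_label \<sigma>) n =
    {(w, y, readout \<phi> x) | w y x. y \<in> sections (bin (wcod \<phi>)) n \<and> (w, feed \<phi> y x, x) \<in> graph p \<sigma> n}"
    (is "?L = ?R")
proof (intro equalityI subsetI)
  fix z assume "z \<in> ?L"
  then obtain v where v: "v \<in> Sec (mdom (span_act_obj \<phi> p)) n"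
    and z: "z = (act_label \<sigma> n v, inp (span_act_obj \<phi> p) n v, outp (span_act_obj \<phi> p) n v)"
    by (auto simp: graph_def)
  from v obtain s y where s: "s \<in> Sec (mdom p) n" "y \<in> sections (bin (wcod \<phi>)) n"
      "inp p n s = feed \<phi> y (outp p n s)" "v = VPair s (VPair (Fam y) (Fam (outp p n s)))"
      "inp (span_act_obj \<phi> p) n v = y" "outp (span_act_obj \<phi> p) n v = readout \<phi> (outp p n s)"
    by (rule Sec_span_act_obj[OF \<phi>])
  then show "z \<in> ?R" using z unfolding graph_def act_label_def by (auto intro!: exI[of _ s])
next
  fix z assume "z \<in> ?R"
  then obtain y s where s: "y \<in> sections (bin (wcod \<phi>)) n" "s \<in> Sec (mdom p) n"
      "inp p n s = feed \<phi> y (outp p n s)" "z = (\<sigma> n s, y, readout \<phi> (outp p n s))"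
    unfolding graph_def by auto
  let ?v = "VPair s (VPair (Fam y) (Fam (outp p n s)))"
  have "?v \<in> Sec (mdom (span_act_obj \<phi> p)) n"
    using s by (auto simp: Sec_pb_pull_leg[OF \<phi>])
  then show "z \<in> ?L"
    using app_span_act_obj[OF \<phi> s(2,1,3)] s(4)
    by (auto simp: graph_def act_label_def intro!: exI[of _ ?v])
qed

text \<open>As the sets of tags are disjoint, the union of the two labels can be split again, and
  each factor is determined by its own part.\<close>

lemma determined_mu:
  assumes X: "X \<in> Obj (WD_cat ShN)" "Y \<in> Obj (WD_cat ShN)" and p: "p \<in> machines X" and q: "q \<in> machines Y"
    and d: "determined p \<sigma> I" "determined q \<tau> J" and IJ: "I \<inter> J = {}"
  shows "determined (span_mu_obj X Y p q) (mu_label \<sigma> \<tau>) (I \<union> J)"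
  unfolding determined_def
proof (intro conjI allI ballI impI)
  fix n v assume "v \<in> Sec (mdom (span_mu_obj X Y p q)) n"
  then obtain s t where s: "v = VPair s t" "s \<in> Sec (mdom p) n" "t \<in> Sec (mdom q) n"
    by (auto simp: prod_sh_simps)
  then show "mu_label \<sigma> \<tau> n v \<subseteq> (I \<union> J) \<times> UNIV"
    using d by (fastforce simp: determined_def mu_label_def)
  fix v' assume "v' \<in> Sec (mdom (span_mu_obj X Y p q)) n"
  then obtain s' t' where s': "v' = VPair s' t'" "s' \<in> Sec (mdom p) n" "t' \<in> Sec (mdom q) n"
    by (auto simp: prod_sh_simps)
  assume "mu_label \<sigma> \<tau> n v = mu_label \<sigma> \<tau> n v'"
  then have eq: "\<sigma> n s \<union> \<tau> n t = \<sigma> n s' \<union> \<tau> n t'" by (simp add: mu_label_def s s')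
  have I: "\<sigma> n s \<subseteq> I \<times> UNIV" "\<sigma> n s' \<subseteq> I \<times> UNIV" "\<tau> n t \<subseteq> J \<times> UNIV" "\<tau> n t' \<subseteq> J \<times> UNIV"
    using d s s' by (auto simp: determined_def)
  have "\<sigma> n s = (\<sigma> n s \<union> \<tau> n t) \<inter> (I \<times> UNIV)" "\<tau> n t = (\<sigma> n s \<union> \<tau> n t) \<inter> (J \<times> UNIV)"
    "\<sigma> n s' = (\<sigma> n s' \<union> \<tau> n t') \<inter> (I \<times> UNIV)" "\<tau> n t' = (\<sigma> n s' \<union> \<tau> n t') \<inter> (J \<times> UNIV)"
    using I IJ by fast+
  then have "\<sigma> n s = \<sigma> n s'" "\<tau> n t = \<tau> n t'" using eq by simp_all
  then have *: "outp p n s = outp p n s'" "inp p n s = inp p n s' \<Longrightarrow> s = s'"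
    "outp q n t = outp q n t'" "inp q n t = inp q n t' \<Longrightarrow> t = t'"
    using d s s' unfolding determined_def by blast+
  then show "outp (span_mu_obj X Y p q) n v = outp (span_mu_obj X Y p q) n v'"
    using s s' by (simp add: app_span_mu_obj[OF X p q])
  assume "inp (span_mu_obj X Y p q) n v = inp (span_mu_obj X Y p q) n v'"
  then have "join (bin X) (bin Y) (inp p n s) (inp q n t) = join (bin X) (bin Y) (inp p n s') (inp q n t')"
    using s s' by (simp add: app_span_mu_obj[OF X p q])
  then have "inp p n s = inp p n s' \<and> inp q n t = inp q n t'"
    using s s' app_machine[OF p] app_machine[OF q] by (intro join_inject) auto
  with * s s' show "v = v'" by simp
qed

lemma label_natural_mu:
  assumes l: "label_natural E p \<sigma>" "label_natural E q \<tau>"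
  shows "label_natural E (span_mu_obj X Y p q) (mu_label \<sigma> \<tau>)"
  unfolding label_natural_def
proof (intro allI ballI impI)
  fix n' k n v assume "v \<in> Sec (mdom (span_mu_obj X Y p q)) n" and "n' + k \<le> n"
  then obtain s t where "v = VPair s t" "s \<in> Sec (mdom p) n" "t \<in> Sec (mdom q) n"
    by (auto simp: prod_sh_simps)
  with l \<open>n' + k \<le> n\<close> show "mu_label \<sigma> \<tau> n' (Res (mdom (span_mu_obj X Y p q)) (Tr n' k n) v) =
      (\<lambda>(i, v). (i, Res (E i) (Tr n' k n) v)) ` mu_label \<sigma> \<tau> n v"
    by (simp add: label_natural_def mu_label_def prod_sh_simps image_Un)
qed

lemma graph_mu:
  assumes X: "X \<in> Obj (WD_cat ShN)" "Y \<in> Obj (WD_cat ShN)" and p: "p \<in> machines X" and q: "q \<in> machines Y"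
  shows "graph (span_mu_obj X Y p q) (mu_label \<sigma> \<tau>) n =
    {(w \<union> w', join (bin X) (bin Y) y y', join (bout X) (bout Y) x x') | w w' y y' x x'.
      (w, y, x) \<in> graph p \<sigma> n \<and> (w', y', x') \<in> graph q \<tau> n}" (is "?L = ?R")
proof -
  have "?L = {(mu_label \<sigma> \<tau> n (VPair s t), inp (span_mu_obj X Y p q) n (VPair s t),
      outp (span_mu_obj X Y p q) n (VPair s t)) | s t. s \<in> Sec (mdom p) n \<and> t \<in> Sec (mdom q) n}"
    unfolding graph_def Sec_span_mu_obj by blast
  also have "\<dots> = {(\<sigma> n s \<union> \<tau> n t, join (bin X) (bin Y) (inp p n s) (inp q n t),
      join (bout X) (bout Y) (outp p n s) (outp q n t)) | s t. s \<in> Sec (mdom p) n \<and> t \<in> Sec (mdom q) n}"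
    by (intro Collect_cong ex_cong1 rev_conj_cong refl) (simp add: mu_label_def app_span_mu_obj[OF X p q])
  also have "\<dots> = ?R" unfolding graph_def by blast
  finally show ?thesis .
qed

lemma determined_unit: "determined unit_machine unit_label {}"
  by (auto simp: determined_def unit_label_def Sec_unit_machine)

lemma label_natural_unit: "label_natural E unit_machine unit_label"
  by (auto simp: label_natural_def unit_label_def)

lemma graph_unit: "graph unit_machine unit_label n = {({}, \<lambda>_. undefined, \<lambda>_. undefined)}"
  using app_unit_machine[of _ n] by (auto simp: graph_def unit_label_def Sec_unit_machine)

lemma graph_sections:
  assumes "p \<in> machines X" "(w, y, x) \<in> graph p \<sigma> n"
  shows "y \<in> sections (bin X) n" "x \<in> sections (bout X) n"
  using assms app_machine[OF assms(1)] by (auto simp: graph_def)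

section \<open>Label-preserving arrows\<close>

definition label_hom ::
  "'a sbox \<Rightarrow> 'a shmap \<Rightarrow> 'a label \<Rightarrow> 'a shmap \<Rightarrow> 'a label \<Rightarrow> 'a shmap \<times> 'a shmap \<times> 'a shmap \<Rightarrow> bool"
where
  "label_hom X p \<sigma> q \<tau> k \<longleftrightarrow> k \<in> hom (slice ShN (span_base X)) p q \<and>
    (\<forall>n. \<forall>s \<in> Sec (mdom p) n. \<tau> n (app (fst (snd k)) n s) = \<sigma> n s)"

lemma slice_homI:
  assumes p: "p \<in> machines X" and q: "q \<in> machines X" and f: "f \<in> hom ShN (mdom p) (mdom q)"
    and eq: "\<And>n s. s \<in> Sec (mdom p) n \<Longrightarrow>
      inp q n (app f n s) = inp p n s \<and> outp q n (app f n s) = outp p n s"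
  shows "(p, f, q) \<in> hom (slice ShN (span_base X)) p q"
proof -
  have "q \<odot> f = p"
  proof (rule map_eqI)
    show "q \<odot> f \<in> hom ShN (mdom p) (span_base X)" using f q by (auto simp: machines_iff Comp_hom)
    show "p \<in> hom ShN (mdom p) (span_base X)" using p by (auto simp: machines_iff)
    fix n s assume "s \<in> Sec (mdom p) n"
    then show "app (q \<odot> f) n s = app p n s"
      using eq app_machine(1)[OF p] app_machine(1)[OF q hom_app[OF f]]
      by (simp add: app_Comp mdom_hom[OF f])
  qed
  with p q f show ?thesis by (auto simp: hom_def slice_def)
qed

lemma slice_homE:
  assumes "k \<in> hom (slice ShN (span_base X)) p q"
  obtains f where "k = (p, f, q)" "p \<in> machines X" "q \<in> machines X" "f \<in> hom ShN (mdom p) (mdom q)"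
    "\<And>n s. s \<in> Sec (mdom p) n \<Longrightarrow> inp q n (app f n s) = inp p n s \<and> outp q n (app f n s) = outp p n s"
proof -
  obtain f where f: "k = (p, f, q)" "p \<in> machines X" "q \<in> machines X" "f \<in> hom ShN (mdom p) (mdom q)"
    "q \<odot> f = p"
    using assms by (auto simp: slice_def hom_def)
  have "app q n (app f n s) = app p n s" if "s \<in> Sec (mdom p) n" for n s
    using app_Comp[of s f n q] that f(5) mdom_hom[OF f(4)] by simp
  then show thesis using that f by (simp add: inp_def outp_def)
qed

lemma Comp_slice: "Comp (slice C b) (q', g, r) (p, f, q) = (p, Comp C g f, r)"
  and Ident_slice: "Ident (slice C b) p = (p, Ident C (Dom C p), p)"
  by (simp_all add: slice_def)

lemmas category_machines = category_slice[OF category_ShN]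

text \<open>Both arrows lie over the same base, so they preserve inputs. The two images of a state
  then have equal labels and equal inputs, and \<open>q\<close> is determined.\<close>

lemma label_hom_unique:
  assumes k: "label_hom X p \<sigma> q \<tau> k" and l: "label_hom X p \<sigma> q \<tau> l" and d: "determined q \<tau> I"
  shows "k = l"
proof -
  obtain f where f: "k = (p, f, q)" "f \<in> hom ShN (mdom p) (mdom q)"
      "\<And>n s. s \<in> Sec (mdom p) n \<Longrightarrow> inp q n (app f n s) = inp p n s \<and> outp q n (app f n s) = outp p n s"
    using k unfolding label_hom_def by (blast elim: slice_homE)
  obtain g where g: "l = (p, g, q)" "g \<in> hom ShN (mdom p) (mdom q)"
      "\<And>n s. s \<in> Sec (mdom p) n \<Longrightarrow> inp q n (app g n s) = inp p n s \<and> outp q n (app g n s) = outp p n s"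
    using l unfolding label_hom_def by (blast elim: slice_homE)
  have "app f n s = app g n s" if s: "s \<in> Sec (mdom p) n" for n s
  proof -
    have "\<tau> n (app f n s) = \<tau> n (app g n s)" using k l s f g by (simp add: label_hom_def)
    with d f(3)[OF s] g(3)[OF s] hom_app[OF f(2) s] hom_app[OF g(2) s] show ?thesis
      unfolding determined_def by metis
  qed
  then show ?thesis using f g map_eqI by metis
qed

lemma label_hom_ident:
  assumes "p \<in> machines X"
  shows "label_hom X p \<sigma> p \<sigma> (Ident (slice ShN (span_base X)) p)"
  using category.ident_hom[OF category_machines assms]
  by (simp add: label_hom_def Ident_slice app_Ident)

lemma label_hom_comp:
  assumes k: "label_hom X p \<sigma> q \<tau> k" and l: "label_hom X q \<tau> r \<rho> l"
  shows "label_hom X p \<sigma> r \<rho> (Comp (slice ShN (span_base X)) l k)"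
proof -
  obtain f where f: "k = (p, f, q)" "f \<in> hom ShN (mdom p) (mdom q)"
    using k unfolding label_hom_def by (blast elim: slice_homE)
  obtain g where g: "l = (q, g, r)" using l unfolding label_hom_def by (blast elim: slice_homE)
  have "Comp (slice ShN (span_base X)) l k \<in> hom (slice ShN (span_base X)) p r"
    using category.comp_hom[OF category_machines] k l unfolding label_hom_def by blast
  then show ?thesis
    using k l f g by (simp add: label_hom_def Comp_slice app_Comp mdom_hom[OF f(2)] hom_app[OF f(2)])
qed

text \<open>Inverses are unique, so the definite description in \<open>cinv\<close> denotes
  one.\<close>

lemma is_inverse_cinv:
  assumes C: "category C" and f: "f \<in> hom C a b" and inv: "invertible C f"
  shows "is_inverse C f (cinv C f)"
proof -
  interpret category C by fact
  have ab: "Dom C f = a" "Cod C f = b" using f by (auto simp: hom_def)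
  obtain g where g: "is_inverse C f g" using inv by (auto simp: invertible_def)
  have "h = g" if h: "is_inverse C f h" for h
    using g h comp_assoc[of g b a f b h a] comp_ident_left[of g b a] comp_ident_right[of h b a] f
    unfolding is_inverse_def ab by simp
  with g show ?thesis unfolding cinv_def by (metis theI)
qed

text \<open>The label of \<open>app g n s\<close> is that of its image under \<open>f\<close>, and
  this image is \<open>s\<close> because \<open>g\<close> is a right inverse of
  \<open>f\<close>.\<close>

lemma label_hom_cinv:
  assumes k: "label_hom X p \<sigma> q \<tau> k" and inv: "invertible (slice ShN (span_base X)) k"
  shows "label_hom X q \<tau> p \<sigma> (cinv (slice ShN (span_base X)) k)"
proof -
  let ?C = "slice ShN (span_base X)"
  have kh: "k \<in> hom ?C p q" using k by (simp add: label_hom_def)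
  obtain f where f: "k = (p, f, q)" "f \<in> hom ShN (mdom p) (mdom q)"
    using kh by (blast elim: slice_homE)
  have i: "is_inverse ?C k (cinv ?C k)"
    by (rule is_inverse_cinv[OF category_machines kh inv])
  then have gh: "cinv ?C k \<in> hom ?C q p" "Comp ?C k (cinv ?C k) = Ident ?C q"
    using kh by (auto simp: is_inverse_def hom_def)
  obtain g where g: "cinv ?C k = (q, g, p)" "g \<in> hom ShN (mdom q) (mdom p)"
    using gh(1) by (blast elim: slice_homE)
  have "f \<odot> g = Ident ShN (mdom q)" using gh(2) unfolding g by (simp add: f Comp_slice Ident_slice)
  then have "app f n (app g n s) = s" if "s \<in> Sec (mdom q) n" for n s
    using that app_Comp[of s g n f] mdom_hom[OF g(2)] by (simp add: app_Ident)
  then have "\<sigma> n (app g n s) = \<tau> n s" if "s \<in> Sec (mdom q) n" for n s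
    using k that hom_app[OF g(2) that] unfolding label_hom_def f by (metis fst_conv snd_conv)
  then show ?thesis using gh(1) by (simp add: label_hom_def g)
qed

text \<open>The source label is the target label pulled back along \<open>k\<close>. Thus arbitrary
  arrows, which occur in naturality squares and in functoriality, can take part in arguments by
  labels.\<close>

lemma label_hom_lift:
  assumes "k \<in> hom (slice ShN (span_base X)) p q"
  shows "\<exists>\<sigma>. label_hom X p \<sigma> q \<tau> k"
  using assms by (auto simp: label_hom_def)

text \<open>Both round trips preserve labels, as do the identities, so uniqueness identifies
  them.\<close>

lemma label_hom_invertible:
  assumes k: "label_hom X p \<sigma> q \<tau> k" and l: "label_hom X q \<tau> p \<sigma> l"
    and d: "determined p \<sigma> I" "determined q \<tau> J"
  shows "invertible (slice ShN (span_base X)) k"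
proof -
  let ?C = "slice ShN (span_base X)"
  have h: "k \<in> hom ?C p q" "l \<in> hom ?C q p" using k l by (simp_all add: label_hom_def)
  then have pq: "p \<in> machines X" "q \<in> machines X" by (blast elim: slice_homE)+
  have "Comp ?C l k = Ident ?C p"
    by (rule label_hom_unique[OF label_hom_comp[OF k l] label_hom_ident[OF pq(1)] d(1)])
  moreover have "Comp ?C k l = Ident ?C q"
    by (rule label_hom_unique[OF label_hom_comp[OF l k] label_hom_ident[OF pq(2)] d(2)])
  ultimately show ?thesis using h unfolding invertible_def is_inverse_def hom_def by (intro conjI exI[of _ l]) simp_all
qed

lemma label_hom_act:
  assumes \<phi>: "\<phi> \<in> Arr (WD_cat ShN)" and k: "label_hom (wdom \<phi>) p \<sigma> q \<tau> k"
  shows "label_hom (wcod \<phi>) (span_act_obj \<phi> p) (act_label \<sigma>) (span_act_obj \<phi> q) (act_label \<tau>)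
    (fa (span_act \<phi>) k)"
proof -
  obtain f where f: "k = (p, f, q)" "p \<in> machines (wdom \<phi>)" "q \<in> machines (wdom \<phi>)"
      "f \<in> hom ShN (mdom p) (mdom q)"
      "\<And>n s. s \<in> Sec (mdom p) n \<Longrightarrow> inp q n (app f n s) = inp p n s \<and> outp q n (app f n s) = outp p n s"
    using k unfolding label_hom_def by (blast elim: slice_homE)
  note P = Sec_pb_pull_leg[OF \<phi> f(2)] and Q = Sec_pb_pull_leg[OF \<phi> f(3)]
  let ?g = "mk_map (pb p (pull_leg \<phi>)) (pb q (pull_leg \<phi>)) (\<lambda>n v. VPair (app f n (vfst v)) (vsnd v))"
  have pb: "interval_sheaf (pb r (pull_leg \<phi>))" if "r \<in> machines (wdom \<phi>)" for r
    using that \<phi> by (intro sheaf_pb[OF _ pull_leg_hom]) (auto simp: machines_iff)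
  have g: "?g \<in> hom ShN (pb p (pull_leg \<phi>)) (pb q (pull_leg \<phi>))"
    by (rule mk_map_hom)
      (use f pb in \<open>auto simp: P Q hom_app pb_simps(2) hom_Res\<close>)
  have "(span_act_obj \<phi> p, ?g, span_act_obj \<phi> q) \<in>
      hom (slice ShN (span_base (wcod \<phi>))) (span_act_obj \<phi> p) (span_act_obj \<phi> q)"
  proof (rule slice_homI[OF span_act_obj_hom span_act_obj_hom])
    fix n v assume v: "v \<in> Sec (mdom (span_act_obj \<phi> p)) n"
    from v obtain s y where s: "s \<in> Sec (mdom p) n" "y \<in> sections (bin (wcod \<phi>)) n"
      "inp p n s = feed \<phi> y (outp p n s)" "v = VPair s (VPair (Fam y) (Fam (outp p n s)))"
      "inp (span_act_obj \<phi> p) n v = y" "outp (span_act_obj \<phi> p) n v = readout \<phi> (outp p n s)"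
      by (rule Sec_span_act_obj[OF \<phi> f(2)])
    have "app f n s \<in> Sec (mdom q) n" using f(4) s(1) by (rule hom_app)
    from app_span_act_obj[OF \<phi> f(3) this s(2)] f(5)[OF s(1)] s v
    show "inp (span_act_obj \<phi> q) n (app ?g n v) = inp (span_act_obj \<phi> p) n v \<and>
        outp (span_act_obj \<phi> q) n (app ?g n v) = outp (span_act_obj \<phi> p) n v"
      by (simp add: app_mk_map)
  qed (use \<phi> f g in auto)
  moreover have "act_label \<tau> n (app ?g n v) = act_label \<sigma> n v"
    if v: "v \<in> Sec (mdom (span_act_obj \<phi> p)) n" for n v
  proof -
    obtain s where "vfst v = s" "s \<in> Sec (mdom p) n"
      using v Sec_span_act_obj[OF \<phi> f(2)] by (metis val.sel(2))
    then show ?thesis using k v by (simp add: label_hom_def act_label_def app_mk_map f(1))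
  qed
  ultimately show ?thesis by (simp add: label_hom_def span_act_def f(1))
qed

lemma label_hom_mu:
  assumes X: "X \<in> Obj (WD_cat ShN)" "Y \<in> Obj (WD_cat ShN)"
    and k: "label_hom X p \<sigma> p' \<sigma>' k" and l: "label_hom Y q \<tau> q' \<tau>' l"
  shows "label_hom (box_sum X Y) (span_mu_obj X Y p q) (mu_label \<sigma> \<tau>)
    (span_mu_obj X Y p' q') (mu_label \<sigma>' \<tau>') (fa (mu Mch_N X Y) (k, l))"
proof -
  obtain f where f: "k = (p, f, p')" "p \<in> machines X" "p' \<in> machines X" "f \<in> hom ShN (mdom p) (mdom p')"
      "\<And>n s. s \<in> Sec (mdom p) n \<Longrightarrow> inp p' n (app f n s) = inp p n s \<and> outp p' n (app f n s) = outp p n s"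
    using k unfolding label_hom_def by (blast elim: slice_homE)
  obtain g where g: "l = (q, g, q')" "q \<in> machines Y" "q' \<in> machines Y" "g \<in> hom ShN (mdom q) (mdom q')"
      "\<And>n s. s \<in> Sec (mdom q) n \<Longrightarrow> inp q' n (app g n s) = inp q n s \<and> outp q' n (app g n s) = outp q n s"
    using l unfolding label_hom_def by (blast elim: slice_homE)
  have app: "app (prod_map f g) n (VPair s t) = VPair (app f n s) (app g n t)"
    if "s \<in> Sec (mdom p) n" "t \<in> Sec (mdom q) n" for n s t
    using that by (simp add: app_prod_map mdom_hom[OF f(4)] mdom_hom[OF g(4)])
  have "(span_mu_obj X Y p q, prod_map f g, span_mu_obj X Y p' q') \<in>
      hom (slice ShN (span_base (box_sum X Y))) (span_mu_obj X Y p q) (span_mu_obj X Y p' q')"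
  proof (rule slice_homI[OF span_mu_obj_hom span_mu_obj_hom])
    show "prod_map f g \<in> hom ShN (mdom (span_mu_obj X Y p q)) (mdom (span_mu_obj X Y p' q'))"
      using prod_map_hom[OF f(4) g(4)] by simp
    fix n v assume "v \<in> Sec (mdom (span_mu_obj X Y p q)) n"
    then obtain s t where st: "v = VPair s t" "s \<in> Sec (mdom p) n" "t \<in> Sec (mdom q) n"
      by (auto simp: prod_sh_simps)
    show "inp (span_mu_obj X Y p' q') n (app (prod_map f g) n v) = inp (span_mu_obj X Y p q) n v \<and>
        outp (span_mu_obj X Y p' q') n (app (prod_map f g) n v) = outp (span_mu_obj X Y p q) n v"
      using st f g by (simp add: app app_span_mu_obj X hom_app[OF f(4)] hom_app[OF g(4)])
  qed (use X f g in auto)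
  moreover have "mu_label \<sigma>' \<tau>' n (app (prod_map f g) n v) = mu_label \<sigma> \<tau> n v"
    if v: "v \<in> Sec (mdom (span_mu_obj X Y p q)) n" for n v
  proof -
    obtain s t where st: "v = VPair s t" "s \<in> Sec (mdom p) n" "t \<in> Sec (mdom q) n"
      using v by (auto simp: prod_sh_simps)
    then show ?thesis using k l by (simp add: label_hom_def mu_label_def app f(1) g(1))
  qed
  ultimately show ?thesis by (simp add: label_hom_def Mch_N_def f(1) g(1))
qed

section \<open>Canonical isomorphisms from equal relations\<close>

text \<open>The description selects the state of \<open>q\<close> with prescribed label, input and
  output. Inclusion of graphs provides such a state, and \<open>determined\<close> makes it
  unique.\<close>

definition canon :: "'a shmap \<Rightarrow> 'a label \<Rightarrow> 'a shmap \<Rightarrow> 'a label \<Rightarrow>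
    'a shmap \<times> 'a shmap \<times> 'a shmap" where
  "canon p \<sigma> q \<tau> = (p, mk_map (mdom p) (mdom q) (\<lambda>n s. THE s'. s' \<in> Sec (mdom q) n \<and>
     \<tau> n s' = \<sigma> n s \<and> inp q n s' = inp p n s \<and> outp q n s' = outp p n s), q)"

lemma machine_Res:
  assumes p: "p \<in> machines X" and s: "s \<in> Sec (mdom p) n" and k: "n' + k \<le> n"
  shows "inp p n' (Res (mdom p) (Tr n' k n) s) = fam (Res (hat (bin X)) (Tr n' k n) (Fam (inp p n s)))"
    and "outp p n' (Res (mdom p) (Tr n' k n) s) = fam (Res (hat (bout X)) (Tr n' k n) (Fam (outp p n s)))"
proof -
  have "app p n' (Res (mdom p) (Tr n' k n) s) =
      Res (span_base X) (Tr n' k n) (VPair (Fam (inp p n s)) (Fam (outp p n s)))"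
    using hom_Res[OF p[unfolded machines_iff] k s] unfolding app_machine(1)[OF p s] .
  then show "inp p n' (Res (mdom p) (Tr n' k n) s) = fam (Res (hat (bin X)) (Tr n' k n) (Fam (inp p n s)))"
    "outp p n' (Res (mdom p) (Tr n' k n) s) = fam (Res (hat (bout X)) (Tr n' k n) (Fam (outp p n s)))"
    unfolding inp_def[of p n' "Res _ _ _"] outp_def[of p n' "Res _ _ _"]
    by (simp_all add: span_base_def prod_sh_simps)
qed

text \<open>Naturality comes from uniqueness: the restriction of the selected state has the label,
  input and output that are required of the state selected for the restriction.\<close>

lemma canon_label_hom:
  assumes p: "p \<in> machines X" and q: "q \<in> machines X" and d: "determined q \<tau> I"
    and l: "label_natural E p \<sigma>" "label_natural E q \<tau>"
    and sub: "\<And>n. graph p \<sigma> n \<subseteq> graph q \<tau> n"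
  shows "label_hom X p \<sigma> q \<tau> (canon p \<sigma> q \<tau>)"
proof -
  define P where "P n s s' \<longleftrightarrow> s' \<in> Sec (mdom q) n \<and>
     \<tau> n s' = \<sigma> n s \<and> inp q n s' = inp p n s \<and> outp q n s' = outp p n s" for n s s'
  define h where "h n s = (THE s'. P n s s')" for n s
  have unique: "s' = s''" if "P n s s'" "P n s s''" for n s s' s''
    using d that unfolding determined_def P_def by metis
  have h: "P n s (h n s)" if s: "s \<in> Sec (mdom p) n" for n s
  proof -
    have "(\<sigma> n s, inp p n s, outp p n s) \<in> graph p \<sigma> n" using s by (auto simp: graph_def)
    then have "(\<sigma> n s, inp p n s, outp p n s) \<in> graph q \<tau> n" using sub by blast
    then have "\<exists>s'. P n s s'" unfolding P_def graph_def by fastforce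
    then show ?thesis unfolding h_def using unique theI by metis
  qed
  have hom: "mk_map (mdom p) (mdom q) h \<in> hom ShN (mdom p) (mdom q)"
  proof (rule mk_map_hom)
    show "interval_sheaf (mdom p)" "interval_sheaf (mdom q)"
      using p q by (auto simp: machines_iff hom_ShN)
    then show "h n' (Res (mdom p) (Tr n' k n) s) = Res (mdom q) (Tr n' k n) (h n s)"
      if k: "n' + k \<le> n" and s: "s \<in> Sec (mdom p) n" for n' k n s
    proof (intro unique[OF h])
      have hs: "h n s \<in> Sec (mdom q) n" "P n s (h n s)" using h[OF s] by (simp_all add: P_def)
      show "P n' (Res (mdom p) (Tr n' k n) s) (Res (mdom q) (Tr n' k n) (h n s))"
        unfolding P_def
        using k s hs l machine_Res[OF p s k] machine_Res[OF q hs(1) k] \<open>interval_sheaf (mdom q)\<close>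
        by (auto simp: P_def sheaf_Res label_natural_def)
    qed (simp add: k s sheaf_Res)
  qed (use h in \<open>simp add: P_def\<close>)
  have "canon p \<sigma> q \<tau> = (p, mk_map (mdom p) (mdom q) h, q)"
    unfolding canon_def h_def P_def ..
  then show ?thesis
    using slice_homI[OF p q hom] h by (simp add: label_hom_def app_mk_map P_def)
qed

text \<open>Every label arises from a label built from leaves by substitution, so it suffices to
  construct the canonical isomorphisms for the latter.\<close>

lemma label_hom_subst:
  assumes "label_hom X p \<sigma> q \<tau> k"
    and "\<And>n s. s \<in> Sec (mdom p) n \<Longrightarrow> \<sigma>' n s = (\<Union>(i, v) \<in> \<sigma> n s. \<theta> n i v)"
    and "\<And>n s. s \<in> Sec (mdom q) n \<Longrightarrow> \<tau>' n s = (\<Union>(i, v) \<in> \<tau> n s. \<theta> n i v)"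
  shows "label_hom X p \<sigma>' q \<tau>' k"
proof -
  obtain f where f: "k = (p, f, q)" "f \<in> hom ShN (mdom p) (mdom q)"
    using assms(1) unfolding label_hom_def by (blast elim: slice_homE)
  show ?thesis using assms hom_app[OF f(2)] by (simp add: label_hom_def f(1))
qed

text \<open>Equal graphs give canonical arrows in both directions, and these are mutually inverse
  because they preserve labels.\<close>

lemma canon_iso:
  assumes "p \<in> machines X" "q \<in> machines X" "determined p \<sigma> I" "determined q \<tau> J"
    "label_natural E p \<sigma>" "label_natural E q \<tau>"
    and graph: "\<And>n. graph p \<sigma> n = graph q \<tau> n"
  shows "label_hom X p \<sigma> q \<tau> (canon p \<sigma> q \<tau>)"
    and "invertible (slice ShN (span_base X)) (canon p \<sigma> q \<tau>)"
proof -
  show *: "label_hom X p \<sigma> q \<tau> (canon p \<sigma> q \<tau>)"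
    using assms by (intro canon_label_hom[of p X q \<tau> J E]) auto
  have "label_hom X q \<tau> p \<sigma> (canon q \<tau> p \<sigma>)"
    using assms by (intro canon_label_hom[of q X p \<sigma> I E]) auto
  from label_hom_invertible[OF * this] assms
  show "invertible (slice ShN (span_base X)) (canon p \<sigma> q \<tau>)" by blast
qed

section \<open>The symmetric monoidal category of wiring diagrams\<close>

lemma win_cases:
  assumes "\<phi> \<in> hom (WD_cat C) X Y" "i \<in> ports (bin X)"
  obtains (out) j where "win \<phi> i = PL j" "j \<in> ports (bout X)" "ty (bout X) j = ty (bin X) i"
  | (inn) k where "win \<phi> i = PR k" "k \<in> ports (bin Y)" "ty (bin Y) k = ty (bin X) i"
proof -
  have "win \<phi> i \<in> ports (bout X \<uplus> bin Y)" "ty (bout X \<uplus> bin Y) (win \<phi> i) = ty (bin X) i"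
    using assms typed_fun_app unfolding hom_WD Arr_WD by metis+
  with that show thesis by auto
qed

lemma wout_port:
  assumes "\<phi> \<in> hom (WD_cat C) X Y" "j \<in> ports (bout Y)"
  shows "wout \<phi> j \<in> ports (bout X)" "ty (bout X) (wout \<phi> j) = ty (bout Y) j"
  using assms typed_fun_app unfolding hom_WD Arr_WD by metis+

lemma wiring_homI:
  assumes "X \<in> Obj (WD_cat C)" "Y \<in> Obj (WD_cat C)" "wdom \<phi> = X" "wcod \<phi> = Y"
    and "win \<phi> \<in> extensional (ports (bin X))" "wout \<phi> \<in> extensional (ports (bout Y))"
    and "\<And>i. i \<in> ports (bin X) \<Longrightarrow>
      win \<phi> i \<in> ports (bout X \<uplus> bin Y) \<and> ty (bout X \<uplus> bin Y) (win \<phi> i) = ty (bin X) i"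
    and "\<And>j. j \<in> ports (bout Y) \<Longrightarrow> wout \<phi> j \<in> ports (bout X) \<and> ty (bout X) (wout \<phi> j) = ty (bout Y) j"
  shows "\<phi> \<in> hom (WD_cat C) X Y"
  using assms unfolding hom_WD Arr_WD typed_fun_def PiE_def by blast

lemma wiring_eqI:
  assumes "\<phi> \<in> hom (WD_cat C) X Y" "\<psi> \<in> hom (WD_cat C) X Y"
    and "\<And>i. i \<in> ports (bin X) \<Longrightarrow> win \<phi> i = win \<psi> i"
    and "\<And>j. j \<in> ports (bout Y) \<Longrightarrow> wout \<phi> j = wout \<psi> j"
  shows "\<phi> = \<psi>"
proof -
  have "win \<phi> = win \<psi>"
    by (rule extensionalityI[of _ "ports (bin X)"])
      (use assms in \<open>auto simp: hom_WD Arr_WD typed_fun_def PiE_def\<close>)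
  moreover have "wout \<phi> = wout \<psi>"
    by (rule extensionalityI[of _ "ports (bout Y)"])
      (use assms in \<open>auto simp: hom_WD Arr_WD typed_fun_def PiE_def\<close>)
  ultimately show ?thesis using assms(1,2) by (simp add: hom_WD)
qed

lemma Comp_WD_simps [simp]:
  "wdom (Comp (WD_cat C) \<psi> \<phi>) = wdom \<phi>" "wcod (Comp (WD_cat C) \<psi> \<phi>) = wcod \<psi>"
  by (simp_all add: WD_cat_def)

lemma win_Comp: "i \<in> ports (bin (wdom \<phi>)) \<Longrightarrow> win (Comp (WD_cat C) \<psi> \<phi>) i =
    pcase PL (\<lambda>y. pcase (\<lambda>y'. PL (wout \<phi> y')) PR (win \<psi> y)) (win \<phi> i)"
  and wout_Comp: "j \<in> ports (bout (wcod \<psi>)) \<Longrightarrow> wout (Comp (WD_cat C) \<psi> \<phi>) j = wout \<phi> (wout \<psi> j)"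
  by (simp_all add: WD_cat_def)

lemma Comp_WD_ext:
  "win (Comp (WD_cat C) \<psi> \<phi>) \<in> extensional (ports (bin (wdom \<phi>)))"
  "wout (Comp (WD_cat C) \<psi> \<phi>) \<in> extensional (ports (bout (wcod \<psi>)))"
  by (simp_all add: WD_cat_def)

lemma hom_WD_Obj:
  assumes "\<phi> \<in> hom (WD_cat C) X Y"
  shows "X \<in> Obj (WD_cat C)" "Y \<in> Obj (WD_cat C)" "wdom \<phi> = X" "wcod \<phi> = Y"
  using assms by (auto simp: hom_WD Arr_WD)

lemma Comp_WD_hom:
  assumes \<phi>: "\<phi> \<in> hom (WD_cat C) X Y" and \<psi>: "\<psi> \<in> hom (WD_cat C) Y Z"
  shows "Comp (WD_cat C) \<psi> \<phi> \<in> hom (WD_cat C) X Z"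
proof (rule wiring_homI)
  note [simp] = hom_WD_Obj[OF \<phi>] hom_WD_Obj[OF \<psi>]
  show "win (Comp (WD_cat C) \<psi> \<phi>) \<in> extensional (ports (bin X))"
    "wout (Comp (WD_cat C) \<psi> \<phi>) \<in> extensional (ports (bout Z))"
    using Comp_WD_ext[where \<phi> = \<phi> and \<psi> = \<psi>] by auto
  fix i assume i: "i \<in> ports (bin X)"
  show "win (Comp (WD_cat C) \<psi> \<phi>) i \<in> ports (bout X \<uplus> bin Z) \<and>
      ty (bout X \<uplus> bin Z) (win (Comp (WD_cat C) \<psi> \<phi>) i) = ty (bin X) i"
    using \<phi> i
  proof (cases rule: win_cases)
    case (inn k)
    from \<psi> inn(2) show ?thesis
      by (cases rule: win_cases) (use i inn wout_port[OF \<phi>] in \<open>auto simp: win_Comp\<close>)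
  qed (use i in \<open>auto simp: win_Comp\<close>)
next
  fix j assume "j \<in> ports (bout Z)"
  then show "wout (Comp (WD_cat C) \<psi> \<phi>) j \<in> ports (bout X) \<and>
      ty (bout X) (wout (Comp (WD_cat C) \<psi> \<phi>) j) = ty (bout Z) j"
    using wout_port[OF \<phi>] wout_port[OF \<psi>] by (simp add: wout_Comp hom_WD_Obj[OF \<psi>])
qed (use hom_WD_Obj[OF \<phi>] hom_WD_Obj[OF \<psi>] in auto)

section \<open>Relabellings and the category of wiring diagrams\<close>

text \<open>Unlike \<open>typed_fun\<close> this does not ask for extensionality, which
  \<open>relabel\<close> enforces itself. Relabellings can then be given by \<open>pcase\<close> and
  composed as plain functions.\<close>

definition typed_on :: "('a port \<Rightarrow> 'a port) \<Rightarrow> ('a, 'o) tset \<Rightarrow> ('a, 'o) tset \<Rightarrow> bool" where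
  "typed_on f A B \<longleftrightarrow> (\<forall>i \<in> ports A. f i \<in> ports B \<and> ty B (f i) = ty A i)"

lemma relabel_simps [simp]:
  "wdom (relabel X Y f g) = X" "wcod (relabel X Y f g) = Y"
  "i \<in> ports (bin X) \<Longrightarrow> win (relabel X Y f g) i = PR (f i)"
  "j \<in> ports (bout Y) \<Longrightarrow> wout (relabel X Y f g) j = g j"
  by (simp_all add: relabel_def)

lemma relabel_hom:
  assumes "X \<in> Obj (WD_cat C)" "Y \<in> Obj (WD_cat C)" "typed_on f (bin X) (bin Y)" "typed_on g (bout Y) (bout X)"
  shows "relabel X Y f g \<in> hom (WD_cat C) X Y"
  by (rule wiring_homI) (use assms in \<open>auto simp: typed_on_def\<close>, auto simp: relabel_def)

lemma relabel_cong:
  assumes "\<And>i. i \<in> ports (bin X) \<Longrightarrow> f i = f' i" "\<And>j. j \<in> ports (bout Y) \<Longrightarrow> g j = g' j"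
  shows "relabel X Y f g = relabel X Y f' g'"
  using assms by (auto simp: relabel_def intro: restrict_ext)

lemma Ident_WD: "Ident (WD_cat C) X = relabel X X (\<lambda>x. x) (\<lambda>x. x)"
  by (simp add: WD_cat_def relabel_def)

lemma typed_on_ident: "typed_on (\<lambda>x. x) A A"
  by (simp add: typed_on_def)

lemma Ident_WD_hom: "X \<in> Obj (WD_cat C) \<Longrightarrow> Ident (WD_cat C) X \<in> hom (WD_cat C) X X"
  unfolding Ident_WD by (intro relabel_hom typed_on_ident)

text \<open>A relabelling connects inputs to external inputs only, so no feedback arises and
  composition is that of functions. The coherence diagrams of the monoidal category can thereby be
  checked port by port.\<close>

lemma relabel_Comp:
  assumes "typed_on f (bin X) (bin Y)" "typed_on g' (bout Z) (bout Y)"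
  shows "Comp (WD_cat C) (relabel Y Z f' g') (relabel X Y f g) = relabel X Z (\<lambda>i. f' (f i)) (\<lambda>j. g (g' j))"
  using assms by (auto simp: WD_cat_def relabel_def typed_on_def intro: restrict_ext)

text \<open>For associativity, an input port is traced through the successive boxes until its wire
  reaches an output of the innermost box or an input of the outermost one; both bracketings end at
  the same port.\<close>

lemma category_WD: "category (WD_cat C :: (('a, 'o) box, ('a, 'o) wiring) cat)"
proof
  fix f g h and V X Y Z :: "('a, 'o) box"
  assume f: "f \<in> hom (WD_cat C) V X"
  note [simp] = hom_WD_Obj(3,4)[OF f]
  show "Comp (WD_cat C) f (Ident (WD_cat C) V) = f"
  proof (rule wiring_eqI[OF Comp_WD_hom[OF Ident_WD_hom f] f])
    fix i assume i: "i \<in> ports (bin V)"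
    with f show "win (Comp (WD_cat C) f (Ident (WD_cat C) V)) i = win f i"
      by (cases rule: win_cases) (use i in \<open>auto simp: Ident_WD win_Comp\<close>)
  qed (use hom_WD_Obj[OF f] wout_port[OF f] in \<open>auto simp: Ident_WD wout_Comp\<close>)
  show "Comp (WD_cat C) (Ident (WD_cat C) X) f = f"
  proof (rule wiring_eqI[OF Comp_WD_hom[OF f Ident_WD_hom] f])
    fix i assume i: "i \<in> ports (bin V)"
    with f show "win (Comp (WD_cat C) (Ident (WD_cat C) X) f) i = win f i"
      by (cases rule: win_cases) (use i in \<open>auto simp: Ident_WD win_Comp\<close>)
  qed (use hom_WD_Obj[OF f] wout_port[OF f] in \<open>auto simp: Ident_WD wout_Comp\<close>)
  assume g: "g \<in> hom (WD_cat C) X Y"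
  note [simp] = hom_WD_Obj(3,4)[OF g]
  show "Comp (WD_cat C) g f \<in> hom (WD_cat C) V Y" by (rule Comp_WD_hom[OF f g])
  assume h: "h \<in> hom (WD_cat C) Y Z"
  note [simp] = hom_WD_Obj(3,4)[OF h]
  show "Comp (WD_cat C) h (Comp (WD_cat C) g f) = Comp (WD_cat C) (Comp (WD_cat C) h g) f"
  proof (rule wiring_eqI[OF Comp_WD_hom[OF Comp_WD_hom[OF f g] h] Comp_WD_hom[OF f Comp_WD_hom[OF g h]]])
    fix i assume i: "i \<in> ports (bin V)"
    show "win (Comp (WD_cat C) h (Comp (WD_cat C) g f)) i = win (Comp (WD_cat C) (Comp (WD_cat C) h g) f) i"
      using f i
    proof (cases rule: win_cases)
      case (inn k)
      from g inn(2) show ?thesis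
      proof (cases rule: win_cases)
        case (inn k')
        from h inn(2) show ?thesis
          by (cases rule: win_cases)
            (use i inn \<open>win f i = PR k\<close> \<open>k \<in> _\<close> in \<open>auto simp: win_Comp wout_Comp\<close>)
      qed (use i inn in \<open>auto simp: win_Comp\<close>)
    qed (use i in \<open>auto simp: win_Comp\<close>)
  next
    fix j assume "j \<in> ports (bout Z)"
    then show "wout (Comp (WD_cat C) h (Comp (WD_cat C) g f)) j =
        wout (Comp (WD_cat C) (Comp (WD_cat C) h g) f) j"
      using wout_port[OF h] by (simp add: wout_Comp)
  qed
qed (auto simp: Arr_WD Ident_WD_hom)

lemma wiring_sum_simps [simp]:
  "wdom (wiring_sum \<phi> \<psi>) = box_sum (wdom \<phi>) (wdom \<psi>)"
  "wcod (wiring_sum \<phi> \<psi>) = box_sum (wcod \<phi>) (wcod \<psi>)"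
  "i \<in> ports (bin (wdom \<phi>)) \<Longrightarrow> win (wiring_sum \<phi> \<psi>) (PL i) = pcase (PL \<circ> PL) (PR \<circ> PL) (win \<phi> i)"
  "k \<in> ports (bin (wdom \<psi>)) \<Longrightarrow> win (wiring_sum \<phi> \<psi>) (PR k) = pcase (PL \<circ> PR) (PR \<circ> PR) (win \<psi> k)"
  "j \<in> ports (bout (wcod \<phi>)) \<Longrightarrow> wout (wiring_sum \<phi> \<psi>) (PL j) = PL (wout \<phi> j)"
  "l \<in> ports (bout (wcod \<psi>)) \<Longrightarrow> wout (wiring_sum \<phi> \<psi>) (PR l) = PR (wout \<psi> l)"
  by (simp_all add: wiring_sum_def)

lemma wiring_sum_hom:
  assumes \<phi>: "\<phi> \<in> hom (WD_cat C) X Y" and \<psi>: "\<psi> \<in> hom (WD_cat C) X' Y'"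
  shows "wiring_sum \<phi> \<psi> \<in> hom (WD_cat C) (box_sum X X') (box_sum Y Y')"
proof (rule wiring_homI)
  note [simp] = hom_WD_Obj[OF \<phi>] hom_WD_Obj[OF \<psi>]
  show "win (wiring_sum \<phi> \<psi>) \<in> extensional (ports (bin (box_sum X X')))"
    "wout (wiring_sum \<phi> \<psi>) \<in> extensional (ports (bout (box_sum Y Y')))"
    by (auto simp: wiring_sum_def)
  fix i assume "i \<in> ports (bin (box_sum X X'))"
  then consider (L) k where "i = PL k" "k \<in> ports (bin X)" | (R) k where "i = PR k" "k \<in> ports (bin X')"
    by auto
  then show "win (wiring_sum \<phi> \<psi>) i \<in> ports (bout (box_sum X X') \<uplus> bin (box_sum Y Y')) \<and>
      ty (bout (box_sum X X') \<uplus> bin (box_sum Y Y')) (win (wiring_sum \<phi> \<psi>) i) = ty (bin (box_sum X X')) i"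
  proof cases
    case L
    from \<phi> L(2) show ?thesis by (cases rule: win_cases) (use L in auto)
  next
    case R
    from \<psi> R(2) show ?thesis by (cases rule: win_cases) (use R in auto)
  qed
next
  fix j assume "j \<in> ports (bout (box_sum Y Y'))"
  then show "wout (wiring_sum \<phi> \<psi>) j \<in> ports (bout (box_sum X X')) \<and>
      ty (bout (box_sum X X')) (wout (wiring_sum \<phi> \<psi>) j) = ty (bout (box_sum Y Y')) j"
    using wout_port[OF \<phi>] wout_port[OF \<psi>] hom_WD_Obj[OF \<phi>] hom_WD_Obj[OF \<psi>] by auto
qed (use hom_WD_Obj[OF \<phi>] hom_WD_Obj[OF \<psi>] in \<open>auto simp: box_sum_Obj\<close>)

lemma wiring_sum_relabel:
  "wiring_sum (relabel X Y f g) (relabel X' Y' f' g') =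
    relabel (box_sum X X') (box_sum Y Y') (pcase (\<lambda>i. PL (f i)) (\<lambda>i. PR (f' i)))
      (pcase (\<lambda>j. PL (g j)) (\<lambda>j. PR (g' j)))"
  by (auto simp: wiring_sum_def relabel_def intro!: restrict_ext)

text \<open>A wire stays inside its summand, so tracing it through the sums is the same as tracing
  it through one of the two composites.\<close>

lemma wiring_sum_Comp:
  assumes \<phi>: "\<phi> \<in> hom (WD_cat C) X Y" and \<psi>: "\<psi> \<in> hom (WD_cat C) Y Z"
    and \<phi>': "\<phi>' \<in> hom (WD_cat C) X' Y'" and \<psi>': "\<psi>' \<in> hom (WD_cat C) Y' Z'"
  shows "wiring_sum (Comp (WD_cat C) \<psi> \<phi>) (Comp (WD_cat C) \<psi>' \<phi>') =
    Comp (WD_cat C) (wiring_sum \<psi> \<psi>') (wiring_sum \<phi> \<phi>')"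
proof (rule wiring_eqI)
  note [simp] = hom_WD_Obj[OF \<phi>] hom_WD_Obj[OF \<psi>] hom_WD_Obj[OF \<phi>'] hom_WD_Obj[OF \<psi>']
  show "wiring_sum (Comp (WD_cat C) \<psi> \<phi>) (Comp (WD_cat C) \<psi>' \<phi>') \<in>
      hom (WD_cat C) (box_sum X X') (box_sum Z Z')"
    "Comp (WD_cat C) (wiring_sum \<psi> \<psi>') (wiring_sum \<phi> \<phi>') \<in> hom (WD_cat C) (box_sum X X') (box_sum Z Z')"
    using assms by (blast intro: wiring_sum_hom Comp_WD_hom)+
  fix i assume "i \<in> ports (bin (box_sum X X'))"
  then consider (L) k where "i = PL k" "k \<in> ports (bin X)" | (R) k where "i = PR k" "k \<in> ports (bin X')"
    by auto
  then show "win (wiring_sum (Comp (WD_cat C) \<psi> \<phi>) (Comp (WD_cat C) \<psi>' \<phi>')) i =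
      win (Comp (WD_cat C) (wiring_sum \<psi> \<psi>') (wiring_sum \<phi> \<phi>')) i"
  proof cases
    case L
    from \<phi> L(2) show ?thesis
    proof (cases rule: win_cases)
      case (inn l)
      from \<psi> inn(2) show ?thesis
        by (cases rule: win_cases) (use L inn in \<open>auto simp: win_Comp\<close>)
    qed (use L in \<open>auto simp: win_Comp\<close>)
  next
    case R
    from \<phi>' R(2) show ?thesis
    proof (cases rule: win_cases)
      case (inn l)
      from \<psi>' inn(2) show ?thesis
        by (cases rule: win_cases) (use R inn in \<open>auto simp: win_Comp\<close>)
    qed (use R in \<open>auto simp: win_Comp\<close>)
  qed
next
  fix j assume "j \<in> ports (bout (box_sum Z Z'))"
  then show "wout (wiring_sum (Comp (WD_cat C) \<psi> \<phi>) (Comp (WD_cat C) \<psi>' \<phi>')) j =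
      wout (Comp (WD_cat C) (wiring_sum \<psi> \<psi>') (wiring_sum \<phi> \<phi>')) j"
    using hom_WD_Obj[OF \<phi>] hom_WD_Obj[OF \<psi>] hom_WD_Obj[OF \<phi>'] hom_WD_Obj[OF \<psi>']
      wout_port[OF \<psi>] wout_port[OF \<psi>']
    by (auto simp: wout_Comp)
qed

lemma wiring_sum_Ident:
  "wiring_sum (Ident (WD_cat C) X) (Ident (WD_cat C) Y) = Ident (WD_cat C) (box_sum X Y)"
  unfolding Ident_WD wiring_sum_relabel by (rule relabel_cong) auto

lemma relabel_invertible:
  assumes X: "X \<in> Obj (WD_cat C)" "Y \<in> Obj (WD_cat C)"
    and f: "typed_on f (bin X) (bin Y)" "typed_on f' (bin Y) (bin X)"
    and g: "typed_on g (bout Y) (bout X)" "typed_on g' (bout X) (bout Y)"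
    and "\<And>i. i \<in> ports (bin X) \<Longrightarrow> f' (f i) = i" "\<And>i. i \<in> ports (bin Y) \<Longrightarrow> f (f' i) = i"
    and "\<And>i. i \<in> ports (bout X) \<Longrightarrow> g (g' i) = i" "\<And>i. i \<in> ports (bout Y) \<Longrightarrow> g' (g i) = i"
  shows "invertible (WD_cat C) (relabel X Y f g)"
proof -
  have 1: "relabel X Y f g \<in> hom (WD_cat C) X Y" "relabel Y X f' g' \<in> hom (WD_cat C) Y X"
    using X f g by (auto intro: relabel_hom)
  have "Comp (WD_cat C) (relabel Y X f' g') (relabel X Y f g) = Ident (WD_cat C) X"
    "Comp (WD_cat C) (relabel X Y f g) (relabel Y X f' g') = Ident (WD_cat C) Y"
    unfolding Ident_WD relabel_Comp[OF f(1) g(2)] relabel_Comp[OF f(2) g(1)]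
    using assms by (auto intro: relabel_cong)
  with 1 show ?thesis
    unfolding invertible_def is_inverse_def by (auto simp: hom_WD)
qed

lemma WD_simps [simp]:
  "Cat (WD C) = WD_cat C" "fo (Tens (WD C)) (X, Y) = box_sum X Y" "fa (Tens (WD C)) (\<phi>, \<psi>) = wiring_sum \<phi> \<psi>"
  "Unit (WD C) = \<lparr>bin = tempty, bout = tempty\<rparr>"
  by (simp_all add: WD_def)

lemma Assoc_WD: "Assoc (WD C) X Y Z = relabel (box_sum (box_sum X Y) Z) (box_sum X (box_sum Y Z))
    (pcase (pcase PL (PR \<circ> PL)) (PR \<circ> PR)) (pcase (PL \<circ> PL) (pcase (PL \<circ> PR) PR))"
  and Lunit_WD: "Lunit (WD C) X =
    relabel (box_sum \<lparr>bin = tempty, bout = tempty\<rparr> X) X (pcase (\<lambda>_. undefined) id) PR"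
  and Runit_WD: "Runit (WD C) X =
    relabel (box_sum X \<lparr>bin = tempty, bout = tempty\<rparr>) X (pcase id (\<lambda>_. undefined)) PL"
  and Braid_WD: "Braid (WD C) X Y = relabel (box_sum X Y) (box_sum Y X) (pcase PR PL) (pcase PR PL)"
  by (simp_all add: WD_def)

lemma ports_tempty [simp]: "ports tempty = {}"
  by (simp add: tempty_def)

lemma unit_box_WD_Obj: "\<lparr>bin = tempty, bout = tempty\<rparr> \<in> Obj (WD_cat C)"
  by (simp add: Obj_WD typed_finite_set_tempty)

context
  fixes C :: "('o, 'm) cat" and X Y Z :: "('a, 'o) box"
  assumes X: "X \<in> Obj (WD_cat C)"
begin

lemma Lunit_WD_hom: "Lunit (WD C) X \<in> hom (WD_cat C) (box_sum \<lparr>bin = tempty, bout = tempty\<rparr> X) X"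
  and Lunit_WD_invertible: "invertible (WD_cat C) (Lunit (WD C) X)"
  and Runit_WD_hom: "Runit (WD C) X \<in> hom (WD_cat C) (box_sum X \<lparr>bin = tempty, bout = tempty\<rparr>) X"
  and Runit_WD_invertible: "invertible (WD_cat C) (Runit (WD C) X)"
  unfolding Lunit_WD Runit_WD
     apply (rule relabel_hom; (simp add: box_sum_Obj unit_box_WD_Obj X; fail)?; auto simp: typed_on_def)
    \<comment> \<open>The inverse relabels in the opposite direction. Its branch
      \<open>undefined\<close> belongs to the ports of the unit box, of which there are
      none.\<close>
    apply (rule relabel_invertible[where f' = PR and g' = "pcase (\<lambda>_. undefined) id"];
      (simp add: box_sum_Obj unit_box_WD_Obj X; fail)?; auto simp: typed_on_def)
   apply (rule relabel_hom; (simp add: box_sum_Obj unit_box_WD_Obj X; fail)?; auto simp: typed_on_def)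
  apply (rule relabel_invertible[where f' = PL and g' = "pcase id (\<lambda>_. undefined)"];
      (simp add: box_sum_Obj unit_box_WD_Obj X; fail)?; auto simp: typed_on_def)
  done

context
  assumes Y: "Y \<in> Obj (WD_cat C)"
begin

lemma Braid_WD_hom: "Braid (WD C) X Y \<in> hom (WD_cat C) (box_sum X Y) (box_sum Y X)"
  and Braid_WD_invertible: "invertible (WD_cat C) (Braid (WD C) X Y)"
  unfolding Braid_WD
   apply (rule relabel_hom; (simp add: box_sum_Obj X Y; fail)?; auto simp: typed_on_def)
  apply (rule relabel_invertible[where f' = "pcase PR PL" and g' = "pcase PR PL"];
      (simp add: box_sum_Obj X Y; fail)?; auto simp: typed_on_def)
  done

context
  assumes Z: "Z \<in> Obj (WD_cat C)"
begin

lemma Assoc_WD_hom: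
  "Assoc (WD C) X Y Z \<in> hom (WD_cat C) (box_sum (box_sum X Y) Z) (box_sum X (box_sum Y Z))"
  and Assoc_WD_invertible: "invertible (WD_cat C) (Assoc (WD C) X Y Z)"
  unfolding Assoc_WD
   apply (rule relabel_hom; (simp add: box_sum_Obj X Y Z; fail)?; auto simp: typed_on_def)
  apply (rule relabel_invertible[where f' = "pcase (PL \<circ> PL) (pcase (PL \<circ> PR) PR)"
        and g' = "pcase (pcase PL (PR \<circ> PL)) (PR \<circ> PR)"];
      (simp add: box_sum_Obj X Y Z; fail)?; auto simp: typed_on_def)
  done

end

end

end

section \<open>Naturality of the structural wiring diagrams\<close>

lemma prod_cat_simps:
  "(a, b) \<in> Obj (prod_cat C D) \<longleftrightarrow> a \<in> Obj C \<and> b \<in> Obj D"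
  "(f, g) \<in> Arr (prod_cat C D) \<longleftrightarrow> f \<in> Arr C \<and> g \<in> Arr D"
  "Dom (prod_cat C D) (f, g) = (Dom C f, Dom D g)"
  "Cod (prod_cat C D) (f, g) = (Cod C f, Cod D g)"
  "Ident (prod_cat C D) (a, b) = (Ident C a, Ident D b)"
  "Comp (prod_cat C D) (f', g') (f, g) = (Comp C f' f, Comp D g' g)"
  by (simp_all add: prod_cat_def)

lemma comp_func_simps: "fo (G \<circ>\<^sub>f F) a = fo G (fo F a)" "fa (G \<circ>\<^sub>f F) f = fa G (fa F f)"
  by (simp_all add: comp_func_def)

lemma prod_func_simps:
  "fo (F \<times>\<^sub>f G) (a, b) = (fo F a, fo G b)" "fa (F \<times>\<^sub>f G) (f, g) = (fa F f, fa G g)"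
  by (simp_all add: prod_func_def)

lemma structural_func_simps:
  "fo id_func a = a" "fa id_func f = f"
  "fo assoc_func ((a, b), c) = (a, b, c)" "fa assoc_func ((f, g), h) = (f, g, h)"
  "fo swap_func (a, b) = (b, a)" "fa swap_func (f, g) = (g, f)"
  "fo (pair_left C x) b = (x, b)" "fa (pair_left C x) g = (Ident C x, g)"
  "fo (pair_right C x) b = (b, x)" "fa (pair_right C x) g = (g, Ident C x)"
  by (simp_all add: id_func_def assoc_func_def swap_func_def pair_left_def pair_right_def)

lemmas func_simps = comp_func_simps prod_func_simps structural_func_simps

lemma Arr_WD_hom: "\<phi> \<in> Arr (WD_cat C) \<Longrightarrow> \<phi> \<in> hom (WD_cat C) (wdom \<phi>) (wcod \<phi>)"
  by (simp add: hom_WD)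

lemma Arr_WD_Obj: "\<phi> \<in> Arr (WD_cat C) \<Longrightarrow> wdom \<phi> \<in> Obj (WD_cat C) \<and> wcod \<phi> \<in> Obj (WD_cat C)"
  by (simp add: Arr_WD)

lemma Assoc_WD_natural:
  assumes f: "f \<in> hom (WD_cat C) X X'" and g: "g \<in> hom (WD_cat C) Y Y'" and h: "h \<in> hom (WD_cat C) Z Z'"
  shows "Comp (WD_cat C) (Assoc (WD C) X' Y' Z') (wiring_sum (wiring_sum f g) h) =
    Comp (WD_cat C) (wiring_sum f (wiring_sum g h)) (Assoc (WD C) X Y Z)" (is "?L = ?R")
proof (rule wiring_eqI)
  note O = hom_WD_Obj[OF f] hom_WD_Obj[OF g] hom_WD_Obj[OF h]
  note [simp] = O
  note homs = wiring_sum_hom[OF f wiring_sum_hom[OF g h]] wiring_sum_hom[OF wiring_sum_hom[OF f g] h]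
    Assoc_WD_hom[OF O(1) O(5) O(9)] Assoc_WD_hom[OF O(2) O(6) O(10)]
  show "?L \<in> hom (WD_cat C) (box_sum (box_sum X Y) Z) (box_sum X' (box_sum Y' Z'))"
    "?R \<in> hom (WD_cat C) (box_sum (box_sum X Y) Z) (box_sum X' (box_sum Y' Z'))"
    by (rule Comp_WD_hom[OF homs(2,4)] Comp_WD_hom[OF homs(3,1)])+
  fix i assume "i \<in> ports (bin (box_sum (box_sum X Y) Z))"
  then consider (X) k where "i = PL (PL k)" "k \<in> ports (bin X)" | (Y) k where "i = PL (PR k)" "k \<in> ports (bin Y)"
    | (Z) k where "i = PR k" "k \<in> ports (bin Z)" by auto
  then show "win ?L i = win ?R i"
  proof cases
    case X
    from f X(2) show ?thesis by (cases rule: win_cases) (use X in \<open>auto simp: win_Comp Assoc_WD\<close>)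
  next
    case Y
    from g Y(2) show ?thesis by (cases rule: win_cases) (use Y in \<open>auto simp: win_Comp Assoc_WD\<close>)
  next
    case Z
    from h Z(2) show ?thesis by (cases rule: win_cases) (use Z in \<open>auto simp: win_Comp Assoc_WD\<close>)
  qed
next
  note [simp] = hom_WD_Obj[OF f] hom_WD_Obj[OF g] hom_WD_Obj[OF h]
  fix j assume "j \<in> ports (bout (box_sum X' (box_sum Y' Z')))"
  then show "wout ?L j = wout ?R j"
    using wout_port[OF f] wout_port[OF g] wout_port[OF h] by (auto simp: wout_Comp Assoc_WD)
qed

lemma Lunit_WD_natural:
  assumes f: "f \<in> hom (WD_cat C) X Y"
  shows "Comp (WD_cat C) (Lunit (WD C) Y) (wiring_sum (Ident (WD_cat C) \<lparr>bin = tempty, bout = tempty\<rparr>) f) =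
    Comp (WD_cat C) f (Lunit (WD C) X)" (is "?L = ?R")
proof (rule wiring_eqI)
  note [simp] = hom_WD_Obj[OF f]
  let ?I = "\<lparr>bin = tempty, bout = tempty\<rparr>"
  show "?L \<in> hom (WD_cat C) (box_sum ?I X) Y" "?R \<in> hom (WD_cat C) (box_sum ?I X) Y"
    by (rule Comp_WD_hom[OF wiring_sum_hom[OF Ident_WD_hom f]] Comp_WD_hom[OF _ f];
      simp add: Lunit_WD_hom unit_box_WD_Obj)+
  fix i assume "i \<in> ports (bin (box_sum ?I X))"
  then obtain k where k: "i = PR k" "k \<in> ports (bin X)" by auto
  from f k(2) show "win ?L i = win ?R i"
    by (cases rule: win_cases) (use k in \<open>auto simp: win_Comp Lunit_WD Ident_WD\<close>)
qed (use hom_WD_Obj[OF f] wout_port[OF f] in \<open>auto simp: wout_Comp Lunit_WD\<close>)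

lemma Runit_WD_natural:
  assumes f: "f \<in> hom (WD_cat C) X Y"
  shows "Comp (WD_cat C) (Runit (WD C) Y) (wiring_sum f (Ident (WD_cat C) \<lparr>bin = tempty, bout = tempty\<rparr>)) =
    Comp (WD_cat C) f (Runit (WD C) X)" (is "?L = ?R")
proof (rule wiring_eqI)
  note [simp] = hom_WD_Obj[OF f]
  let ?I = "\<lparr>bin = tempty, bout = tempty\<rparr>"
  show "?L \<in> hom (WD_cat C) (box_sum X ?I) Y" "?R \<in> hom (WD_cat C) (box_sum X ?I) Y"
    by (rule Comp_WD_hom[OF wiring_sum_hom[OF f Ident_WD_hom]] Comp_WD_hom[OF _ f];
      simp add: Runit_WD_hom unit_box_WD_Obj)+
  fix i assume "i \<in> ports (bin (box_sum X ?I))"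
  then obtain k where k: "i = PL k" "k \<in> ports (bin X)" by auto
  from f k(2) show "win ?L i = win ?R i"
    by (cases rule: win_cases) (use k in \<open>auto simp: win_Comp Runit_WD Ident_WD\<close>)
qed (use hom_WD_Obj[OF f] wout_port[OF f] in \<open>auto simp: wout_Comp Runit_WD\<close>)

lemma Braid_WD_natural:
  assumes f: "f \<in> hom (WD_cat C) X X'" and g: "g \<in> hom (WD_cat C) Y Y'"
  shows "Comp (WD_cat C) (Braid (WD C) X' Y') (wiring_sum f g) =
    Comp (WD_cat C) (wiring_sum g f) (Braid (WD C) X Y)" (is "?L = ?R")
proof (rule wiring_eqI)
  note [simp] = hom_WD_Obj[OF f] hom_WD_Obj[OF g]
  show "?L \<in> hom (WD_cat C) (box_sum X Y) (box_sum Y' X')" "?R \<in> hom (WD_cat C) (box_sum X Y) (box_sum Y' X')"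
    by (rule Comp_WD_hom[OF wiring_sum_hom[OF f g]] Comp_WD_hom[OF _ wiring_sum_hom[OF g f]];
      simp add: Braid_WD_hom)+
  fix i assume "i \<in> ports (bin (box_sum X Y))"
  then consider (X) k where "i = PL k" "k \<in> ports (bin X)" | (Y) k where "i = PR k" "k \<in> ports (bin Y)"
    by auto
  then show "win ?L i = win ?R i"
  proof cases
    case X
    from f X(2) show ?thesis by (cases rule: win_cases) (use X in \<open>auto simp: win_Comp Braid_WD\<close>)
  next
    case Y
    from g Y(2) show ?thesis by (cases rule: win_cases) (use Y in \<open>auto simp: win_Comp Braid_WD\<close>)
  qed
next
  note [simp] = hom_WD_Obj[OF f] hom_WD_Obj[OF g]
  fix j assume "j \<in> ports (bout (box_sum Y' X'))"
  then show "wout ?L j = wout ?R j"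
    using wout_port[OF f] wout_port[OF g] by (auto simp: wout_Comp Braid_WD)
qed

lemma symmetric_monoidal_category_WD: "symmetric_monoidal_category (WD C)"
proof (rule symmetric_monoidal_category.intro, unfold WD_simps)
  note simps = prod_cat_simps func_simps
  note homs = Lunit_WD_hom Runit_WD_hom Braid_WD_hom Assoc_WD_hom
  note invs = Lunit_WD_invertible Runit_WD_invertible Braid_WD_invertible Assoc_WD_invertible
  note Objs = box_sum_Obj Arr_WD_Obj
  show "category (WD_cat C)" by (rule category_WD)
  show "is_functor (prod_cat (WD_cat C) (WD_cat C)) (WD_cat C) (Tens (WD C))"
    unfolding is_functor_def split_paired_Ball_Sigma prod_cat_def
    by (auto simp: box_sum_Obj wiring_sum_Ident wiring_sum_hom[OF Arr_WD_hom Arr_WD_hom]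
      intro!: wiring_sum_Comp) (auto simp: hom_WD)
  show "\<lparr>bin = tempty, bout = tempty\<rparr> \<in> Obj (WD_cat C)" by (rule unit_box_WD_Obj)
  show "nat_iso (prod_cat (prod_cat (WD_cat C) (WD_cat C)) (WD_cat C)) (WD_cat C)
     (Tens (WD C) \<circ>\<^sub>f Tens (WD C) \<times>\<^sub>f id_func)
     (Tens (WD C) \<circ>\<^sub>f (id_func \<times>\<^sub>f Tens (WD C)) \<circ>\<^sub>f assoc_func)
     (\<lambda>((X, Y), Z). Assoc (WD C) X Y Z)"
    unfolding nat_iso_def
    by (auto simp: simps homs invs Objs intro!: Assoc_WD_natural Arr_WD_hom)
  show "nat_iso (WD_cat C) (WD_cat C)
     (Tens (WD C) \<circ>\<^sub>f pair_left (WD_cat C) \<lparr>bin = tempty, bout = tempty\<rparr>) id_func (Lunit (WD C))"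
    unfolding nat_iso_def
    by (auto simp: simps homs invs Objs intro!: Lunit_WD_natural Arr_WD_hom)
  show "nat_iso (WD_cat C) (WD_cat C)
     (Tens (WD C) \<circ>\<^sub>f pair_right (WD_cat C) \<lparr>bin = tempty, bout = tempty\<rparr>) id_func (Runit (WD C))"
    unfolding nat_iso_def
    by (auto simp: simps homs invs Objs intro!: Runit_WD_natural Arr_WD_hom)
  show "nat_iso (prod_cat (WD_cat C) (WD_cat C)) (WD_cat C) (Tens (WD C)) (Tens (WD C) \<circ>\<^sub>f swap_func)
     (\<lambda>(X, Y). Braid (WD C) X Y)"
    unfolding nat_iso_def
    by (auto simp: simps homs invs Objs intro!: Braid_WD_natural Arr_WD_hom)
\<comment> \<open>Both sides of the pentagon, the triangle, the hexagon and the symmetry law are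
  composites of relabellings. Each collapses to a single relabelling, and the port functions are
  compared by cases.\<close>
qed (unfold Assoc_WD Lunit_WD Runit_WD Braid_WD Ident_WD wiring_sum_relabel,
  ((subst relabel_Comp, (auto simp: typed_on_def; fail), (auto simp: typed_on_def; fail))+,
    (rule relabel_cong; force))+)

section \<open>Coherence from uniqueness of label-preserving arrows\<close>

context symmetric_monoidal_category
begin

lemma comp_hom: "f \<in> hom WC X Y \<Longrightarrow> g \<in> hom WC Y Z \<Longrightarrow> g \<cdot> f \<in> hom WC X Z"
  using cat by (rule category.comp_hom)

lemma one_hom: "X \<in> Obj WC \<Longrightarrow> \<one> X \<in> hom WC X X"
  using cat by (rule category.ident_hom)

lemma hom_Obj:
  assumes "f \<in> hom WC X Y" shows "X \<in> Obj WC" "Y \<in> Obj WC"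
  using assms category.dom_obj[OF cat] category.cod_obj[OF cat] by (auto simp: hom_def)

lemma tens_Obj: "X \<in> Obj WC \<Longrightarrow> Y \<in> Obj WC \<Longrightarrow> X \<otimes> Y \<in> Obj WC"
  using tens_functor by (auto simp: is_functor_def prod_cat_def)

lemma tens_hom: "f \<in> hom WC X X' \<Longrightarrow> g \<in> hom WC Y Y' \<Longrightarrow> f \<boxtimes> g \<in> hom WC (X \<otimes> Y) (X' \<otimes> Y')"
  using tens_functor by (auto simp: is_functor_def prod_cat_def hom_def)

lemma tens_one: "X \<in> Obj WC \<Longrightarrow> Y \<in> Obj WC \<Longrightarrow> \<one> (X \<otimes> Y) = \<one> X \<boxtimes> \<one> Y"
  using tens_functor by (auto simp: is_functor_def prod_cat_def)

lemma tens_comp: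
  assumes "f \<in> hom WC X X'" "f' \<in> hom WC X' X''" "g \<in> hom WC Y Y'" "g' \<in> hom WC Y' Y''"
  shows "(f' \<boxtimes> g') \<cdot> (f \<boxtimes> g) = (f' \<cdot> f) \<boxtimes> (g' \<cdot> g)"
proof -
  have "\<forall>k \<in> Arr (prod_cat WC WC). \<forall>l \<in> Arr (prod_cat WC WC).
      Cod (prod_cat WC WC) k = Dom (prod_cat WC WC) l \<longrightarrow>
      fa (Tens W) (Comp (prod_cat WC WC) l k) = fa (Tens W) l \<cdot> fa (Tens W) k"
    using tens_functor by (simp add: is_functor_def)
  from bspec[OF bspec[OF this, of "(f, g)"], of "(f', g')"] assms show ?thesis
    by (simp add: prod_cat_simps hom_def)
qed

lemma assoc_hom: "X \<in> Obj WC \<Longrightarrow> Y \<in> Obj WC \<Longrightarrow> Z \<in> Obj WC \<Longrightarrow>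
    \<a> X Y Z \<in> hom WC ((X \<otimes> Y) \<otimes> Z) (X \<otimes> Y \<otimes> Z)"
  using assoc_nat by (auto simp: nat_iso_def prod_cat_def func_simps)

lemma lunit_hom: "X \<in> Obj WC \<Longrightarrow> \<l> X \<in> hom WC (\<I> \<otimes> X) X"
  using lunit_nat by (auto simp: nat_iso_def prod_cat_def func_simps)

lemma runit_hom: "X \<in> Obj WC \<Longrightarrow> \<r> X \<in> hom WC (X \<otimes> \<I>) X"
  using runit_nat by (auto simp: nat_iso_def prod_cat_def func_simps)

lemma braid_hom: "X \<in> Obj WC \<Longrightarrow> Y \<in> Obj WC \<Longrightarrow> \<s> X Y \<in> hom WC (X \<otimes> Y) (Y \<otimes> X)"
  using braid_nat by (auto simp: nat_iso_def prod_cat_def func_simps)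

lemma assoc_natural:
  assumes "f \<in> hom WC X X'" "g \<in> hom WC Y Y'" "h \<in> hom WC Z Z'"
  shows "(f \<boxtimes> g \<boxtimes> h) \<cdot> \<a> X Y Z = \<a> X' Y' Z' \<cdot> ((f \<boxtimes> g) \<boxtimes> h)"
proof -
  have "((f, g), h) \<in> Arr (prod_cat (prod_cat WC WC) WC)"
    using assms by (simp add: prod_cat_simps hom_def)
  with assoc_nat have "(\<lambda>((X, Y), Z). \<a> X Y Z) (Cod (prod_cat (prod_cat WC WC) WC) ((f, g), h)) \<cdot>
      fa (Tens W \<circ>\<^sub>f (Tens W \<times>\<^sub>f id_func)) ((f, g), h) =
      fa (Tens W \<circ>\<^sub>f (id_func \<times>\<^sub>f Tens W) \<circ>\<^sub>f assoc_func) ((f, g), h) \<cdot>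
      (\<lambda>((X, Y), Z). \<a> X Y Z) (Dom (prod_cat (prod_cat WC WC) WC) ((f, g), h))"
    unfolding nat_iso_def by blast
  with assms show ?thesis by (simp add: prod_cat_simps func_simps hom_def)
qed

lemma lunit_natural:
  assumes "f \<in> hom WC X Y" shows "f \<cdot> \<l> X = \<l> Y \<cdot> (\<one> \<I> \<boxtimes> f)"
  using lunit_nat assms by (auto simp: nat_iso_def func_simps hom_def)

lemma runit_natural:
  assumes "f \<in> hom WC X Y" shows "f \<cdot> \<r> X = \<r> Y \<cdot> (f \<boxtimes> \<one> \<I>)"
  using runit_nat assms by (auto simp: nat_iso_def func_simps hom_def)

lemma braid_natural:
  assumes "f \<in> hom WC X X'" "g \<in> hom WC Y Y'"
  shows "(g \<boxtimes> f) \<cdot> \<s> X Y = \<s> X' Y' \<cdot> (f \<boxtimes> g)"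
proof -
  have "(f, g) \<in> Arr (prod_cat WC WC)" using assms by (simp add: prod_cat_simps hom_def)
  with braid_nat have "(\<lambda>(X, Y). \<s> X Y) (Cod (prod_cat WC WC) (f, g)) \<cdot> fa (Tens W) (f, g) =
      fa (Tens W \<circ>\<^sub>f swap_func) (f, g) \<cdot> (\<lambda>(X, Y). \<s> X Y) (Dom (prod_cat WC WC) (f, g))"
    unfolding nat_iso_def by blast
  with assms show ?thesis by (simp add: prod_cat_simps func_simps hom_def)
qed

end

lemma nat_iso_prodI:
  assumes "\<And>a b. a \<in> Obj C \<Longrightarrow> b \<in> Obj D \<Longrightarrow>
      \<eta> a b \<in> hom E (fo F (a, b)) (fo G (a, b)) \<and> invertible E (\<eta> a b)"
    and "\<And>f g. f \<in> Arr C \<Longrightarrow> g \<in> Arr D \<Longrightarrow>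
      Comp E (\<eta> (Cod C f) (Cod D g)) (fa F (f, g)) = Comp E (fa G (f, g)) (\<eta> (Dom C f) (Dom D g))"
  shows "nat_iso (prod_cat C D) E F G (\<lambda>(a, b). \<eta> a b)"
  using assms by (auto simp: nat_iso_def prod_cat_def)

lemma nat_iso_prod3I:
  assumes "\<And>a b c. a \<in> Obj C \<Longrightarrow> b \<in> Obj D \<Longrightarrow> c \<in> Obj D' \<Longrightarrow>
      \<eta> a b c \<in> hom E (fo F ((a, b), c)) (fo G ((a, b), c)) \<and> invertible E (\<eta> a b c)"
    and "\<And>f g h. f \<in> Arr C \<Longrightarrow> g \<in> Arr D \<Longrightarrow> h \<in> Arr D' \<Longrightarrow>
      Comp E (\<eta> (Cod C f) (Cod D g) (Cod D' h)) (fa F ((f, g), h)) =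
      Comp E (fa G ((f, g), h)) (\<eta> (Dom C f) (Dom D g) (Dom D' h))"
  shows "nat_iso (prod_cat (prod_cat C D) D') E F G (\<lambda>((a, b), c). \<eta> a b c)"
  using assms by (auto simp: nat_iso_def prod_cat_def)

text \<open>The coherence argument in abstract form. \<open>LH X S \<sigma> T \<tau> k\<close>
  stands for an arrow \<open>k\<close> from \<open>S\<close> to \<open>T\<close> that carries the
  label \<sigma> to the label \<tau>. \<open>D X T \<tau> I\<close> stands for a label \<tau> with
  tags in \<open>I\<close> that separates such arrows into \<open>T\<close>. The cells are required
  to preserve all labels, not only those made of leaves, because the axioms apply them inside larger
  composites.\<close>

locale labelled_lax_functor = symmetric_monoidal_category W + lax_functor_data W F K
  for W :: "('b, 'w) smcat"
    and F :: "('b, 'w, 'o, 'm) lax_data"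
    and K :: "('b, 'w, 'o, 'm) lax_cells" +
  fixes LH :: "'b \<Rightarrow> 'o \<Rightarrow> 'l \<Rightarrow> 'o \<Rightarrow> 'l \<Rightarrow> 'm \<Rightarrow> bool"
    and D :: "'b \<Rightarrow> 'o \<Rightarrow> 'l \<Rightarrow> nat set \<Rightarrow> bool"
    and lf :: "nat \<Rightarrow> 'l" and LF :: "'l \<Rightarrow> 'l" and LM :: "'l \<Rightarrow> 'l \<Rightarrow> 'l" and LI :: 'l
  assumes F0_cat: "\<And>X. X \<in> Obj WC \<Longrightarrow> category (F0 X)"
    and Fo_Obj: "\<And>f X Y S. f \<in> hom WC X Y \<Longrightarrow> S \<in> Obj (F0 X) \<Longrightarrow> Fo f S \<in> Obj (F0 Y)"
    and M_Obj: "\<And>X Y S T. X \<in> Obj WC \<Longrightarrow> Y \<in> Obj WC \<Longrightarrow> S \<in> Obj (F0 X) \<Longrightarrow> T \<in> Obj (F0 Y) \<Longrightarrow>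
          M X Y S T \<in> Obj (F0 (X \<otimes> Y))"
    and e_Obj: "e \<in> Obj (F0 \<I>)"
    and LH_hom: "\<And>X S \<sigma> T \<tau> k. LH X S \<sigma> T \<tau> k \<Longrightarrow> k \<in> hom (F0 X) S T"
    and LH_lift: "\<And>X S T \<tau> k. k \<in> hom (F0 X) S T \<Longrightarrow> \<exists>\<sigma>. LH X S \<sigma> T \<tau> k"
    and LH_unique: "\<And>X S \<sigma> T \<tau> k l I. LH X S \<sigma> T \<tau> k \<Longrightarrow> LH X S \<sigma> T \<tau> l \<Longrightarrow> D X T \<tau> I \<Longrightarrow> k = l"
    and LH_ident: "\<And>X S \<sigma>. S \<in> Obj (F0 X) \<Longrightarrow> LH X S \<sigma> S \<sigma> (i X S)"
    and LH_comp: "\<And>X S \<sigma> T \<tau> U \<rho> k l. LH X S \<sigma> T \<tau> k \<Longrightarrow> LH X T \<tau> U \<rho> l \<Longrightarrow>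
          LH X S \<sigma> U \<rho> (Comp (F0 X) l k)"
    and LH_cinv: "\<And>X S \<sigma> T \<tau> k. LH X S \<sigma> T \<tau> k \<Longrightarrow> invertible (F0 X) k \<Longrightarrow>
          LH X T \<tau> S \<sigma> (cinv (F0 X) k)"
    and LH_F: "\<And>f X Y S \<sigma> T \<tau> k. f \<in> hom WC X Y \<Longrightarrow> LH X S \<sigma> T \<tau> k \<Longrightarrow>
          LH Y (Fo f S) (LF \<sigma>) (Fo f T) (LF \<tau>) (Fa f k)"
    and LH_M: "\<And>X Y S \<sigma> S' \<sigma>' T \<tau> T' \<tau>' k l. X \<in> Obj WC \<Longrightarrow> Y \<in> Obj WC \<Longrightarrow>
          LH X S \<sigma> S' \<sigma>' k \<Longrightarrow> LH Y T \<tau> T' \<tau>' l \<Longrightarrow>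
          LH (X \<otimes> Y) (M X Y S T) (LM \<sigma> \<tau>) (M X Y S' T') (LM \<sigma>' \<tau>') (Ma X Y k l)"
    and D_leaf: "\<And>X S j. S \<in> Obj (F0 X) \<Longrightarrow> D X S (lf j) {j}"
    and D_F: "\<And>f X Y S \<sigma> I. f \<in> hom WC X Y \<Longrightarrow> D X S \<sigma> I \<Longrightarrow> D Y (Fo f S) (LF \<sigma>) I"
    and D_M: "\<And>X Y S \<sigma> I T \<tau> J. X \<in> Obj WC \<Longrightarrow> Y \<in> Obj WC \<Longrightarrow> D X S \<sigma> I \<Longrightarrow> D Y T \<tau> J \<Longrightarrow>
          I \<inter> J = {} \<Longrightarrow> D (X \<otimes> Y) (M X Y S T) (LM \<sigma> \<tau>) (I \<union> J)"
    and cmp_cell: "\<And>f g X Y Z S \<sigma>. f \<in> hom WC X Y \<Longrightarrow> g \<in> hom WC Y Z \<Longrightarrow> S \<in> Obj (F0 X) \<Longrightarrow>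
          LH Z (Fo g (Fo f S)) (LF (LF \<sigma>)) (Fo (g \<cdot> f) S) (LF \<sigma>) (c g f S) \<and>
          invertible (F0 Z) (c g f S)"
    and unt_cell: "\<And>X S \<sigma>. X \<in> Obj WC \<Longrightarrow> S \<in> Obj (F0 X) \<Longrightarrow>
          LH X S \<sigma> (Fo (\<one> X) S) (LF \<sigma>) (u X S) \<and> invertible (F0 X) (u X S)"
    and mun_cell: "\<And>f g X X' Y Y' S T \<sigma> \<tau>. f \<in> hom WC X X' \<Longrightarrow> g \<in> hom WC Y Y' \<Longrightarrow>
          S \<in> Obj (F0 X) \<Longrightarrow> T \<in> Obj (F0 Y) \<Longrightarrow>
          LH (X' \<otimes> Y') (Fo (f \<boxtimes> g) (M X Y S T)) (LF (LM \<sigma> \<tau>))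
            (M X' Y' (Fo f S) (Fo g T)) (LM (LF \<sigma>) (LF \<tau>)) (m f g S T) \<and>
          invertible (F0 (X' \<otimes> Y')) (m f g S T)"
    and asc_cell: "\<And>X Y Z S T U \<sigma> \<tau> \<rho>. X \<in> Obj WC \<Longrightarrow> Y \<in> Obj WC \<Longrightarrow> Z \<in> Obj WC \<Longrightarrow>
          S \<in> Obj (F0 X) \<Longrightarrow> T \<in> Obj (F0 Y) \<Longrightarrow> U \<in> Obj (F0 Z) \<Longrightarrow>
          LH (X \<otimes> Y \<otimes> Z) (Fo (\<a> X Y Z) (M (X \<otimes> Y) Z (M X Y S T) U)) (LF (LM (LM \<sigma> \<tau>) \<rho>))
            (M X (Y \<otimes> Z) S (M Y Z T U)) (LM \<sigma> (LM \<tau> \<rho>)) (A X Y Z S T U) \<and>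
          invertible (F0 (X \<otimes> Y \<otimes> Z)) (A X Y Z S T U)"
    and lun_cell: "\<And>X S \<sigma>. X \<in> Obj WC \<Longrightarrow> S \<in> Obj (F0 X) \<Longrightarrow>
          LH X (Fo (\<l> X) (M \<I> X e S)) (LF (LM LI \<sigma>)) S \<sigma> (L X S) \<and> invertible (F0 X) (L X S)"
    and run_cell: "\<And>X S \<sigma>. X \<in> Obj WC \<Longrightarrow> S \<in> Obj (F0 X) \<Longrightarrow>
          LH X (Fo (\<r> X) (M X \<I> S e)) (LF (LM \<sigma> LI)) S \<sigma> (R X S) \<and> invertible (F0 X) (R X S)"
    and brd_cell: "\<And>X Y S T \<sigma> \<tau>. X \<in> Obj WC \<Longrightarrow> Y \<in> Obj WC \<Longrightarrow> S \<in> Obj (F0 X) \<Longrightarrow> T \<in> Obj (F0 Y) \<Longrightarrow>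
          LH (Y \<otimes> X) (Fo (\<s> X Y) (M X Y S T)) (LF (LM \<sigma> \<tau>)) (M Y X T S) (LM \<tau> \<sigma>) (B X Y S T) \<and>
          invertible (F0 (Y \<otimes> X)) (B X Y S T)"
begin

text \<open>In the following rules the wiring diagram \<open>h\<close> is kept separate from the composite it equals,
  so that the coherence laws of \<open>W\<close> enter as side conditions.\<close>

lemma LH_c: "f \<in> hom WC X Y \<Longrightarrow> g \<in> hom WC Y Z \<Longrightarrow> S \<in> Obj (F0 X) \<Longrightarrow> h = g \<cdot> f \<Longrightarrow>
    LH Z (Fo g (Fo f S)) (LF (LF \<sigma>)) (Fo h S) (LF \<sigma>) (c g f S)"
  using cmp_cell by blast

lemma LH_c_inv:
  assumes "f \<in> hom WC X Y" "g \<in> hom WC Y Z" "S \<in> Obj (F0 X)" "h = g \<cdot> f"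
  shows "LH Z (Fo h S) (LF \<sigma>) (Fo g (Fo f S)) (LF (LF \<sigma>)) (c_inv g f S)"
proof -
  have "Cod WC g = Z" using assms(2) by (simp add: hom_def)
  then show ?thesis using LH_cinv cmp_cell[OF assms(1-3)] assms(4) by blast
qed

text \<open>Needed for \<open>c3\<close>, a composite of cells whose invertibility is not among the
  assumptions.\<close>

lemma LH_invertible:
  assumes k: "LH X S \<sigma> T \<tau> k" and l: "LH X T \<tau> S \<sigma> l" and D: "D X S \<sigma> I" "D X T \<tau> J"
    and X: "X \<in> Obj WC"
  shows "invertible (F0 X) k"
proof -
  interpret F0: category "F0 X" using X by (rule F0_cat)
  have h: "k \<in> hom (F0 X) S T" "l \<in> hom (F0 X) T S" using k l LH_hom by blast+
  then have ST: "S \<in> Obj (F0 X)" "T \<in> Obj (F0 X)"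
    using F0.dom_obj F0.cod_obj by (auto simp: hom_def)
  have "Comp (F0 X) l k = i X S" "Comp (F0 X) k l = i X T"
    using LH_unique[OF LH_comp[OF k l] LH_ident[OF ST(1)] D(1)]
      LH_unique[OF LH_comp[OF l k] LH_ident[OF ST(2)] D(2)] .
  then show ?thesis
    using h unfolding invertible_def is_inverse_def hom_def by (intro conjI exI[of _ l]) simp_all
qed

text \<open>The inverses of the two factors of \<open>c3\<close> compose to a label-preserving arrow
  in the opposite direction; uniqueness shows that it is an inverse.\<close>

lemma LH_c3_inv:
  assumes f: "f \<in> hom WC V X" and g: "g \<in> hom WC X Y" and h: "h \<in> hom WC Y Z" and S: "S \<in> Obj (F0 V)"
    and k: "k = h \<cdot> g \<cdot> f"
  shows "LH Z (Fo k S) (LF \<sigma>) (Fo h (Fo g (Fo f S))) (LF (LF (LF \<sigma>))) (c3_inv h g f S)"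
proof -
  have [simp]: "Cod WC h = Z" "Cod WC g = Y" using g h by (simp_all add: hom_def)
  have 1: "LH Z (Fo h (Fo g (Fo f S))) (LF (LF (LF \<sigma>))) (Fo k S) (LF \<sigma>) (c3 h g f S)" for \<sigma>
    unfolding \<open>Cod WC h = Z\<close> k
    by (rule LH_comp, rule LH_F[OF h], rule LH_c[OF f g S refl], rule LH_c[OF comp_hom[OF f g] h S refl])
  have "LH Z (Fo k S) (LF \<sigma>) (Fo h (Fo g (Fo f S))) (LF (LF (LF \<sigma>)))
      (Comp (F0 Z) (Fa h (c_inv g f S)) (c_inv h (g \<cdot> f) S))" for \<sigma>
    unfolding k
    by (rule LH_comp, rule LH_c_inv[OF comp_hom[OF f g] h S refl], rule LH_F[OF h], rule LH_c_inv[OF f g S refl])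
  \<comment> \<open>Invertibility of an arrow does not refer to labels, so it may be tested with any
    determined label; the leaf with tag 0 is one.\<close>
  from LH_invertible[OF 1 this D_F[OF h D_F[OF g D_F[OF f D_leaf[OF S, of 0]]]]
      D_F[OF comp_hom[OF comp_hom[OF f g] h, folded k] D_leaf[OF S, of 0]] hom_Obj(2)[OF h]]
  have "invertible (F0 Z) (c3 h g f S)" .
  with LH_cinv[OF 1] show ?thesis by simp
qed

lemma LH_u: "X \<in> Obj WC \<Longrightarrow> S \<in> Obj (F0 X) \<Longrightarrow> h = \<one> X \<Longrightarrow> LH X S \<sigma> (Fo h S) (LF \<sigma>) (u X S)"
  using unt_cell by blast

lemma LH_u_inv:
  "X \<in> Obj WC \<Longrightarrow> S \<in> Obj (F0 X) \<Longrightarrow> h = \<one> X \<Longrightarrow> LH X (Fo h S) (LF \<sigma>) S \<sigma> (u_inv X S)"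
  using LH_cinv unt_cell by blast

lemma LH_m: "f \<in> hom WC X X' \<Longrightarrow> g \<in> hom WC Y Y' \<Longrightarrow> S \<in> Obj (F0 X) \<Longrightarrow> T \<in> Obj (F0 Y) \<Longrightarrow>
    h = f \<boxtimes> g \<Longrightarrow>
    LH (X' \<otimes> Y') (Fo h (M X Y S T)) (LF (LM \<sigma> \<tau>)) (M X' Y' (Fo f S) (Fo g T)) (LM (LF \<sigma>) (LF \<tau>)) (m f g S T)"
  using mun_cell by blast

lemmas LH_A = asc_cell[THEN conjunct1]
lemmas LH_L = lun_cell[THEN conjunct1]
lemmas LH_R = run_cell[THEN conjunct1]
lemmas LH_B = brd_cell[THEN conjunct1]

text \<open>These rules are directed by the shape of the arrow: applied to a composite, they find
  the labels of the intermediate objects by unification, and the laws of \<open>W\<close> remain as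
  side conditions.\<close>

lemmas LH_rules = LH_comp LH_c LH_c_inv LH_c3_inv LH_u LH_u_inv LH_m LH_A LH_L LH_R LH_B
  LH_F LH_M LH_ident refl
lemmas W_rules = unit_obj tens_Obj tens_hom one_hom comp_hom assoc_hom lunit_hom runit_hom braid_hom
lemmas F_rules = Fo_Obj M_Obj e_Obj D_leaf D_F D_M

section \<open>Functoriality and the coherence axioms\<close>

text \<open>The target receives a leaf label, which is determined, and the source the label pulled
  back from it. The tag \<open>j\<close> is left open so that the factors of a product can be kept
  apart.\<close>

lemma hom_E:
  assumes "k \<in> Arr (F0 X)"
  obtains \<sigma> where "LH X (Dom (F0 X) k) \<sigma> (Cod (F0 X) k) (lf j) k"
  using assms LH_lift[of k X] by (auto simp: hom_def)

lemma F0_Obj: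
  assumes "X \<in> Obj WC" "k \<in> Arr (F0 X)"
  shows "Dom (F0 X) k \<in> Obj (F0 X)" "Cod (F0 X) k \<in> Obj (F0 X)"
  using category.dom_obj[OF F0_cat] category.cod_obj[OF F0_cat] assms by blast+

lemma FA_is_functor:
  assumes f: "f \<in> hom WC X Y"
  shows "is_functor (F0 X) (F0 Y) (FA F f)"
  unfolding is_functor_def
proof (intro conjI ballI impI)
  fix S assume S: "S \<in> Obj (F0 X)"
  show "Fo f S \<in> Obj (F0 Y)" using f S by (rule Fo_Obj)
  show "Fa f (i X S) = i Y (Fo f S)"
    by (rule LH_unique[where \<sigma> = "LF (lf 0)" and \<tau> = "LF (lf 0)"]) (rule LH_rules F_rules f S)+
next
  note X = hom_Obj[OF f]
  fix k assume k: "k \<in> Arr (F0 X)"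
  obtain \<sigma> where k': "LH X (Dom (F0 X) k) \<sigma> (Cod (F0 X) k) (lf 0) k"
    using k by (rule hom_E)
  show "Fa f k \<in> hom (F0 Y) (Fo f (Dom (F0 X) k)) (Fo f (Cod (F0 X) k))"
    by (rule LH_hom, rule LH_F[OF f k'])
  fix l assume l: "l \<in> Arr (F0 X)" and kl: "Cod (F0 X) k = Dom (F0 X) l"
  obtain \<tau> where l': "LH X (Dom (F0 X) l) \<tau> (Cod (F0 X) l) (lf 0) l"
    using l by (rule hom_E)
  \<comment> \<open>The label of the source of \<open>l\<close> becomes the label of the target of
    \<open>k\<close>, so that the two arrows compose as label-preserving arrows.\<close>
  obtain \<sigma> where k': "LH X (Dom (F0 X) k) \<sigma> (Dom (F0 X) l) \<tau> k"
    using LH_lift[of k X _ _ \<tau>] k kl by (auto simp: hom_def)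
  show "Fa f (Comp (F0 X) l k) = Comp (F0 Y) (Fa f l) (Fa f k)"
    by (rule LH_unique) (rule LH_rules F_rules f k' l' F0_Obj[OF X(1)] k l)+
qed

lemma mu_is_functor:
  assumes X: "X \<in> Obj WC" and Y: "Y \<in> Obj WC"
  shows "is_functor (prod_cat (F0 X) (F0 Y)) (F0 (X \<otimes> Y)) (mu F X Y)"
  unfolding is_functor_def
proof (intro conjI ballI impI)
  fix ST assume "ST \<in> Obj (prod_cat (F0 X) (F0 Y))"
  then obtain S T where ST: "ST = (S, T)" "S \<in> Obj (F0 X)" "T \<in> Obj (F0 Y)"
    by (cases ST) (auto simp: prod_cat_simps)
  then show "fo (mu F X Y) ST \<in> Obj (F0 (X \<otimes> Y))" using M_Obj X Y by simp
  have "Ma X Y (i X S) (i Y T) = i (X \<otimes> Y) (M X Y S T)"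
    \<comment> \<open>The factors carry the distinct tags 0 and 1 to meet the disjointness condition
      of \<open>D_M\<close>.\<close>
    by (rule LH_unique[where \<sigma> = "LM (lf 0) (lf 1)" and \<tau> = "LM (lf 0) (lf 1)"])
      (rule LH_rules F_rules X Y ST | (simp; fail))+
  then show "fa (mu F X Y) (Ident (prod_cat (F0 X) (F0 Y)) ST) = Ident (F0 (X \<otimes> Y)) (fo (mu F X Y) ST)"
    by (simp add: ST prod_cat_simps)
next
  fix kk assume "kk \<in> Arr (prod_cat (F0 X) (F0 Y))"
  then obtain k k' where k: "kk = (k, k')" "k \<in> Arr (F0 X)" "k' \<in> Arr (F0 Y)"
    by (cases kk) (auto simp: prod_cat_simps)
  obtain \<sigma> where K: "LH X (Dom (F0 X) k) \<sigma> (Cod (F0 X) k) (lf 0) k"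
    using k(2) by (rule hom_E)
  obtain \<sigma>' where K': "LH Y (Dom (F0 Y) k') \<sigma>' (Cod (F0 Y) k') (lf 1) k'"
    using k(3) by (rule hom_E)
  show "fa (mu F X Y) kk \<in> hom (F0 (X \<otimes> Y)) (fo (mu F X Y) (Dom (prod_cat (F0 X) (F0 Y)) kk))
      (fo (mu F X Y) (Cod (prod_cat (F0 X) (F0 Y)) kk))"
    using LH_hom[OF LH_M[OF X Y K K']] by (simp add: k prod_cat_simps)
  fix ll assume "ll \<in> Arr (prod_cat (F0 X) (F0 Y))"
    and kl: "Cod (prod_cat (F0 X) (F0 Y)) kk = Dom (prod_cat (F0 X) (F0 Y)) ll"
  then obtain l l' where l: "ll = (l, l')" "l \<in> Arr (F0 X)" "l' \<in> Arr (F0 Y)"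
    by (cases ll) (auto simp: prod_cat_simps)
  obtain \<tau> where L: "LH X (Dom (F0 X) l) \<tau> (Cod (F0 X) l) (lf 0) l"
    using l(2) by (rule hom_E)
  obtain \<tau>' where L': "LH Y (Dom (F0 Y) l') \<tau>' (Cod (F0 Y) l') (lf 1) l'"
    using l(3) by (rule hom_E)
  obtain \<sigma> where K: "LH X (Dom (F0 X) k) \<sigma> (Dom (F0 X) l) \<tau> k"
    using LH_lift[of k X _ _ \<tau>] k l kl by (auto simp: hom_def prod_cat_simps)
  obtain \<sigma>' where K': "LH Y (Dom (F0 Y) k') \<sigma>' (Dom (F0 Y) l') \<tau>' k'"
    using LH_lift[of k' Y _ _ \<tau>'] k l kl by (auto simp: hom_def prod_cat_simps)
  have "Ma X Y (Comp (F0 X) l k) (Comp (F0 Y) l' k') = Comp (F0 (X \<otimes> Y)) (Ma X Y l l') (Ma X Y k k')"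
    by (rule LH_unique)
      (rule LH_rules F_rules X Y K K' L L' F0_Obj[OF X] F0_Obj[OF Y] k l | (simp; fail))+
  then show "fa (mu F X Y) (Comp (prod_cat (F0 X) (F0 Y)) ll kk) =
      Comp (F0 (X \<otimes> Y)) (fa (mu F X Y) ll) (fa (mu F X Y) kk)"
    by (simp add: k l prod_cat_simps)
qed

text \<open>In each coherence axiom below, \<open>\<sigma>\<close> and \<open>\<tau>\<close> are the labels of the common source and the
  common target of the two sides.\<close>

lemma pseudofunctor: "symmetric_lax_monoidal_pseudofunctor W F K"
proof (rule symmetric_lax_monoidal_pseudofunctor.intro, goal_cases)
  case 1
  show ?case by (rule symmetric_monoidal_category_axioms)
next
  case (2 X)
  then show ?case by (rule F0_cat)
next
  case (3 f X Y)
  then show ?case by (rule FA_is_functor)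
next
  case (4 X Y)
  then show ?case by (rule mu_is_functor)
next
  case 5
  show ?case by (rule e_Obj)
next
  case (6 f g X Y Z)
  show ?case
    unfolding nat_iso_def func_simps
  proof (intro conjI ballI)
    fix k assume k: "k \<in> Arr (F0 X)"
    \<comment> \<open>The arrow \<open>k\<close> is arbitrary. Its target carries a leaf and its
      source the pulled-back label \<sigma>; the cells at both ends of the naturality square
      preserve these labels because they preserve every label.\<close>
    obtain \<sigma> where k': "LH X (Dom (F0 X) k) \<sigma> (Cod (F0 X) k) (lf 0) k"
      using k by (rule hom_E)
    show "Comp (F0 Z) (c g f (Cod (F0 X) k)) (Fa g (Fa f k)) =
        Comp (F0 Z) (Fa (g \<cdot> f) k) (c g f (Dom (F0 X) k))"
      by (rule LH_unique)
        (rule 6 k' LH_rules F_rules W_rules F0_Obj[OF hom_Obj(1)[OF 6(1)]] k | (simp; fail))+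
  qed (use cmp_cell[OF 6] LH_hom in blast)+
next
  case (7 X)
  show ?case
    unfolding nat_iso_def func_simps
  proof (intro conjI ballI)
    fix k assume k: "k \<in> Arr (F0 X)"
    obtain \<sigma> where k': "LH X (Dom (F0 X) k) \<sigma> (Cod (F0 X) k) (lf 0) k"
      using k by (rule hom_E)
    show "Comp (F0 X) (u X (Cod (F0 X) k)) k = Comp (F0 X) (Fa (\<one> X) k) (u X (Dom (F0 X) k))"
      by (rule LH_unique)
        (rule 7 k' LH_rules F_rules W_rules F0_Obj[OF 7] k | (simp; fail))+
  qed (use unt_cell[OF 7] LH_hom in blast)+
next
  case (8 f g X X' Y Y')
  note Objs = hom_Obj[OF 8(1)] hom_Obj[OF 8(2)]
  show ?case
  proof (rule nat_iso_prodI, unfold func_simps)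
    fix k l assume k: "k \<in> Arr (F0 X)" "l \<in> Arr (F0 Y)"
    obtain \<sigma> where K: "LH X (Dom (F0 X) k) \<sigma> (Cod (F0 X) k) (lf 0) k"
      using k(1) by (rule hom_E)
    obtain \<tau> where L: "LH Y (Dom (F0 Y) l) \<tau> (Cod (F0 Y) l) (lf 1) l"
      using k(2) by (rule hom_E)
    show "Comp (F0 (X' \<otimes> Y')) (m f g (Cod (F0 X) k) (Cod (F0 Y) l)) (Fa (f \<boxtimes> g) (Ma X Y k l)) =
      Comp (F0 (X' \<otimes> Y')) (Ma X' Y' (Fa f k) (Fa g l)) (m f g (Dom (F0 X) k) (Dom (F0 Y) l))"
      by (rule LH_unique)
        (rule 8 Objs K L LH_rules F_rules W_rules F0_Obj[OF Objs(1)] F0_Obj[OF Objs(3)] k | (simp; fail))+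
  qed (use mun_cell[OF 8] LH_hom in blast)
next
  case (9 X Y Z)
  show ?case
  proof (rule nat_iso_prod3I, unfold func_simps)
    fix k l n assume k: "k \<in> Arr (F0 X)" "l \<in> Arr (F0 Y)" "n \<in> Arr (F0 Z)"
    obtain \<sigma> where K: "LH X (Dom (F0 X) k) \<sigma> (Cod (F0 X) k) (lf 0) k"
      using k(1) by (rule hom_E)
    obtain \<tau> where L: "LH Y (Dom (F0 Y) l) \<tau> (Cod (F0 Y) l) (lf 1) l"
      using k(2) by (rule hom_E)
    obtain \<rho> where N: "LH Z (Dom (F0 Z) n) \<rho> (Cod (F0 Z) n) (lf 2) n"
      using k(3) by (rule hom_E)
    show "Comp (F0 (X \<otimes> Y \<otimes> Z)) (A X Y Z (Cod (F0 X) k) (Cod (F0 Y) l) (Cod (F0 Z) n))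
        (Fa (\<a> X Y Z) (Ma (X \<otimes> Y) Z (Ma X Y k l) n)) =
      Comp (F0 (X \<otimes> Y \<otimes> Z)) (Ma X (Y \<otimes> Z) k (Ma Y Z l n))
        (A X Y Z (Dom (F0 X) k) (Dom (F0 Y) l) (Dom (F0 Z) n))"
      by (rule LH_unique)
        (rule 9 K L N LH_rules F_rules W_rules F0_Obj[OF 9(1)] F0_Obj[OF 9(2)] F0_Obj[OF 9(3)] k
          | (simp; fail))+
  qed (use asc_cell[OF 9] LH_hom in blast)
next
  case (10 X)
  show ?case
    unfolding nat_iso_def func_simps
  proof (intro conjI ballI)
    fix k assume k: "k \<in> Arr (F0 X)"
    obtain \<sigma> where k': "LH X (Dom (F0 X) k) \<sigma> (Cod (F0 X) k) (lf 0) k"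
      using k by (rule hom_E)
    show "Comp (F0 X) (L X (Cod (F0 X) k)) (Fa (\<l> X) (Ma \<I> X (i \<I> e) k)) =
        Comp (F0 X) k (L X (Dom (F0 X) k))"
      by (rule LH_unique)
        (rule 10 k' LH_rules F_rules W_rules F0_Obj[OF 10] k | (simp; fail))+
  qed (use lun_cell[OF 10] LH_hom in blast)+
next
  case (11 X)
  show ?case
    unfolding nat_iso_def func_simps
  proof (intro conjI ballI)
    fix k assume k: "k \<in> Arr (F0 X)"
    obtain \<sigma> where k': "LH X (Dom (F0 X) k) \<sigma> (Cod (F0 X) k) (lf 0) k"
      using k by (rule hom_E)
    show "Comp (F0 X) (R X (Cod (F0 X) k)) (Fa (\<r> X) (Ma X \<I> k (i \<I> e))) =
        Comp (F0 X) k (R X (Dom (F0 X) k))"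
      by (rule LH_unique)
        (rule 11 k' LH_rules F_rules W_rules F0_Obj[OF 11] k | (simp; fail))+
  qed (use run_cell[OF 11] LH_hom in blast)+
next
  case (12 X Y)
  show ?case
  proof (rule nat_iso_prodI, unfold func_simps)
    fix k l assume k: "k \<in> Arr (F0 X)" "l \<in> Arr (F0 Y)"
    obtain \<sigma> where K: "LH X (Dom (F0 X) k) \<sigma> (Cod (F0 X) k) (lf 0) k"
      using k(1) by (rule hom_E)
    obtain \<tau> where L: "LH Y (Dom (F0 Y) l) \<tau> (Cod (F0 Y) l) (lf 1) l"
      using k(2) by (rule hom_E)
    show "Comp (F0 (Y \<otimes> X)) (B X Y (Cod (F0 X) k) (Cod (F0 Y) l)) (Fa (\<s> X Y) (Ma X Y k l)) =
      Comp (F0 (Y \<otimes> X)) (Ma Y X l k) (B X Y (Dom (F0 X) k) (Dom (F0 Y) l))"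
      by (rule LH_unique)
        (rule 12 K L LH_rules F_rules W_rules F0_Obj[OF 12(1)] F0_Obj[OF 12(2)] k | (simp; fail))+
  qed (use brd_cell[OF 12] LH_hom in blast)
next
  case (13 f g h V X Y Z S)
  show ?case
    unfolding chain.simps
    by (rule LH_unique[where \<sigma> = "LF (LF (LF (lf 0)))" and \<tau> = "LF (lf 0)"])
      (rule 13 LH_rules F_rules W_rules category.comp_assoc[OF cat, symmetric] | (simp; fail))+
next
  case (14 f X Y S)
  note X = hom_Obj[OF 14(1)]
  show ?case
    unfolding chain.simps
    \<comment> \<open>The target is given explicitly: the cell ends at the action of
      \<open>f \<cdot> \<one> X\<close> and the identity at \<open>Fo f S\<close>. They become the
      same object by the unit law of the category, which enters as a side condition.\<close>
    by (rule LH_unique[where \<sigma> = "LF (lf 0)" and \<tau> = "LF (lf 0)" and T = "Fo f S"])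
      (rule 14 X LH_rules F_rules W_rules category.comp_ident_right[OF cat, symmetric] | (simp; fail))+
next
  case (15 f X Y S)
  note X = hom_Obj[OF 15(1)]
  show ?case
    unfolding chain.simps
    by (rule LH_unique[where \<sigma> = "LF (lf 0)" and \<tau> = "LF (lf 0)" and T = "Fo f S"])
      (rule 15 X LH_rules F_rules W_rules category.comp_ident_left[OF cat, symmetric] | (simp; fail))+
next
  case (16 f f' g g' X X' X'' Y Y' Y'' S T)
  note X = hom_Obj[OF 16(1)] hom_Obj[OF 16(2)] hom_Obj[OF 16(3)] hom_Obj[OF 16(4)]
  show ?case
    unfolding chain.simps
    by (rule LH_unique[where \<sigma> = "LF (LF (LM (lf 0) (lf 1)))" and \<tau> = "LM (LF (lf 0)) (LF (lf 1))"])
      (rule 16 X LH_rules F_rules W_rules tens_comp | (simp; fail))+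
next
  case (17 X Y S T)
  show ?case
    unfolding chain.simps
    by (rule LH_unique[where \<sigma> = "LM (lf 0) (lf 1)" and \<tau> = "LM (LF (lf 0)) (LF (lf 1))"])
      (rule 17 LH_rules F_rules W_rules tens_one | (simp; fail))+
next
  case (18 f g h X X' Y Y' Z Z' S T U)
  note X = hom_Obj[OF 18(1)] hom_Obj[OF 18(2)] hom_Obj[OF 18(3)]
  show ?case
    unfolding chain.simps
    by (rule LH_unique[where \<sigma> = "LF (LM (LM (lf 0) (lf 1)) (lf 2))" and \<tau> = "LM (LF (lf 0)) (LM (LF (lf 1)) (LF (lf 2)))"])
      (rule 18 X LH_rules F_rules W_rules assoc_natural | (simp; fail))+
next
  case (19 f X Y S)
  note X = hom_Obj[OF 19(1)]
  show ?case
    unfolding chain.simps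
    by (rule LH_unique[where \<sigma> = "LF (LM LI (lf 0))" and \<tau> = "LF (lf 0)"])
      (rule 19 X LH_rules F_rules W_rules lunit_natural | (simp; fail))+
next
  case (20 f X Y S)
  note X = hom_Obj[OF 20(1)]
  show ?case
    unfolding chain.simps
    by (rule LH_unique[where \<sigma> = "LF (LM (lf 0) LI)" and \<tau> = "LF (lf 0)"])
      (rule 20 X LH_rules F_rules W_rules runit_natural | (simp; fail))+
next
  case (21 f g X X' Y Y' S T)
  note X = hom_Obj[OF 21(1)] hom_Obj[OF 21(2)]
  show ?case
    unfolding chain.simps
    by (rule LH_unique[where \<sigma> = "LF (LM (lf 0) (lf 1))" and \<tau> = "LM (LF (lf 1)) (LF (lf 0))"])
      (rule 21 X LH_rules F_rules W_rules braid_natural | (simp; fail))+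
next
  case (22 X Y Z V S T U P)
  show ?case
    unfolding chain.simps
    by (rule LH_unique[where \<sigma> = "LF (LM (LM (LM (lf 0) (lf 1)) (lf 2)) (lf 3))" and \<tau> = "LM (lf 0) (LM (lf 1) (LM (lf 2) (lf 3)))"])
      (rule 22 LH_rules F_rules W_rules pentagon | (simp; fail))+
next
  case (23 X Y S T)
  show ?case
    unfolding chain.simps
    by (rule LH_unique[where \<sigma> = "LF (LM (LM (lf 0) LI) (lf 1))" and \<tau> = "LM (lf 0) (lf 1)"])
      (rule 23 LH_rules F_rules W_rules triangle | (simp; fail))+
next
  case (24 X Y Z S T U)
  show ?case
    unfolding chain.simps
    \<comment> \<open>The permuted tags of the target record where each of the three factors has
      moved; the two paths of the hexagon move them in the same way.\<close>
    by (rule LH_unique[where \<sigma> = "LF (LM (LM (lf 0) (lf 1)) (lf 2))" and \<tau> = "LM (lf 1) (LM (lf 2) (lf 0))"])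
      (rule 24 LH_rules F_rules W_rules hexagon | (simp; fail))+
next
  case (25 X Y S T)
  show ?case
    unfolding chain.simps
    by (rule LH_unique[where \<sigma> = "LF (LF (LM (lf 0) (lf 1)))" and \<tau> = "LM (lf 0) (lf 1)"])
      (rule 25 LH_rules F_rules W_rules symmetry | (simp; fail))+
qed

end

section \<open>The algebra of span systems\<close>

lemma hom_WD_iff: "\<phi> \<in> hom (WD_cat C) X Y \<Longrightarrow> \<phi> \<in> Arr (WD_cat C)"
  by (simp add: hom_WD)

lemma act_machine:
  "\<phi> \<in> hom (WD_cat ShN) X Y \<Longrightarrow> p \<in> machines X \<Longrightarrow> span_act_obj \<phi> p \<in> machines Y"
  using span_act_obj_hom by (auto simp: hom_WD)

lemma act_determined:
  "\<phi> \<in> hom (WD_cat ShN) X Y \<Longrightarrow> p \<in> machines X \<Longrightarrow> determined p \<sigma> I \<Longrightarrow>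
    determined (span_act_obj \<phi> p) (act_label \<sigma>) I"
  using determined_act by (auto simp: hom_WD)

lemma act_label_natural:
  "\<phi> \<in> hom (WD_cat ShN) X Y \<Longrightarrow> p \<in> machines X \<Longrightarrow> label_natural E p \<sigma> \<Longrightarrow>
    label_natural E (span_act_obj \<phi> p) (act_label \<sigma>)"
  using label_natural_act by (auto simp: hom_WD)

lemma graph_act_iff:
  assumes "\<phi> \<in> hom (WD_cat ShN) X Y" "p \<in> machines X"
  shows "(w, z, x') \<in> graph (span_act_obj \<phi> p) (act_label \<sigma>) n \<longleftrightarrow>
    z \<in> sections (bin Y) n \<and> (\<exists>x. x' = readout \<phi> x \<and> (w, feed \<phi> z x, x) \<in> graph p \<sigma> n)"
  using assms by (auto simp: hom_WD graph_act)

lemma graph_mu_iff: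
  assumes "X \<in> Obj (WD_cat ShN)" "Y \<in> Obj (WD_cat ShN)" "p \<in> machines X" "q \<in> machines Y"
  shows "(w, y, x) \<in> graph (span_mu_obj X Y p q) (mu_label \<sigma> \<tau>) n \<longleftrightarrow>
    (\<exists>w1 w2 y1 y2 x1 x2. w = w1 \<union> w2 \<and> y = join (bin X) (bin Y) y1 y2 \<and> x = join (bout X) (bout Y) x1 x2 \<and>
      (w1, y1, x1) \<in> graph p \<sigma> n \<and> (w2, y2, x2) \<in> graph q \<tau> n)"
  unfolding graph_mu[OF assms] by blast

section \<open>Feeding and reading out along composite diagrams\<close>

lemma feed_sections:
  "\<phi> \<in> hom (WD_cat C) X Y \<Longrightarrow> y \<in> sections (bin Y) n \<Longrightarrow> x \<in> sections (bout X) n \<Longrightarrow>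
    feed \<phi> y x \<in> sections (bin X) n"
  and readout_sections:
  "\<phi> \<in> hom (WD_cat C) X Y \<Longrightarrow> x \<in> sections (bout X) n \<Longrightarrow> readout \<phi> x \<in> sections (bout Y) n"
  using win_sections wout_sections by (auto simp: hom_WD)

text \<open>Where the composite diagram splices a wire through the intermediate box, the right-hand
  side looks up the value that \<open>\<psi>\<close> supplies at that port, either from outside or
  from the output read out along \<open>\<phi>\<close>.\<close>

lemma feed_Comp:
  assumes \<phi>: "\<phi> \<in> hom (WD_cat C) X Y" and \<psi>: "\<psi> \<in> hom (WD_cat C) Y Z"
  shows "feed (Comp (WD_cat C) \<psi> \<phi>) z x = feed \<phi> (feed \<psi> z (readout \<phi> x)) x"
proof -
  note [simp] = hom_WD_Obj[OF \<phi>] hom_WD_Obj[OF \<psi>]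
  have "pcase x z (win (Comp (WD_cat C) \<psi> \<phi>) i) = pcase x (feed \<psi> z (readout \<phi> x)) (win \<phi> i)"
    if i: "i \<in> ports (bin X)" for i
    using \<phi> i
  proof (cases rule: win_cases)
    case (inn k)
    from \<psi> inn(2) show ?thesis
      by (cases rule: win_cases) (use i inn in \<open>auto simp: win_Comp feed_def readout_def\<close>)
  qed (use i in \<open>auto simp: win_Comp\<close>)
  then show ?thesis by (auto simp: feed_def[of \<phi>] feed_def[of "Comp _ _ _"] intro: restrict_ext)
qed

lemma readout_Comp:
  assumes \<phi>: "\<phi> \<in> hom (WD_cat C) X Y" and \<psi>: "\<psi> \<in> hom (WD_cat C) Y Z"
  shows "readout (Comp (WD_cat C) \<psi> \<phi>) x = readout \<psi> (readout \<phi> x)"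
  using wout_port[OF \<psi>] hom_WD_Obj[OF \<phi>] hom_WD_Obj[OF \<psi>]
  by (auto simp: readout_def wout_Comp intro: restrict_ext)

lemma feed_relabel: "feed (relabel X Y f g) y x = (\<lambda>i \<in> ports (bin X). y (f i))"
  and readout_relabel: "readout (relabel X Y f g) x = (\<lambda>i \<in> ports (bout Y). x (g i))"
  by (auto simp: feed_def readout_def intro: restrict_ext)

lemma feed_Ident: "y \<in> sections (bin X) n \<Longrightarrow> feed (Ident (WD_cat C) X) y x = y"
  and readout_Ident: "x \<in> sections (bout X) n \<Longrightarrow> readout (Ident (WD_cat C) X) x = x"
  by (simp_all add: Ident_WD feed_relabel readout_relabel)

lemma feed_sum:
  assumes \<phi>: "\<phi> \<in> hom (WD_cat C) X X'" and \<psi>: "\<psi> \<in> hom (WD_cat C) Y Y'"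
  shows "feed (wiring_sum \<phi> \<psi>) (join (bin X') (bin Y') z z') (join (bout X) (bout Y) x x') =
    join (bin X) (bin Y) (feed \<phi> z x) (feed \<psi> z' x')"
proof -
  note [simp] = hom_WD_Obj[OF \<phi>] hom_WD_Obj[OF \<psi>]
  let ?y = "join (bin X') (bin Y') z z'" and ?x = "join (bout X) (bout Y) x x'"
  have "pcase ?x ?y (win (wiring_sum \<phi> \<psi>) (PL i)) = feed \<phi> z x i" if i: "i \<in> ports (bin X)" for i
    using \<phi> i by (cases rule: win_cases) (use i in \<open>auto simp: feed_def\<close>)
  moreover have "pcase ?x ?y (win (wiring_sum \<phi> \<psi>) (PR i)) = feed \<psi> z' x' i"
    if i: "i \<in> ports (bin Y)" for i
    using \<psi> i by (cases rule: win_cases) (use i in \<open>auto simp: feed_def\<close>)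
  ultimately show ?thesis
    unfolding feed_def[of "wiring_sum _ _"] join_def[of "bin X"] by (auto intro!: restrict_ext)
qed

lemma readout_sum:
  assumes \<phi>: "\<phi> \<in> hom (WD_cat C) X X'" and \<psi>: "\<psi> \<in> hom (WD_cat C) Y Y'"
  shows "readout (wiring_sum \<phi> \<psi>) (join (bout X) (bout Y) x x') =
    join (bout X') (bout Y') (readout \<phi> x) (readout \<psi> x')"
  using wout_port[OF \<phi>] wout_port[OF \<psi>] hom_WD_Obj[OF \<phi>] hom_WD_Obj[OF \<psi>]
  by (auto simp: readout_def join_def intro!: restrict_ext)

text \<open>The associator is a relabelling, so what it feeds is the external input with its joins
  bracketed differently.\<close>

lemma feed_Assoc:
  "feed (Assoc (WD C) X Y Z) (join (bin X) (bin Y \<uplus> bin Z) y1 (join (bin Y) (bin Z) y2 y3)) x =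
    join (bin X \<uplus> bin Y) (bin Z) (join (bin X) (bin Y) y1 y2) y3"
  and readout_Assoc:
  "readout (Assoc (WD C) X Y Z) (join (bout X \<uplus> bout Y) (bout Z) (join (bout X) (bout Y) x1 x2) x3) =
    join (bout X) (bout Y \<uplus> bout Z) x1 (join (bout Y) (bout Z) x2 x3)"
  unfolding Assoc_WD feed_relabel readout_relabel by (auto simp: join_def intro!: restrict_ext)

lemma feed_Braid:
  "feed (Braid (WD C) X Y) (join (bin Y) (bin X) y2 y1) x = join (bin X) (bin Y) y1 y2"
  and readout_Braid:
  "readout (Braid (WD C) X Y) (join (bout X) (bout Y) x1 x2) = join (bout Y) (bout X) x2 x1"
  unfolding Braid_WD feed_relabel readout_relabel by (auto simp: join_def intro!: restrict_ext)

lemma feed_Lunit: "feed (Lunit (WD C) X) y x = join tempty (bin X) (\<lambda>_. undefined) y"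
  and readout_Lunit: "x \<in> sections (bout X) n \<Longrightarrow> readout (Lunit (WD C) X) (join tempty (bout X) v x) = x"
  and feed_Runit: "feed (Runit (WD C) X) y x = join (bin X) tempty y (\<lambda>_. undefined)"
  and readout_Runit: "x \<in> sections (bout X) n \<Longrightarrow> readout (Runit (WD C) X) (join (bout X) tempty x v) = x"
  unfolding Lunit_WD Runit_WD feed_relabel readout_relabel
     apply (auto simp: join_def intro!: restrict_ext)[1]
    apply (rule sections_eqI[of _ _ n]; auto intro!: restrict_sections simp: sections_app; fail)
   apply (auto simp: join_def intro!: restrict_ext)[1]
  apply (rule sections_eqI[of _ _ n]; auto intro!: restrict_sections simp: sections_app; fail)
  done

section \<open>Equalities of relations behind the structural isomorphisms\<close>

lemma graph_eqI:
  fixes p q :: "'a shmap"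
  assumes "\<And>w y x. (w, y, x) \<in> graph p \<sigma> n \<Longrightarrow> (w, y, x) \<in> graph q \<tau> n"
    and "\<And>w y x. (w, y, x) \<in> graph q \<tau> n \<Longrightarrow> (w, y, x) \<in> graph p \<sigma> n"
  shows "graph p \<sigma> n = graph q \<tau> n"
  using assms by (auto simp: set_eq_iff)

text \<open>By \<open>feed_Comp\<close> and \<open>readout_Comp\<close> both relations have the same
  defining condition, except that the nested one also asks the intermediate input to consist of
  sections. This holds because it is fed from families of sections.\<close>

lemma graph_Comp:
  assumes f: "f \<in> hom (WD_cat ShN) X Y" and g: "g \<in> hom (WD_cat ShN) Y Z" and p: "p \<in> machines X"
  shows "graph (span_act_obj g (span_act_obj f p)) (act_label (act_label \<sigma>)) n =
    graph (span_act_obj (Comp (WD_cat ShN) g f) p) (act_label \<sigma>) n"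
proof -
  have "feed g z (readout f x) \<in> sections (bin Y) n"
    if "z \<in> sections (bin Z) n" "(w, y, x) \<in> graph p \<sigma> n" for w x y z
    using feed_sections[OF g that(1) readout_sections[OF f graph_sections(2)[OF p that(2)]]] .
  then show ?thesis
    by (intro graph_eqI; unfold graph_act_iff[OF g act_machine[OF f p]] graph_act_iff[OF f p]
      graph_act_iff[OF Comp_WD_hom[OF f g] p] feed_Comp[OF f g] readout_Comp[OF f g]) blast+
qed

lemma graph_Ident:
  assumes X: "X \<in> Obj (WD_cat ShN)" and p: "p \<in> machines X"
  shows "graph p \<sigma> n = graph (span_act_obj (Ident (WD_cat ShN) X) p) (act_label \<sigma>) n"
proof -
  have "y \<in> sections (bin X) n \<Longrightarrow> feed (Ident (WD_cat ShN) X) y x = y" for x y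
    by (rule feed_Ident)
  moreover have "(w, y, x) \<in> graph p \<sigma> n \<Longrightarrow>
      readout (Ident (WD_cat ShN) X) x = x \<and> y \<in> sections (bin X) n" for w x y
    using graph_sections[OF p] readout_Ident by blast
  ultimately show ?thesis
    by (intro graph_eqI; unfold graph_act_iff[OF Ident_WD_hom[OF X] p]) metis+
qed

text \<open>An input of the sum splits uniquely into inputs of the summands, which are then fed
  independently of each other.\<close>

lemma graph_sum:
  assumes f: "f \<in> hom (WD_cat ShN) X X'" and g: "g \<in> hom (WD_cat ShN) Y Y'"
    and p: "p \<in> machines X" and q: "q \<in> machines Y"
  shows "graph (span_act_obj (wiring_sum f g) (span_mu_obj X Y p q)) (act_label (mu_label \<sigma> \<tau>)) n =
    graph (span_mu_obj X' Y' (span_act_obj f p) (span_act_obj g q)) (mu_label (act_label \<sigma>) (act_label \<tau>)) n"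
    (is "?L = ?R")
proof (rule graph_eqI)
  fix w z x
  note Objs = hom_WD_Obj[OF f] hom_WD_Obj[OF g]
  note L = graph_act_iff[OF wiring_sum_hom[OF f g] span_mu_obj_hom[OF Objs(1,5) p q]]
    graph_mu_iff[OF Objs(1,5) p q]
  note R = graph_mu_iff[OF Objs(2,6) act_machine[OF f p] act_machine[OF g q]]
    graph_act_iff[OF f p] graph_act_iff[OF g q]
  {
    assume "(w, z, x) \<in> ?L"
    then obtain w1 w2 y1 y2 x1 x2 where z: "z \<in> sections (bin X' \<uplus> bin Y') n"
      and *: "x = readout (wiring_sum f g) (join (bout X) (bout Y) x1 x2)" "w = w1 \<union> w2"
      "feed (wiring_sum f g) z (join (bout X) (bout Y) x1 x2) = join (bin X) (bin Y) y1 y2"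
      "(w1, y1, x1) \<in> graph p \<sigma> n" "(w2, y2, x2) \<in> graph q \<tau> n"
      unfolding L box_sum_simps by blast
    obtain z1 z2 where z': "z1 \<in> sections (bin X') n" "z2 \<in> sections (bin Y') n" "z = join (bin X') (bin Y') z1 z2"
      using z by (rule join_cases)
    have "join (bin X) (bin Y) (feed f z1 x1) (feed g z2 x2) = join (bin X) (bin Y) y1 y2"
      using *(3) unfolding z'(3) feed_sum[OF f g] .
    then have "feed f z1 x1 = y1 \<and> feed g z2 x2 = y2"
      using feed_sections[OF f z'(1)] feed_sections[OF g z'(2)] graph_sections[OF p *(4)] graph_sections[OF q *(5)]
      by (intro join_inject) auto
    then show "(w, z, x) \<in> ?R" unfolding R using * z' unfolding readout_sum[OF f g] by blast
  }
  assume "(w, z, x) \<in> ?R"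
  then obtain w1 w2 z1 z2 x1 x2 where *: "w = w1 \<union> w2" "z = join (bin X') (bin Y') z1 z2"
    "x = join (bout X') (bout Y') (readout f x1) (readout g x2)"
    "z1 \<in> sections (bin X') n" "z2 \<in> sections (bin Y') n"
    "(w1, feed f z1 x1, x1) \<in> graph p \<sigma> n" "(w2, feed g z2 x2, x2) \<in> graph q \<tau> n"
    unfolding R by blast
  then have "z \<in> sections (bin X' \<uplus> bin Y') n" using join_sections by blast
  then show "(w, z, x) \<in> ?L"
    unfolding L box_sum_simps
    by (intro conjI, assumption, intro exI[of _ "join (bout X) (bout Y) x1 x2"] conjI exI[of _ w1] exI[of _ w2]
        exI[of _ "feed f z1 x1"] exI[of _ "feed g z2 x2"] exI[of _ x1] exI[of _ x2])
      (simp_all add: * feed_sum[OF f g] readout_sum[OF f g])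
qed

text \<open>On labels the associator amounts to associativity of union, on inputs and outputs to a
  different bracketing of joins. Injectivity of \<open>join\<close> recovers the three
  parts.\<close>

lemma graph_Assoc:
  assumes X: "X \<in> Obj (WD_cat ShN)" and Y: "Y \<in> Obj (WD_cat ShN)" and Z: "Z \<in> Obj (WD_cat ShN)"
    and p: "p \<in> machines X" and q: "q \<in> machines Y" and r: "r \<in> machines Z"
  shows "graph (span_act_obj (Assoc (WD ShN) X Y Z) (span_mu_obj (box_sum X Y) Z (span_mu_obj X Y p q) r))
      (act_label (mu_label (mu_label \<sigma> \<tau>) \<rho>)) n =
    graph (span_mu_obj X (box_sum Y Z) p (span_mu_obj Y Z q r)) (mu_label \<sigma> (mu_label \<tau> \<rho>)) n" (is "?L = ?R")
proof (rule graph_eqI)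
  fix w z x
  note XY = box_sum_Obj[OF X Y] and YZ = box_sum_Obj[OF Y Z]
  note pq = span_mu_obj_hom[OF X Y p q] and qr = span_mu_obj_hom[OF Y Z q r]
  note L = graph_act_iff[OF Assoc_WD_hom[OF X Y Z] span_mu_obj_hom[OF XY Z pq r]]
    graph_mu_iff[OF XY Z pq r] graph_mu_iff[OF X Y p q]
  note R = graph_mu_iff[OF X YZ p qr] graph_mu_iff[OF Y Z q r]
  {
    assume "(w, z, x) \<in> ?L"
    then obtain w1 w2 w3 y1 y2 y3 x1 x2 x3 where z: "z \<in> sections (bin X \<uplus> bin Y \<uplus> bin Z) n"
      and *: "w = (w1 \<union> w2) \<union> w3"
      "x = readout (Assoc (WD ShN) X Y Z) (join (bout X \<uplus> bout Y) (bout Z) (join (bout X) (bout Y) x1 x2) x3)"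
      "feed (Assoc (WD ShN) X Y Z) z (join (bout X \<uplus> bout Y) (bout Z) (join (bout X) (bout Y) x1 x2) x3) =
        join (bin X \<uplus> bin Y) (bin Z) (join (bin X) (bin Y) y1 y2) y3"
      "(w1, y1, x1) \<in> graph p \<sigma> n" "(w2, y2, x2) \<in> graph q \<tau> n" "(w3, y3, x3) \<in> graph r \<rho> n"
      unfolding L by auto
    obtain z1 z23 where z1: "z1 \<in> sections (bin X) n" "z23 \<in> sections (bin Y \<uplus> bin Z) n"
      "z = join (bin X) (bin Y \<uplus> bin Z) z1 z23" using z by (rule join_cases)
    obtain z2 z3 where z2: "z2 \<in> sections (bin Y) n" "z3 \<in> sections (bin Z) n" "z23 = join (bin Y) (bin Z) z2 z3"
      using z1(2) by (rule join_cases)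
    note y = graph_sections(1)[OF p *(4)] graph_sections(1)[OF q *(5)] graph_sections(1)[OF r *(6)]
    have "join (bin X \<uplus> bin Y) (bin Z) (join (bin X) (bin Y) z1 z2) z3 =
        join (bin X \<uplus> bin Y) (bin Z) (join (bin X) (bin Y) y1 y2) y3"
      using *(3) unfolding z1(3) z2(3) feed_Assoc .
    then have "join (bin X) (bin Y) z1 z2 = join (bin X) (bin Y) y1 y2 \<and> z3 = y3"
      using z1 z2 y by (intro join_inject[of _ "bin X \<uplus> bin Y" n]) (auto intro: join_sections)
    moreover from this have "z1 = y1 \<and> z2 = y2"
      using z1 z2 y by (intro join_inject[of _ "bin X" n]) auto
    ultimately have "z = join (bin X) (bin Y \<uplus> bin Z) y1 (join (bin Y) (bin Z) y2 y3)"
      by (simp add: z1(3) z2(3))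
    then show "(w, z, x) \<in> ?R" unfolding R box_sum_simps using * unfolding readout_Assoc by (metis Un_assoc)
  }
  assume "(w, z, x) \<in> ?R"
  then obtain w1 w2 w3 y1 y2 y3 x1 x2 x3 where *: "w = w1 \<union> (w2 \<union> w3)"
    "z = join (bin X) (bin Y \<uplus> bin Z) y1 (join (bin Y) (bin Z) y2 y3)"
    "x = join (bout X) (bout Y \<uplus> bout Z) x1 (join (bout Y) (bout Z) x2 x3)"
    "(w1, y1, x1) \<in> graph p \<sigma> n" "(w2, y2, x2) \<in> graph q \<tau> n" "(w3, y3, x3) \<in> graph r \<rho> n"
    unfolding R by auto
  note y = graph_sections(1)[OF p *(4)] graph_sections(1)[OF q *(5)] graph_sections(1)[OF r *(6)]
  have "z \<in> sections (bin X \<uplus> bin Y \<uplus> bin Z) n" using y *(2) by (auto intro: join_sections)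
  moreover have "x = readout (Assoc (WD ShN) X Y Z) (join (bout X \<uplus> bout Y) (bout Z) (join (bout X) (bout Y) x1 x2) x3)"
    "feed (Assoc (WD ShN) X Y Z) z x' = join (bin X \<uplus> bin Y) (bin Z) (join (bin X) (bin Y) y1 y2) y3" for x'
    unfolding *(2,3) feed_Assoc readout_Assoc by (rule refl)+
  ultimately show "(w, z, x) \<in> ?L" unfolding L box_sum_simps using * by (metis Un_assoc)
qed

text \<open>Since labels are sets, exchanging the factors is commutativity of union.\<close>

lemma graph_Braid:
  assumes X: "X \<in> Obj (WD_cat ShN)" and Y: "Y \<in> Obj (WD_cat ShN)"
    and p: "p \<in> machines X" and q: "q \<in> machines Y"
  shows "graph (span_act_obj (Braid (WD ShN) X Y) (span_mu_obj X Y p q)) (act_label (mu_label \<sigma> \<tau>)) n =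
    graph (span_mu_obj Y X q p) (mu_label \<tau> \<sigma>) n" (is "?L = ?R")
proof (rule graph_eqI)
  fix w z x
  note L = graph_act_iff[OF Braid_WD_hom[OF X Y] span_mu_obj_hom[OF X Y p q]] graph_mu_iff[OF X Y p q]
  note R = graph_mu_iff[OF Y X q p]
  {
    assume "(w, z, x) \<in> ?L"
    then obtain w1 w2 y1 y2 x1 x2 where z: "z \<in> sections (bin Y \<uplus> bin X) n"
      and *: "w = w1 \<union> w2" "x = readout (Braid (WD ShN) X Y) (join (bout X) (bout Y) x1 x2)"
      "feed (Braid (WD ShN) X Y) z (join (bout X) (bout Y) x1 x2) = join (bin X) (bin Y) y1 y2"
      "(w1, y1, x1) \<in> graph p \<sigma> n" "(w2, y2, x2) \<in> graph q \<tau> n"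
      unfolding L by auto
    obtain z2 z1 where z1: "z2 \<in> sections (bin Y) n" "z1 \<in> sections (bin X) n" "z = join (bin Y) (bin X) z2 z1"
      using z by (rule join_cases)
    have "join (bin X) (bin Y) z1 z2 = join (bin X) (bin Y) y1 y2"
      using *(3) unfolding z1(3) feed_Braid .
    then have "z1 = y1 \<and> z2 = y2"
      using z1 graph_sections(1)[OF p *(4)] graph_sections(1)[OF q *(5)] by (intro join_inject) auto
    then show "(w, z, x) \<in> ?R" unfolding R using * z1 unfolding readout_Braid by (metis Un_commute)
  }
  assume "(w, z, x) \<in> ?R"
  then obtain w1 w2 y1 y2 x1 x2 where *: "w = w1 \<union> w2"
    "z = join (bin Y) (bin X) y2 y1" "x = join (bout Y) (bout X) x2 x1"
    "(w1, y1, x1) \<in> graph p \<sigma> n" "(w2, y2, x2) \<in> graph q \<tau> n"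
    unfolding R by (metis Un_commute)
  have "z \<in> sections (bin Y \<uplus> bin X) n"
    using *(2) graph_sections(1)[OF p *(4)] graph_sections(1)[OF q *(5)] by (auto intro: join_sections)
  moreover have "x = readout (Braid (WD ShN) X Y) (join (bout X) (bout Y) x1 x2)"
    "feed (Braid (WD ShN) X Y) z x' = join (bin X) (bin Y) y1 y2" for x'
    unfolding *(2,3) feed_Braid readout_Braid by (rule refl)+
  ultimately show "(w, z, x) \<in> ?L" unfolding L box_sum_simps using * by metis
qed

text \<open>The unit machine has exactly one state of each length. Its label is empty, and so are
  the port sets of its input and output, so it contributes nothing to union or join.\<close>

lemma graph_Lunit:
  assumes X: "X \<in> Obj (WD_cat ShN)" and p: "p \<in> machines X"
  shows "graph (span_act_obj (Lunit (WD ShN) X) (span_mu_obj unit_box X unit_machine p))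
    (act_label (mu_label unit_label \<sigma>)) n = graph p \<sigma> n" (is "?L = ?R")
proof (rule graph_eqI)
  fix w z x
  note I = unit_box_WD_Obj unit_machine_hom
  note L = graph_act_iff[OF Lunit_WD_hom[OF X] span_mu_obj_hom[OF I(1) X I(2) p]] graph_mu_iff[OF I(1) X I(2) p]
    graph_unit feed_Lunit box.simps
  {
    assume "(w, z, x) \<in> ?L"
    then obtain y x' where z: "z \<in> sections (bin X) n"
      and *: "x = readout (Lunit (WD ShN) X) (join tempty (bout X) (\<lambda>_. undefined) x')"
      "join tempty (bin X) (\<lambda>_. undefined) z = join tempty (bin X) (\<lambda>_. undefined) y" "(w, y, x') \<in> graph p \<sigma> n"
      unfolding L by auto
    have "z = y"
      using join_inject[OF _ _ z graph_sections(1)[OF p *(3)] *(2)] by (simp add: sections_tempty)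
    then show "(w, z, x) \<in> ?R" using * readout_Lunit[OF graph_sections(2)[OF p *(3)], where C = ShN] by simp
  }
  assume R: "(w, z, x) \<in> ?R"
  note s = graph_sections[OF p R]
  have "x = readout (Lunit (WD ShN) X) (join tempty (bout X) (\<lambda>_. undefined) x)"
    using readout_Lunit[OF s(2), where C = ShN] by simp
  then show "(w, z, x) \<in> ?L" unfolding L using R s(1) by blast
qed

lemma graph_Runit:
  assumes X: "X \<in> Obj (WD_cat ShN)" and p: "p \<in> machines X"
  shows "graph (span_act_obj (Runit (WD ShN) X) (span_mu_obj X unit_box p unit_machine))
    (act_label (mu_label \<sigma> unit_label)) n = graph p \<sigma> n" (is "?L = ?R")
proof (rule graph_eqI)
  fix w z x
  note I = unit_box_WD_Obj unit_machine_hom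
  note L = graph_act_iff[OF Runit_WD_hom[OF X] span_mu_obj_hom[OF X I(1) p I(2)]] graph_mu_iff[OF X I(1) p I(2)]
    graph_unit feed_Runit box.simps
  {
    assume "(w, z, x) \<in> ?L"
    then obtain y x' where z: "z \<in> sections (bin X) n"
      and *: "x = readout (Runit (WD ShN) X) (join (bout X) tempty x' (\<lambda>_. undefined))"
      "join (bin X) tempty z (\<lambda>_. undefined) = join (bin X) tempty y (\<lambda>_. undefined)" "(w, y, x') \<in> graph p \<sigma> n"
      unfolding L by auto
    have "z = y"
      using join_inject[OF z graph_sections(1)[OF p *(3)] _ _ *(2)] by (simp add: sections_tempty)
    then show "(w, z, x) \<in> ?R" using * readout_Runit[OF graph_sections(2)[OF p *(3)], where C = ShN] by simp
  }
  assume R: "(w, z, x) \<in> ?R"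
  note s = graph_sections[OF p R]
  have "x = readout (Runit (WD ShN) X) (join (bout X) tempty x (\<lambda>_. undefined))"
    using readout_Runit[OF s(2), where C = ShN] by simp
  then show "(w, z, x) \<in> ?L" unfolding L using R s(1) by blast
qed

section \<open>The 2-cells of the algebra\<close>

text \<open>Leaves with distinct tags serve as generic labels: each cell is the canonical
  isomorphism for them, and \<open>canon_cell\<close> transfers preservation to all other
  labels.\<close>

definition Mch_cells ::
  "('a sbox, 'a swiring, 'a shmap, 'a shmap \<times> 'a shmap \<times> 'a shmap) lax_cells" where
  "Mch_cells =
    \<lparr>cmp = \<lambda>g f p. canon (span_act_obj g (span_act_obj f p)) (act_label (act_label (leaf 0)))
       (span_act_obj (Comp (WD_cat ShN) g f) p) (act_label (leaf 0)),
     unt = \<lambda>X p. canon p (leaf 0) (span_act_obj (Ident (WD_cat ShN) X) p) (act_label (leaf 0)),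
     mun = \<lambda>f g p q. canon (span_act_obj (wiring_sum f g) (span_mu_obj (wdom f) (wdom g) p q))
       (act_label (mu_label (leaf 0) (leaf 1)))
       (span_mu_obj (wcod f) (wcod g) (span_act_obj f p) (span_act_obj g q))
       (mu_label (act_label (leaf 0)) (act_label (leaf 1))),
     asc = \<lambda>X Y Z p q r. canon
       (span_act_obj (Assoc (WD ShN) X Y Z) (span_mu_obj (box_sum X Y) Z (span_mu_obj X Y p q) r))
       (act_label (mu_label (mu_label (leaf 0) (leaf 1)) (leaf 2)))
       (span_mu_obj X (box_sum Y Z) p (span_mu_obj Y Z q r))
       (mu_label (leaf 0) (mu_label (leaf 1) (leaf 2))),
     lun = \<lambda>X p. canon (span_act_obj (Lunit (WD ShN) X) (span_mu_obj unit_box X unit_machine p))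
       (act_label (mu_label unit_label (leaf 0))) p (leaf 0),
     run = \<lambda>X p. canon (span_act_obj (Runit (WD ShN) X) (span_mu_obj X unit_box p unit_machine))
       (act_label (mu_label (leaf 0) unit_label)) p (leaf 0),
     brd = \<lambda>X Y p q. canon (span_act_obj (Braid (WD ShN) X Y) (span_mu_obj X Y p q))
       (act_label (mu_label (leaf 0) (leaf 1))) (span_mu_obj Y X q p) (mu_label (leaf 1) (leaf 0))\<rparr>"

lemmas machine_rules = act_machine span_mu_obj_hom unit_machine_hom box_sum_Obj unit_box_WD_Obj
  Comp_WD_hom Ident_WD_hom wiring_sum_hom Assoc_WD_hom Lunit_WD_hom Runit_WD_hom Braid_WD_hom
lemmas label_rules = determined_leaf act_determined determined_mu determined_unit
  label_natural_leaf act_label_natural label_natural_mu label_natural_unit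
lemmas label_defs = leaf_def act_label_def mu_label_def unit_label_def

text \<open>The function \<theta> replaces each tagged state by the label it is to carry. As labels
  are sets, this substitution commutes with the unions in \<open>mu_label\<close>.\<close>

lemma canon_cell:
  assumes "p \<in> machines X" "q \<in> machines X" "determined p \<sigma> I" "determined q \<tau> J"
    "label_natural E p \<sigma>" "label_natural E q \<tau>" "\<And>n. graph p \<sigma> n = graph q \<tau> n"
    and "\<And>n s. s \<in> Sec (mdom p) n \<Longrightarrow> \<sigma>' n s = (\<Union>(i, v) \<in> \<sigma> n s. \<theta> n i v)"
    and "\<And>n s. s \<in> Sec (mdom q) n \<Longrightarrow> \<tau>' n s = (\<Union>(i, v) \<in> \<tau> n s. \<theta> n i v)"
  shows "label_hom X p \<sigma>' q \<tau>' (canon p \<sigma> q \<tau>) \<and> invertible (slice ShN (span_base X)) (canon p \<sigma> q \<tau>)"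
  by (intro conjI label_hom_subst[where \<theta> = \<theta>, OF canon_iso(1)[OF assms(1-7)]]
      canon_iso(2)[OF assms(1-7)] assms(8,9))

lemma cmp_cell:
  assumes f: "f \<in> hom (WD_cat ShN) X Y" and g: "g \<in> hom (WD_cat ShN) Y Z" and p: "p \<in> machines X"
  shows "label_hom Z (span_act_obj g (span_act_obj f p)) (act_label (act_label \<sigma>))
      (span_act_obj (Comp (WD_cat ShN) g f) p) (act_label \<sigma>) (cmp Mch_cells g f p) \<and>
    invertible (slice ShN (span_base Z)) (cmp Mch_cells g f p)"
  unfolding Mch_cells_def lax_cells.simps
  by (rule canon_cell[where E = "\<lambda>_. mdom p" and \<theta> = "\<lambda>n i v. \<sigma> n v"])
    (rule f g p machine_rules label_rules refl graph_Comp | (auto simp: label_defs; fail))+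

lemma unt_cell:
  assumes X: "X \<in> Obj (WD_cat ShN)" and p: "p \<in> machines X"
  shows "label_hom X p \<sigma> (span_act_obj (Ident (WD_cat ShN) X) p) (act_label \<sigma>) (unt Mch_cells X p) \<and>
    invertible (slice ShN (span_base X)) (unt Mch_cells X p)"
  unfolding Mch_cells_def lax_cells.simps
  by (rule canon_cell[where E = "\<lambda>_. mdom p" and \<theta> = "\<lambda>n i v. \<sigma> n v"])
    (rule X p machine_rules label_rules refl graph_Ident | (auto simp: label_defs; fail))+

lemma mun_cell:
  assumes f: "f \<in> hom (WD_cat ShN) X X'" and g: "g \<in> hom (WD_cat ShN) Y Y'"
    and p: "p \<in> machines X" and q: "q \<in> machines Y"
  shows "label_hom (box_sum X' Y') (span_act_obj (wiring_sum f g) (span_mu_obj X Y p q))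
      (act_label (mu_label \<sigma> \<tau>)) (span_mu_obj X' Y' (span_act_obj f p) (span_act_obj g q))
      (mu_label (act_label \<sigma>) (act_label \<tau>)) (mun Mch_cells f g p q) \<and>
    invertible (slice ShN (span_base (box_sum X' Y'))) (mun Mch_cells f g p q)"
  unfolding Mch_cells_def lax_cells.simps hom_WD_Obj[OF f] hom_WD_Obj[OF g]
  \<comment> \<open>In \<open>Mch_cells\<close> the tag 0 belongs to \<open>p\<close> and the tag 1
    to \<open>q\<close>; the sheaves \<open>E\<close> and the substitution \<theta> follow this
    convention.\<close>
  by (rule canon_cell[where E = "\<lambda>i. if i = 0 then mdom p else mdom q"
        and \<theta> = "\<lambda>n i v. if i = 0 then \<sigma> n v else \<tau> n v"])
    (rule hom_WD_Obj[OF f] hom_WD_Obj[OF g] f g p q machine_rules label_rules refl graph_sum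
      | (auto simp: label_defs; fail))+

lemma asc_cell:
  assumes X: "X \<in> Obj (WD_cat ShN)" "Y \<in> Obj (WD_cat ShN)" "Z \<in> Obj (WD_cat ShN)"
    and p: "p \<in> machines X" "q \<in> machines Y" "r \<in> machines Z"
  shows "label_hom (box_sum X (box_sum Y Z))
      (span_act_obj (Assoc (WD ShN) X Y Z) (span_mu_obj (box_sum X Y) Z (span_mu_obj X Y p q) r))
      (act_label (mu_label (mu_label \<sigma> \<tau>) \<rho>)) (span_mu_obj X (box_sum Y Z) p (span_mu_obj Y Z q r))
      (mu_label \<sigma> (mu_label \<tau> \<rho>)) (asc Mch_cells X Y Z p q r) \<and>
    invertible (slice ShN (span_base (box_sum X (box_sum Y Z)))) (asc Mch_cells X Y Z p q r)"
  unfolding Mch_cells_def lax_cells.simps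
  by (rule canon_cell[where E = "\<lambda>i. if i = 0 then mdom p else if i = 1 then mdom q else mdom r"
        and \<theta> = "\<lambda>n i v. if i = 0 then \<sigma> n v else if i = 1 then \<tau> n v else \<rho> n v"])
    (rule X p machine_rules label_rules refl graph_Assoc | (auto simp: label_defs; fail))+

lemma lun_cell:
  assumes X: "X \<in> Obj (WD_cat ShN)" and p: "p \<in> machines X"
  shows "label_hom X (span_act_obj (Lunit (WD ShN) X) (span_mu_obj unit_box X unit_machine p))
      (act_label (mu_label unit_label \<sigma>)) p \<sigma> (lun Mch_cells X p) \<and>
    invertible (slice ShN (span_base X)) (lun Mch_cells X p)"
  unfolding Mch_cells_def lax_cells.simps
  by (rule canon_cell[where E = "\<lambda>_. mdom p" and \<theta> = "\<lambda>n i v. \<sigma> n v"])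
    (rule X p machine_rules label_rules refl graph_Lunit | (auto simp: label_defs; fail))+

lemma run_cell:
  assumes X: "X \<in> Obj (WD_cat ShN)" and p: "p \<in> machines X"
  shows "label_hom X (span_act_obj (Runit (WD ShN) X) (span_mu_obj X unit_box p unit_machine))
      (act_label (mu_label \<sigma> unit_label)) p \<sigma> (run Mch_cells X p) \<and>
    invertible (slice ShN (span_base X)) (run Mch_cells X p)"
  unfolding Mch_cells_def lax_cells.simps
  by (rule canon_cell[where E = "\<lambda>_. mdom p" and \<theta> = "\<lambda>n i v. \<sigma> n v"])
    (rule X p machine_rules label_rules refl graph_Runit | (auto simp: label_defs; fail))+

lemma brd_cell:
  assumes X: "X \<in> Obj (WD_cat ShN)" "Y \<in> Obj (WD_cat ShN)" and p: "p \<in> machines X" "q \<in> machines Y"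
  shows "label_hom (box_sum Y X) (span_act_obj (Braid (WD ShN) X Y) (span_mu_obj X Y p q))
      (act_label (mu_label \<sigma> \<tau>)) (span_mu_obj Y X q p) (mu_label \<tau> \<sigma>) (brd Mch_cells X Y p q) \<and>
    invertible (slice ShN (span_base (box_sum Y X))) (brd Mch_cells X Y p q)"
  unfolding Mch_cells_def lax_cells.simps
  by (rule canon_cell[where E = "\<lambda>i. if i = 0 then mdom p else mdom q"
        and \<theta> = "\<lambda>n i v. if i = 0 then \<sigma> n v else \<tau> n v"])
    (rule X p machine_rules label_rules refl graph_Braid | (auto simp: label_defs; fail))+

lemma Mch_N_simps [simp]:
  "FO Mch_N X = slice ShN (span_base X)" "FA Mch_N f = span_act f"
  "fo (mu Mch_N X Y) (p, q) = span_mu_obj X Y p q"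
  "eta Mch_N = pair_map (Ident ShN (hat tempty)) (Ident ShN (hat tempty))"
  "fo (span_act f) p = span_act_obj f p"
  by (simp_all add: Mch_N_def span_act_def)

theorem WD_algebra_Mch_N: "WD_algebra ShN (Mch_N :: ('a sbox, 'a swiring, _, _) lax_data)"
  unfolding WD_algebra_def
proof (intro exI)
  \<comment> \<open>Membership in \<open>machines X\<close> is joined to \<open>determined\<close>,
    because preservation of the latter under wiring and parallel composition is established for
    machines.\<close>
  have "labelled_lax_functor (WD ShN) (Mch_N :: ('a sbox, 'a swiring, _, _) lax_data) Mch_cells label_hom
    (\<lambda>X p \<sigma> I. p \<in> machines X \<and> determined p \<sigma> I) leaf act_label mu_label unit_label"
  proof (intro labelled_lax_functor.intro labelled_lax_functor_axioms.intro symmetric_monoidal_category_WD,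
      unfold WD_simps Mch_N_simps)
    show "category (slice ShN (span_base X))" for X :: "'a sbox" by (rule category_machines)
    show "label_hom Y (span_act_obj f p) (act_label \<sigma>) (span_act_obj f q) (act_label \<tau>) (fa (span_act f) k)"
      if "f \<in> hom (WD_cat ShN) X Y" "label_hom X p \<sigma> q \<tau> k" for f X Y p \<sigma> q \<tau> and k :: "'a shmap \<times> _"
      using label_hom_act[of f p \<sigma> q \<tau> k] that by (simp add: hom_WD)
    show "label_hom X q \<tau> p \<sigma> (cinv (slice ShN (span_base X)) k)"
      if "label_hom X p \<sigma> q \<tau> k" "invertible (slice ShN (span_base X)) k" for X p \<sigma> q \<tau> and k :: "'a shmap \<times> _"
      using that by (rule label_hom_cinv)
    show "k = l" if "label_hom X p \<sigma> q \<tau> k" "label_hom X p \<sigma> q \<tau> l" "q \<in> machines X \<and> determined q \<tau> I"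
      for X p \<sigma> q \<tau> I and k l :: "'a shmap \<times> _"
      using that label_hom_unique by blast
    show "k \<in> hom (slice ShN (span_base X)) p q" if "label_hom X p \<sigma> q \<tau> k"
      for X p \<sigma> q \<tau> and k :: "'a shmap \<times> _"
      using that by (simp add: label_hom_def)
  qed ((rule cmp_cell unt_cell mun_cell asc_cell lun_cell run_cell brd_cell; assumption) |
      blast intro: act_machine span_mu_obj_hom unit_machine_hom label_hom_lift label_hom_ident
        label_hom_comp label_hom_mu determined_leaf act_determined determined_mu)+
  then show "symmetric_lax_monoidal_pseudofunctor (WD ShN) (Mch_N :: ('a sbox, 'a swiring, _, _) lax_data) Mch_cells"
    by (rule labelled_lax_functor.pseudofunctor)
qed

section \<open>Epimorphisms and monomorphisms of interval sheaves\<close>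

text \<open>A sufficient criterion only: an epimorphism can miss a long section whose pieces have
  preimages that do not fit together. The converse is accordingly proved at length 0.\<close>

lemma epic_ShN_I:
  assumes f: "f \<in> hom ShN X Y"
    and surj: "\<And>n y. y \<in> Sec Y n \<Longrightarrow> \<exists>x \<in> Sec X n. app f n x = y"
  shows "epic ShN f"
  unfolding epic_def
proof (intro conjI allI ballI impI)
  show "f \<in> Arr ShN" using f by (simp add: hom_def)
  fix Z g h assume g: "g \<in> hom ShN (Cod ShN f) Z" and h: "h \<in> hom ShN (Cod ShN f) Z"
    and eq: "g \<odot> f = h \<odot> f"
  have [simp]: "mdom f = X" "mcod f = Y" using f by (auto simp: hom_ShN)
  show "g = h"
  proof (rule map_eqI[of _ Y Z])
    fix n y assume "y \<in> Sec Y n"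
    then obtain x where "x \<in> Sec X n" "app f n x = y" using surj by blast
    then show "app g n y = app h n y" using app_Comp[of x f n g] app_Comp[of x f n h] eq by simp
  qed (use g h in auto)
qed

lemma monic_ShN_I:
  assumes f: "f \<in> hom ShN X Y"
    and inj: "\<And>n x x'. x \<in> Sec X n \<Longrightarrow> x' \<in> Sec X n \<Longrightarrow> app f n x = app f n x' \<Longrightarrow> x = x'"
  shows "monic ShN f"
  unfolding monic_def
proof (intro conjI allI ballI impI)
  show "f \<in> Arr ShN" using f by (simp add: hom_def)
  fix Z g h assume g: "g \<in> hom ShN Z (Dom ShN f)" and h: "h \<in> hom ShN Z (Dom ShN f)"
    and eq: "f \<odot> g = f \<odot> h"
  have [simp]: "mdom f = X" "mdom g = Z" "mdom h = Z" using f g h by (auto simp: hom_ShN)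
  show "g = h"
  proof (rule map_eqI[of _ Z X])
    fix n z assume z: "z \<in> Sec Z n"
    then have "app f n (app g n z) = app f n (app h n z)"
      using app_Comp[of z g n f] app_Comp[of z h n f] eq by simp
    then show "app g n z = app h n z"
      using inj z g h hom_app by (metis Dom_ShN \<open>mdom f = X\<close>)
  qed (use g h in auto)
qed

text \<open>The point, i.e. the sheaf represented by \<open>0\<close>.\<close>

definition point :: "'a sh" where
  "point = \<lparr>Sec = \<lambda>n. if n = 0 then {Atom undefined} else {}, Res = \<lambda>t v. v\<rparr>"

lemma sheaf_point: "interval_sheaf point"
  by (rule interval_sheafI) (auto simp: point_def intro!: presheafI split: if_splits)

text \<open>A section of length 0 is the same as a map from the point, and \<open>f\<close> can be
  cancelled from the two composites with such maps.\<close>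

lemma monic_ShN_inj:
  fixes f :: "'a shmap"
  assumes f: "f \<in> hom ShN X Y" and m: "monic ShN f"
    and x: "x \<in> Sec X 0" "x' \<in> Sec X 0" and eq: "app f 0 x = app f 0 x'"
  shows "x = x'"
proof -
  note X = hom_sheaf_dom[OF f]
  define g where "g z = mk_map (point :: 'a sh) X (\<lambda>n v. z)" for z
  have g: "g z \<in> hom ShN point X" if "z \<in> Sec X 0" for z
    unfolding g_def
    by (rule mk_map_hom[OF sheaf_point X])
      (use that X in \<open>auto simp: point_def sheaf_Res_id split: if_splits\<close>)
  have p: "Atom undefined \<in> Sec point 0" by (simp add: point_def)
  have app_g: "app (g z) n v = z" if "v \<in> Sec point n" for z n v
    using that by (simp add: g_def app_mk_map)
  have "f \<odot> g x = f \<odot> g x'"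
  proof (rule map_eqI[OF Comp_hom[OF g f] Comp_hom[OF g f]])
    fix n v assume v: "v \<in> Sec (point :: 'a sh) n"
    then have "n = 0" by (auto simp: point_def split: if_splits)
    with v eq show "app (f \<odot> g x) n v = app (f \<odot> g x') n v"
      using app_Comp[of v "g x" n f] app_Comp[of v "g x'" n f] app_g by (simp add: g_def)
  qed (use x in auto)
  then have "g x = g x'"
    using m g x mdom_hom[OF f] unfolding monic_def Dom_ShN by blast
  then show ?thesis using app_g[OF p] by metis
qed

text \<open>The codiscrete sheaf on two vertices, with paths encoded as the lists of their vertices: maps
  into it are the same as arbitrary subsets of the vertices.\<close>

primrec encode :: "bool list \<Rightarrow> 'a val" where
  "encode [] = Atom undefined"
| "encode (b # bs) = VPair (if b then Fam (\<lambda>_. Atom undefined) else Atom undefined) (encode bs)"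

text \<open>The truth values are encoded by different constructors, \<open>Fam\<close> and
  \<open>Atom\<close>, so injectivity holds for every type \<open>'a\<close>, even one with a single
  element.\<close>

lemma inj_encode: "inj encode"
proof (rule injI)
  fix bs bs' :: "bool list"
  assume "(encode bs :: 'a val) = encode bs'"
  then show "bs = bs'"
  proof (induction bs arbitrary: bs')
    case Nil
    then show ?case by (cases bs') auto
  next
    case (Cons b bs)
    then show ?case by (cases bs') (auto split: if_splits)
  qed
qed

definition codiscrete :: "'a sh" where
  "codiscrete =
    \<lparr>Sec = \<lambda>n. encode ` {bs. length bs = n + 1},
     Res = \<lambda>t v. encode (take (tsrc t + 1) (drop (toff t) (inv encode v)))\<rparr>"

lemma Sec_codiscrete: "Sec codiscrete n = encode ` {bs. length bs = n + 1}"
  and Res_codiscrete: "Res codiscrete (Tr n' p n) (encode bs) = encode (take (n' + 1) (drop p bs))"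
  by (simp_all add: codiscrete_def inv_f_f[OF inj_encode])

text \<open>Gluing is concatenation of vertex lists in which the common vertex is kept once: the
  last vertex of the first list is dropped.\<close>

lemma sheaf_codiscrete: "interval_sheaf codiscrete"
proof (rule interval_sheafI)
  show "presheaf codiscrete"
    by (rule presheafI)
      (auto simp: Sec_codiscrete Res_codiscrete drop_take add.commute intro!: imageI)
next
  fix n1 n2 and x1 x2 :: "'a val"
  assume "x1 \<in> Sec codiscrete n1" "x2 \<in> Sec codiscrete n2"
    "Res codiscrete (Tr 0 n1 n1) x1 = Res codiscrete (Tr 0 0 n2) x2"
  then obtain bs cs where x: "x1 = encode bs" "x2 = encode cs" "length bs = n1 + 1" "length cs = n2 + 1"
    and "drop n1 bs = take 1 cs"
    by (auto simp: Sec_codiscrete Res_codiscrete inj_eq[OF inj_encode])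
  then have "take n1 bs @ take 1 cs = bs" by (metis append_take_drop_id)
  with x show "\<exists>x \<in> Sec codiscrete (n1 + n2). Res codiscrete (Tr n1 0 (n1 + n2)) x = x1 \<and>
      Res codiscrete (Tr n2 n1 (n1 + n2)) x = x2"
    by (intro bexI[of _ "encode (take n1 bs @ cs)"]) (auto simp: Sec_codiscrete Res_codiscrete)
next
  fix n1 n2 and x y :: "'a val"
  assume "x \<in> Sec codiscrete (n1 + n2)" "y \<in> Sec codiscrete (n1 + n2)"
    "Res codiscrete (Tr n1 0 (n1 + n2)) x = Res codiscrete (Tr n1 0 (n1 + n2)) y"
    "Res codiscrete (Tr n2 n1 (n1 + n2)) x = Res codiscrete (Tr n2 n1 (n1 + n2)) y"
  then obtain bs cs where x: "x = encode bs" "y = encode cs" "length bs = n1 + n2 + 1" "length cs = n1 + n2 + 1"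
    and eq: "take (n1 + 1) bs = take (n1 + 1) cs" "drop n1 bs = drop n1 cs"
    by (auto simp: Sec_codiscrete Res_codiscrete inj_eq[OF inj_encode])
  have "take n1 bs = take n1 (take (n1 + 1) bs)" "take n1 cs = take n1 (take (n1 + 1) cs)" by simp_all
  then have "bs = cs" using eq by (metis append_take_drop_id)
  then show "x = y" by (simp add: x)
qed

text \<open>The vertices of a section \<open>y\<close> of length \<open>n\<close> are its
  restrictions \<open>Res Y (Tr 0 i n) y\<close>. The map records, along \<open>y\<close>, which of
  them belong to the subset \<open>u\<close>.\<close>

lemma codiscrete_map_hom:
  assumes Y: "interval_sheaf Y"
  shows "mk_map Y codiscrete (\<lambda>n y. encode (map (\<lambda>i. u (Res Y (Tr 0 i n) y)) [0..<n + 1])) \<in>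
    hom ShN Y codiscrete"
proof (rule mk_map_hom[OF Y sheaf_codiscrete])
  fix n' p n y assume "n' + p \<le> n" "y \<in> Sec Y n"
  then have "map (\<lambda>i. u (Res Y (Tr 0 i n') (Res Y (Tr n' p n) y))) [0..<n' + 1] =
      take (n' + 1) (drop p (map (\<lambda>i. u (Res Y (Tr 0 i n) y)) [0..<n + 1]))"
    by (intro nth_equalityI) (auto simp: sheaf_Res_Res[OF Y] nth_append simp del: upt_Suc)
  then show "encode (map (\<lambda>i. u (Res Y (Tr 0 i n') (Res Y (Tr n' p n) y))) [0..<n' + 1]) =
      Res codiscrete (Tr n' p n) (encode (map (\<lambda>i. u (Res Y (Tr 0 i n) y)) [0..<n + 1]))"
    by (simp only: Res_codiscrete)
qed (auto simp: Sec_codiscrete)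

text \<open>If \<open>y\<close> is missed by \<open>f\<close>, the subset containing only
  \<open>y\<close> and the empty subset have the same preimage. Their classifying maps then agree
  after composition with \<open>f\<close>, although they differ at \<open>y\<close>.\<close>

lemma epic_ShN_surj:
  fixes f :: "'a shmap"
  assumes f: "f \<in> hom ShN X Y" and e: "epic ShN f" and y: "y \<in> Sec Y 0"
  shows "\<exists>x \<in> Sec X 0. app f 0 x = y"
proof (rule ccontr)
  assume no: "\<not> (\<exists>x \<in> Sec X 0. app f 0 x = y)"
  note X = hom_sheaf_dom[OF f] and Y = hom_sheaf_cod[OF f]
  define h where "h u n z = (encode (map (\<lambda>i. u (Res Y (Tr 0 i n) z)) [0..<n + 1]) :: 'a val)" for u n z
  define g where "g u = mk_map Y codiscrete (h u)" for u
  have g: "g u \<in> hom ShN Y codiscrete" for u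
    unfolding g_def h_def by (rule codiscrete_map_hom[OF Y])
  have app_g: "app (g u) n z = h u n z" if "z \<in> Sec Y n" for u n z
    using that by (simp add: g_def app_mk_map)
  have "g (\<lambda>z. z = y) \<odot> f = g (\<lambda>_. False) \<odot> f"
  proof (rule map_eqI[OF Comp_hom[OF f g] Comp_hom[OF f g]])
    fix n x assume x: "x \<in> Sec X n"
    have "Res Y (Tr 0 i n) (app f n x) \<noteq> y" if "i \<le> n" for i
      using no x that hom_Res[OF f, of 0 i n x] sheaf_Res[OF X, of 0 i n x] by auto
    then have "h (\<lambda>z. z = y) n (app f n x) = h (\<lambda>_. False) n (app f n x)"
      unfolding h_def by (intro arg_cong[of _ _ encode] map_cong refl) (simp add: less_Suc_eq_le del: upt_Suc)
    then show "app (g (\<lambda>z. z = y) \<odot> f) n x = app (g (\<lambda>_. False) \<odot> f) n x"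
      using x app_g hom_app[OF f x] by (simp add: app_Comp mdom_hom[OF f])
  qed
  then have "g (\<lambda>z. z = y) = g (\<lambda>_. False)"
    using e g mcod_hom[OF f] unfolding epic_def Cod_ShN by blast
  then have "h (\<lambda>z. z = y) 0 y = h (\<lambda>_. False) 0 y" using app_g[OF y] by metis
  then show False by (simp add: h_def sheaf_Res_id[OF Y y])
qed

section \<open>Lifting criteria for total, deterministic and inertial maps\<close>

context
  fixes f :: "'a shmap" and S A
  assumes f: "f \<in> hom ShN S A"
begin

lemma Sec_h1_cod: "Sec (pb (lam A) f) n =
    {VPair a s | a s. a \<in> Sec A (n + 1) \<and> s \<in> Sec S n \<and> Res A (Tr n 0 (n + 1)) a = app f n s}"
  using mdom_hom[OF f] by (auto simp: pb_simps lam_def app_mk_map Ext1_def)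

lemma app_h1:
  assumes "s \<in> Sec S (n + 1)"
  shows "app (h1 f) n s = VPair (app f (n + 1) s) (Res S (Tr n 0 (n + 1)) s)"
proof -
  have "s \<in> Sec (Ext1 S) n" using assms by (simp add: Ext1_def)
  then show ?thesis by (simp add: h1_def app_mk_map mdom_hom[OF f] lam_def Ext1_map_def)
qed

lemma h1_hom: "h1 f \<in> hom ShN (Ext1 S) (pb (lam A) f)"
proof -
  note S = hom_sheaf_dom[OF f] and A = hom_sheaf_cod[OF f]
  have "Res A (Tr n' k (Suc n')) (app f (Suc n') (Res S (Tr (Suc n') p (Suc n)) s)) =
      Res A (Tr n' (p + k) (Suc n)) (app f (Suc n) s)"
    if "n' + p \<le> n" "k \<le> 1" "s \<in> Sec S (Suc n)" for n' p n k s
    using that by (simp add: hom_Res[OF f] sheaf_Res_Res[OF A] hom_app[OF f])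
  show ?thesis
    unfolding h1_def mdom_hom[OF f] mcod_hom[OF f]
  proof (rule mk_map_hom)
    show "interval_sheaf (Ext1 S)" by (rule sheaf_Ext1[OF S])
    show "interval_sheaf (pb (lam A) f)" by (rule sheaf_pb[OF lam_hom[OF A] f])
    fix n s assume s: "s \<in> Sec (Ext1 S) n"
    then have s': "s \<in> Sec S (n + 1)" by (simp add: Ext1_def)
    have eq: "VPair (app (Ext1_map f) n s) (app (lam S) n s) =
        VPair (app f (n + 1) s) (Res S (Tr n 0 (n + 1)) s)"
      if "s \<in> Sec (Ext1 S) n" for n s
      using that by (simp add: Ext1_map_def lam_def app_mk_map)
    show "VPair (app (Ext1_map f) n s) (app (lam S) n s) \<in> Sec (pb (lam A) f) n"
      unfolding eq[OF s] Sec_h1_cod using s' by (auto simp: hom_app[OF f] sheaf_Res[OF S] hom_Res[OF f])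
    fix n' p m assume p: "n' + p \<le> m" and s: "s \<in> Sec (Ext1 S) m"
    then have s': "s \<in> Sec S (m + 1)" by (simp add: Ext1_def)
    have "Res (Ext1 S) (Tr n' p m) s \<in> Sec (Ext1 S) n'" by (rule sheaf_Res[OF sheaf_Ext1[OF S] p s])
    from eq[OF this] p s'
    show "VPair (app (Ext1_map f) n' (Res (Ext1 S) (Tr n' p m) s)) (app (lam S) n' (Res (Ext1 S) (Tr n' p m) s)) =
        Res (pb (lam A) f) (Tr n' p m) (VPair (app (Ext1_map f) m s) (app (lam S) m s))"
      unfolding eq[OF s]
      by (simp add: pb_simps lam_def Ext1_def mdom_hom[OF f] hom_Res[OF f] sheaf_Res_Res[OF S])
  qed
qed

text \<open>One unit at a time suffices: the final vertex of the state is lifted along the final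
  unit of the input, and the result is glued to the state.\<close>

lemma total_map_iff:
  "total_map f \<longleftrightarrow> (\<forall>s \<in> Sec S 0. \<forall>a \<in> Sec A 1. Res A (Tr 0 0 1) a = app f 0 s \<longrightarrow>
     (\<exists>s' \<in> Sec S 1. Res S (Tr 0 0 1) s' = s \<and> app f 1 s' = a))" (is "_ \<longleftrightarrow> ?R")
proof
  note S = hom_sheaf_dom[OF f] and A = hom_sheaf_cod[OF f]
  assume t: "total_map f"
  show ?R
  proof (intro ballI impI)
    fix s a assume "s \<in> Sec S 0" "a \<in> Sec A 1" "Res A (Tr 0 0 1) a = app f 0 s"
    then have "VPair a s \<in> Sec (pb (lam A) f) 0" by (simp add: Sec_h1_cod)
    from epic_ShN_surj[OF h1_hom t[unfolded total_map_def] this]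
    obtain s' where "s' \<in> Sec S 1" "app (h1 f) 0 s' = VPair a s" by (auto simp: Ext1_def)
    then show "\<exists>s' \<in> Sec S 1. Res S (Tr 0 0 1) s' = s \<and> app f 1 s' = a"
      using app_h1[of s' 0] by auto
  qed
next
  note S = hom_sheaf_dom[OF f] and A = hom_sheaf_cod[OF f]
  assume R: ?R
  show "total_map f"
    unfolding total_map_def
  proof (rule epic_ShN_I[OF h1_hom])
    fix n v assume "v \<in> Sec (pb (lam A) f) n"
    then obtain a s where v: "v = VPair a s" and a: "a \<in> Sec A (n + 1)" and s: "s \<in> Sec S n"
      and eq: "Res A (Tr n 0 (n + 1)) a = app f n s"
      by (auto simp: Sec_h1_cod)
    let ?a = "Res A (Tr 1 n (n + 1)) a" and ?s = "Res S (Tr 0 n n) s"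
    have "Res A (Tr 0 0 1) ?a = Res A (Tr 0 n n) (Res A (Tr n 0 (n + 1)) a)"
      using a by (simp add: sheaf_Res_Res[OF A])
    also have "\<dots> = app f 0 ?s" unfolding eq using s by (simp add: hom_Res[OF f])
    finally obtain t where t: "t \<in> Sec S 1" "Res S (Tr 0 0 1) t = ?s" "app f 1 t = ?a"
      using R sheaf_Res[OF S _ s, of 0 n] sheaf_Res[OF A _ a, of 1 n] by auto
    obtain s' where s': "s' \<in> Sec S (n + 1)" "Res S (Tr n 0 (n + 1)) s' = s" "Res S (Tr 1 n (n + 1)) s' = t"
      using sheaf_glue[OF S s t(1) t(2)[symmetric]] by blast
    \<comment> \<open>The glued state lies over \<open>a\<close>: the two agree on the first
      \<open>n\<close> units by \<open>eq\<close> and on the last one by the choice of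
      \<open>t\<close>.\<close>
    have "app f (n + 1) s' = a"
    proof (rule sheaf_separated[OF A hom_app[OF f s'(1)] a])
      show "Res A (Tr n 0 (n + 1)) (app f (n + 1) s') = Res A (Tr n 0 (n + 1)) a"
        using hom_Res[OF f, of n 0 "n + 1" s'] s' eq by simp
      show "Res A (Tr 1 n (n + 1)) (app f (n + 1) s') = Res A (Tr 1 n (n + 1)) a"
        using hom_Res[OF f, of 1 n "n + 1" s'] s' t by simp
    qed
    then have "app (h1 f) n s' = v" using app_h1[OF s'(1)] s'(2) v by simp
    then show "\<exists>s \<in> Sec (Ext1 S) n. app (h1 f) n s = v"
      using s'(1) by (auto simp: Ext1_def)
  qed
qed

text \<open>Two liftings of the same state can differ only in their last unit, and these last units
  start at the same vertex and have the same image.\<close>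

lemma deterministic_map_iff:
  "deterministic_map f \<longleftrightarrow> (\<forall>s \<in> Sec S 1. \<forall>s' \<in> Sec S 1.
     Res S (Tr 0 0 1) s = Res S (Tr 0 0 1) s' \<longrightarrow> app f 1 s = app f 1 s' \<longrightarrow> s = s')" (is "_ \<longleftrightarrow> ?R")
proof
  assume d: "deterministic_map f"
  show ?R
  proof (intro ballI impI)
    fix s s' assume s: "s \<in> Sec S 1" "s' \<in> Sec S 1"
      and "Res S (Tr 0 0 1) s = Res S (Tr 0 0 1) s'" "app f 1 s = app f 1 s'"
    then have "app (h1 f) 0 s = app (h1 f) 0 s'" using app_h1[of s 0] app_h1[of s' 0] by simp
    then show "s = s'"
      using monic_ShN_inj[OF h1_hom d[unfolded deterministic_map_def]] s by (simp add: Ext1_def)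
  qed
next
  note S = hom_sheaf_dom[OF f] and A = hom_sheaf_cod[OF f]
  assume R: ?R
  show "deterministic_map f"
    unfolding deterministic_map_def
  proof (rule monic_ShN_I[OF h1_hom])
    fix n s s' assume "s \<in> Sec (Ext1 S) n" "s' \<in> Sec (Ext1 S) n" and eq: "app (h1 f) n s = app (h1 f) n s'"
    then have s: "s \<in> Sec S (n + 1)" "s' \<in> Sec S (n + 1)" by (simp_all add: Ext1_def)
    have eq: "app f (n + 1) s = app f (n + 1) s'" "Res S (Tr n 0 (n + 1)) s = Res S (Tr n 0 (n + 1)) s'"
      using eq app_h1[OF s(1)] app_h1[OF s(2)] by simp_all
    show "s = s'"
    proof (rule sheaf_separated[OF S s eq(2)], rule R[rule_format])
      show "Res S (Tr 1 n (n + 1)) s \<in> Sec S 1" "Res S (Tr 1 n (n + 1)) s' \<in> Sec S 1"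
        using s by (simp_all add: sheaf_Res[OF S])
      have "Res S (Tr 0 0 1) (Res S (Tr 1 n (n + 1)) z) = Res S (Tr 0 n n) (Res S (Tr n 0 (n + 1)) z)"
        if "z \<in> Sec S (n + 1)" for z
        using that by (simp add: sheaf_Res_Res[OF S])
      then show "Res S (Tr 0 0 1) (Res S (Tr 1 n (n + 1)) s) = Res S (Tr 0 0 1) (Res S (Tr 1 n (n + 1)) s')"
        using s eq by simp
      show "app f 1 (Res S (Tr 1 n (n + 1)) s) = app f 1 (Res S (Tr 1 n (n + 1)) s')"
        using s eq(1) by (simp add: hom_Res[OF f])
    qed
  qed
qed

lemma inertial_map_iff:
  "inertial_map f \<longleftrightarrow> (\<exists>q \<in> hom ShN S (Ext1 A). \<forall>n. \<forall>s \<in> Sec S n.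
     Res A (Tr n 0 (n + 1)) (app q n s) = app f n s)"
proof -
  note S = hom_sheaf_dom[OF f] and A = hom_sheaf_cod[OF f]
  have "f = lam A \<odot> q \<longleftrightarrow> (\<forall>n. \<forall>s \<in> Sec S n. Res A (Tr n 0 (n + 1)) (app q n s) = app f n s)"
    if q: "q \<in> hom ShN S (Ext1 A)" for q
  proof -
    have app: "app (lam A \<odot> q) n s = Res A (Tr n 0 (n + 1)) (app q n s)" if "s \<in> Sec S n" for n s
      using that hom_app[OF q that] by (simp add: app_Comp mdom_hom[OF q] lam_def app_mk_map)
    show ?thesis
    proof
      assume "f = lam A \<odot> q"
      then show "\<forall>n. \<forall>s \<in> Sec S n. Res A (Tr n 0 (n + 1)) (app q n s) = app f n s" using app by simp
    next
      assume "\<forall>n. \<forall>s \<in> Sec S n. Res A (Tr n 0 (n + 1)) (app q n s) = app f n s"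
      then show "f = lam A \<odot> q"
        by (intro map_eqI[OF f Comp_hom[OF q lam_hom[OF A]]]) (simp add: app)
    qed
  qed
  then show ?thesis unfolding inertial_map_def mdom_hom[OF f] mcod_hom[OF f] by blast
qed

end

section \<open>Inertial, total and deterministic machines\<close>

definition restr :: "('a, 'a sh) tset \<Rightarrow> trans \<Rightarrow> ('a port \<Rightarrow> 'a val) \<Rightarrow> 'a port \<Rightarrow> 'a val" where
  "restr A t a = (\<lambda>x \<in> ports A. Res (ty A x) t (a x))"

lemma Res_hat_Fam: "Res (hat A) t (Fam a) = Fam (restr A t a)"
  by (simp add: Res_hat restr_def)

lemma restr_sections:
  "typed_finite_set ShN A \<Longrightarrow> a \<in> sections A n \<Longrightarrow> n' + k \<le> n \<Longrightarrow> restr A (Tr n' k n) a \<in> sections A n'"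
  unfolding restr_def
  by (rule restrict_sections) (auto simp: typed_finite_set_def Obj_ShN intro: sheaf_Res sections_app)

text \<open>Naturality of \<open>hat_in \<phi>\<close>, read off on bare families.\<close>

lemma restr_feed:
  assumes \<phi>: "\<phi> \<in> hom (WD_cat ShN) X Y" and z: "z \<in> sections (bin Y) n" and b: "b \<in> sections (bout X) n"
    and k: "n' + k \<le> n"
  shows "restr (bin X) (Tr n' k n) (feed \<phi> z b) =
    feed \<phi> (restr (bin Y) (Tr n' k n) z) (restr (bout X) (Tr n' k n) b)"
proof -
  note [simp] = hom_WD_Obj(3,4)[OF \<phi>] and arr = hom_WD_iff[OF \<phi>]
  have r: "restr (bin Y) (Tr n' k n) z \<in> sections (bin Y) n'" "restr (bout X) (Tr n' k n) b \<in> sections (bout X) n'"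
    using hom_WD_Obj[OF \<phi>] z b k by (auto simp: Obj_WD intro!: restr_sections)
  have "VPair (Fam z) (Fam b) \<in> Sec (hat (bin Y) \<times>\<^sub>S hat (bout X)) n"
    using z b by (auto simp: prod_sh_simps Sec_hat)
  then have "app (hat_in \<phi>) n' (Res (hat (bin Y) \<times>\<^sub>S hat (bout X)) (Tr n' k n) (VPair (Fam z) (Fam b))) =
      Res (hat (bin X)) (Tr n' k n) (app (hat_in \<phi>) n (VPair (Fam z) (Fam b)))"
    using hom_Res[OF hat_in_hom[OF arr] k] by simp
  then show ?thesis
    using r z b by (simp add: prod_sh_simps Res_hat_Fam app_hat_in[OF arr])
qed

lemma restr_readout:
  assumes \<phi>: "\<phi> \<in> hom (WD_cat ShN) X Y" and b: "b \<in> sections (bout X) n" and k: "n' + k \<le> n"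
  shows "restr (bout Y) (Tr n' k n) (readout \<phi> b) = readout \<phi> (restr (bout X) (Tr n' k n) b)"
proof -
  note [simp] = hom_WD_Obj(3,4)[OF \<phi>] and arr = hom_WD_iff[OF \<phi>]
  have r: "restr (bout X) (Tr n' k n) b \<in> sections (bout X) n'"
    using hom_WD_Obj[OF \<phi>] b k by (auto simp: Obj_WD intro!: restr_sections)
  have "Fam b \<in> Sec (hat (bout X)) n" using b by (auto simp: Sec_hat)
  then have "app (hat_out \<phi>) n' (Res (hat (bout X)) (Tr n' k n) (Fam b)) =
      Res (hat (bout Y)) (Tr n' k n) (app (hat_out \<phi>) n (Fam b))"
    using hom_Res[OF hat_out_hom[OF arr] k] by simp
  then show ?thesis using r b by (simp add: Res_hat_Fam app_hat_out)
qed

lemma restr_join: "restr (A \<uplus> A') t (join A A' a a') = join A A' (restr A t a) (restr A' t a')"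
  by (auto simp: restr_def join_def intro!: restrict_ext)

lemma machine_restr:
  assumes "p \<in> machines X" "s \<in> Sec (mdom p) n" "n' + k \<le> n"
  shows "inp p n' (Res (mdom p) (Tr n' k n) s) = restr (bin X) (Tr n' k n) (inp p n s)"
    and "outp p n' (Res (mdom p) (Tr n' k n) s) = restr (bout X) (Tr n' k n) (outp p n s)"
  using machine_Res[OF assms] by (simp_all add: Res_hat_Fam)

text \<open>A factorisation through \<open>lam\<close> in terms of families: \<open>q n s\<close> is
  the output on [0, n + 1] that a state of length \<open>n\<close> announces, one unit ahead. The
  second clause is naturality into \<open>Ext1\<close>.\<close>

definition inertial_at :: "'a sbox \<Rightarrow> 'a shmap \<Rightarrow> (nat \<Rightarrow> 'a val \<Rightarrow> 'a port \<Rightarrow> 'a val) \<Rightarrow> bool" where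
  "inertial_at X p q \<longleftrightarrow>
    (\<forall>n. \<forall>s \<in> Sec (mdom p) n. q n s \<in> sections (bout X) (n + 1) \<and>
      restr (bout X) (Tr n 0 (n + 1)) (q n s) = outp p n s) \<and>
    (\<forall>n n' k. \<forall>s \<in> Sec (mdom p) n. n' + k \<le> n \<longrightarrow>
      q n' (Res (mdom p) (Tr n' k n) s) = restr (bout X) (Tr (n' + 1) k (n + 1)) (q n s))"

definition total_at :: "'a sbox \<Rightarrow> 'a shmap \<Rightarrow> bool" where
  "total_at X p \<longleftrightarrow> (\<forall>s \<in> Sec (mdom p) 0. \<forall>a \<in> sections (bin X) 1.
     restr (bin X) (Tr 0 0 1) a = inp p 0 s \<longrightarrow>
     (\<exists>s' \<in> Sec (mdom p) 1. Res (mdom p) (Tr 0 0 1) s' = s \<and> inp p 1 s' = a))"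

definition deterministic_at :: "'a shmap \<Rightarrow> bool" where
  "deterministic_at p \<longleftrightarrow> (\<forall>s \<in> Sec (mdom p) 1. \<forall>s' \<in> Sec (mdom p) 1.
     Res (mdom p) (Tr 0 0 1) s = Res (mdom p) (Tr 0 0 1) s' \<longrightarrow> inp p 1 s = inp p 1 s' \<longrightarrow> s = s')"

context
  fixes X :: "'a sbox" and p :: "'a shmap"
  assumes X: "X \<in> Obj (WD_cat ShN)" and p: "p \<in> machines X"
begin

lemma prj_machine_hom:
  "prj1 (hat (bin X)) (hat (bout X)) \<odot> p \<in> hom ShN (mdom p) (hat (bin X))"
  "prj2 (hat (bin X)) (hat (bout X)) \<odot> p \<in> hom ShN (mdom p) (hat (bout X))"
proof -
  have "p \<in> hom ShN (mdom p) (hat (bin X) \<times>\<^sub>S hat (bout X))"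
    using p unfolding machines_iff by (simp add: span_base_def)
  then show "prj1 (hat (bin X)) (hat (bout X)) \<odot> p \<in> hom ShN (mdom p) (hat (bin X))"
    "prj2 (hat (bin X)) (hat (bout X)) \<odot> p \<in> hom ShN (mdom p) (hat (bout X))"
    using sheaf_box[OF X] by (auto intro: Comp_hom[OF _ prj1_hom] Comp_hom[OF _ prj2_hom])
qed

lemma app_prj_machine:
  assumes "s \<in> Sec (mdom p) n"
  shows "app (prj1 (hat (bin X)) (hat (bout X)) \<odot> p) n s = Fam (inp p n s)"
    and "app (prj2 (hat (bin X)) (hat (bout X)) \<odot> p) n s = Fam (outp p n s)"
  using app_machine[OF p assms] assms
  by (auto simp: app_Comp Sec_hat intro!: app_prj1 app_prj2)

lemma total_at_iff: "total_map (prj1 (hat (bin X)) (hat (bout X)) \<odot> p) \<longleftrightarrow> total_at X p"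
  unfolding total_map_iff[OF prj_machine_hom(1)] total_at_def
  by (auto simp: app_prj_machine Sec_hat Res_hat_Fam)

lemma deterministic_at_iff:
  "deterministic_map (prj1 (hat (bin X)) (hat (bout X)) \<odot> p) \<longleftrightarrow> deterministic_at p"
  unfolding deterministic_map_iff[OF prj_machine_hom(1)] deterministic_at_def
  by (auto simp: app_prj_machine)

lemma inertial_at_iff:
  "inertial_map (prj2 (hat (bin X)) (hat (bout X)) \<odot> p) \<longleftrightarrow> (\<exists>q. inertial_at X p q)"
  unfolding inertial_map_iff[OF prj_machine_hom(2)]
proof
  let ?B = "hat (bout X)"
  note S = hom_sheaf_dom[OF prj_machine_hom(2)] and B = sheaf_box(2)[OF X]
  assume "\<exists>q \<in> hom ShN (mdom p) (Ext1 ?B). \<forall>n. \<forall>s \<in> Sec (mdom p) n.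
    Res ?B (Tr n 0 (n + 1)) (app q n s) = app (prj2 (hat (bin X)) ?B \<odot> p) n s"
  then obtain q where q: "q \<in> hom ShN (mdom p) (Ext1 ?B)"
    and eq: "\<And>n s. s \<in> Sec (mdom p) n \<Longrightarrow>
      Res ?B (Tr n 0 (n + 1)) (app q n s) = app (prj2 (hat (bin X)) ?B \<odot> p) n s" by blast
  have app_q: "fam (app q n s) \<in> sections (bout X) (n + 1)" "app q n s = Fam (fam (app q n s))"
    if "s \<in> Sec (mdom p) n" for n s
    using hom_app[OF q that] by (auto simp: Ext1_def Sec_hat)
  have "inertial_at X p (\<lambda>n s. fam (app q n s))"
    unfolding inertial_at_def
  proof (intro conjI allI ballI impI)
    fix n s assume s: "s \<in> Sec (mdom p) n"
    show "fam (app q n s) \<in> sections (bout X) (n + 1)" by (rule app_q(1)[OF s])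
    have "Res ?B (Tr n 0 (n + 1)) (Fam (fam (app q n s))) = Fam (outp p n s)"
      using eq[OF s] app_q(2)[OF s] app_prj_machine(2)[OF s] by metis
    then show "restr (bout X) (Tr n 0 (n + 1)) (fam (app q n s)) = outp p n s"
      by (simp add: Res_hat_Fam)
  next
    fix n n' k s assume s: "s \<in> Sec (mdom p) n" and k: "n' + k \<le> n"
    have "app q n' (Res (mdom p) (Tr n' k n) s) = Res ?B (Tr (n' + 1) k (n + 1)) (Fam (fam (app q n s)))"
      using hom_Res[OF q k s] app_q(2)[OF s] by (simp add: Ext1_def)
    then show "fam (app q n' (Res (mdom p) (Tr n' k n) s)) =
        restr (bout X) (Tr (n' + 1) k (n + 1)) (fam (app q n s))"
      by (simp add: Res_hat_Fam)
  qed
  then show "\<exists>q. inertial_at X p q" by blast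
next
  let ?B = "hat (bout X)"
  note S = hom_sheaf_dom[OF prj_machine_hom(2)] and B = sheaf_box(2)[OF X]
  assume "\<exists>q. inertial_at X p q"
  then obtain q where q: "inertial_at X p q" by blast
  have "mk_map (mdom p) (Ext1 ?B) (\<lambda>n s. Fam (q n s)) \<in> hom ShN (mdom p) (Ext1 ?B)"
    by (rule mk_map_hom[OF S sheaf_Ext1[OF B]])
      (use q in \<open>auto simp: inertial_at_def Ext1_def Sec_hat Res_hat_Fam\<close>)
  moreover have "Res ?B (Tr n 0 (n + 1)) (app (mk_map (mdom p) (Ext1 ?B) (\<lambda>n s. Fam (q n s))) n s) =
      app (prj2 (hat (bin X)) ?B \<odot> p) n s" if "s \<in> Sec (mdom p) n" for n s
    using q that by (simp add: app_mk_map app_prj_machine Res_hat_Fam inertial_at_def)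
  ultimately show "\<exists>q \<in> hom ShN (mdom p) (Ext1 ?B). \<forall>n. \<forall>s \<in> Sec (mdom p) n.
    Res ?B (Tr n 0 (n + 1)) (app q n s) = app (prj2 (hat (bin X)) ?B \<odot> p) n s"
    by blast
qed

end

lemma Mch_iff:
  assumes X: "X \<in> Obj (WD_cat ShN)"
  shows "p \<in> Mch_in X \<longleftrightarrow> p \<in> machines X \<and> (\<exists>q. inertial_at X p q)"
    and "p \<in> Mch_t X \<longleftrightarrow> p \<in> machines X \<and> (\<exists>q. inertial_at X p q) \<and> total_at X p"
    and "p \<in> Mch_d X \<longleftrightarrow> p \<in> machines X \<and> (\<exists>q. inertial_at X p q) \<and> deterministic_at p"
proof -
  have "machine (hat (bin X)) (hat (bout X)) p \<longleftrightarrow> p \<in> machines X"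
    using sheaf_box[OF X] by (auto simp: machine_def Obj_ShN slice_def span_base_def)
  then show "p \<in> Mch_in X \<longleftrightarrow> p \<in> machines X \<and> (\<exists>q. inertial_at X p q)"
    "p \<in> Mch_t X \<longleftrightarrow> p \<in> machines X \<and> (\<exists>q. inertial_at X p q) \<and> total_at X p"
    "p \<in> Mch_d X \<longleftrightarrow> p \<in> machines X \<and> (\<exists>q. inertial_at X p q) \<and> deterministic_at p"
    using inertial_at_iff[OF X, of p] total_at_iff[OF X, of p] deterministic_at_iff[OF X, of p]
    by (auto simp: Mch_in_def Mch_t_def Mch_d_def inertial_machine_def total_machine_def
      deterministic_machine_def)
qed

text \<open>Inertia makes the output during the first time unit a function of the initial state. This is
  what breaks the feedback loops of a wiring diagram.\<close>

lemma inertial_outp: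
  assumes "inertial_at X p q" "p \<in> machines X" "s \<in> Sec (mdom p) 1"
  shows "outp p 1 s = q 0 (Res (mdom p) (Tr 0 0 1) s)"
proof -
  \<comment> \<open>The family \<open>q 1 s\<close> lives over [0, 2]. Its restriction to [0, 1] is
    the output of \<open>s\<close> on the one hand and, by naturality, the output announced by the
    initial state on the other.\<close>
  have "restr (bout X) (Tr 1 0 (1 + 1)) (q 1 s) = outp p 1 s"
    using assms unfolding inertial_at_def by blast
  moreover have "q 0 (Res (mdom p) (Tr 0 0 1) s) = restr (bout X) (Tr (0 + 1) 0 (1 + 1)) (q 1 s)"
    using assms unfolding inertial_at_def by fastforce
  ultimately show ?thesis by simp
qed

section \<open>Closure under wiring diagrams\<close>

context
  fixes \<phi> :: "'a swiring" and X Y p q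
  assumes \<phi>: "\<phi> \<in> hom (WD_cat ShN) X Y" and p: "p \<in> machines X" and q: "inertial_at X p q"
begin

lemma Sec_act:
  assumes "v \<in> Sec (mdom (span_act_obj \<phi> p)) n"
  obtains s y where "s \<in> Sec (mdom p) n" "y \<in> sections (bin Y) n"
    "inp p n s = feed \<phi> y (outp p n s)" "v = VPair s (VPair (Fam y) (Fam (outp p n s)))"
    "inp (span_act_obj \<phi> p) n v = y" "outp (span_act_obj \<phi> p) n v = readout \<phi> (outp p n s)"
  using Sec_span_act_obj[OF hom_WD_iff[OF \<phi>] _ assms] p hom_WD_Obj(3,4)[OF \<phi>] by metis

lemma Sec_actI:
  assumes "s \<in> Sec (mdom p) n" "y \<in> sections (bin Y) n" "inp p n s = feed \<phi> y (outp p n s)"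
  shows "VPair s (VPair (Fam y) (Fam (outp p n s))) \<in> Sec (mdom (span_act_obj \<phi> p)) n"
    and "inp (span_act_obj \<phi> p) n (VPair s (VPair (Fam y) (Fam (outp p n s)))) = y"
  using Sec_pb_pull_leg[OF hom_WD_iff[OF \<phi>], of p n] app_span_act_obj(1)[OF hom_WD_iff[OF \<phi>] _ assms(1)]
    assms p hom_WD_Obj(3,4)[OF \<phi>] by auto

lemma Res_act:
  assumes "s \<in> Sec (mdom p) n" "n' + k \<le> n"
  shows "Res (mdom (span_act_obj \<phi> p)) (Tr n' k n) (VPair s (VPair (Fam y) (Fam (outp p n s)))) =
    VPair (Res (mdom p) (Tr n' k n) s)
      (VPair (Fam (restr (bin Y) (Tr n' k n) y)) (Fam (outp p n' (Res (mdom p) (Tr n' k n) s))))"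
  using mdom_hom[OF pull_leg_hom[OF hom_WD_iff[OF \<phi>]]] hom_WD_Obj(3,4)[OF \<phi>]
  by (simp add: pb_simps prod_sh_simps Res_hat_Fam machine_restr[OF p assms])

text \<open>The outer output is read out from the inner one, so reading out the announced inner
  output announces the outer output.\<close>

lemma inertial_act: "inertial_at Y (span_act_obj \<phi> p) (\<lambda>n v. readout \<phi> (q n (vfst v)))"
  unfolding inertial_at_def
proof (intro conjI allI ballI impI)
  fix n v assume "v \<in> Sec (mdom (span_act_obj \<phi> p)) n"
  then obtain s where s: "s \<in> Sec (mdom p) n" "vfst v = s"
    "outp (span_act_obj \<phi> p) n v = readout \<phi> (outp p n s)"
    by (rule Sec_act) auto
  then have qs: "q n s \<in> sections (bout X) (n + 1)" "restr (bout X) (Tr n 0 (n + 1)) (q n s) = outp p n s"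
    using q by (auto simp: inertial_at_def)
  show "readout \<phi> (q n (vfst v)) \<in> sections (bout Y) (n + 1)"
    unfolding s using readout_sections[OF \<phi> qs(1)] .
  show "restr (bout Y) (Tr n 0 (n + 1)) (readout \<phi> (q n (vfst v))) = outp (span_act_obj \<phi> p) n v"
    unfolding s using restr_readout[OF \<phi> qs(1), of n 0] qs(2) by simp
next
  fix n n' k v assume "v \<in> Sec (mdom (span_act_obj \<phi> p)) n" and k: "n' + k \<le> n"
  then obtain s y where s: "s \<in> Sec (mdom p) n" "v = VPair s (VPair (Fam y) (Fam (outp p n s)))"
    by (blast elim: Sec_act)
  then have qs: "q n s \<in> sections (bout X) (n + 1)"
    "q n' (Res (mdom p) (Tr n' k n) s) = restr (bout X) (Tr (n' + 1) k (n + 1)) (q n s)"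
    using q k by (auto simp: inertial_at_def)
  show "readout \<phi> (q n' (vfst (Res (mdom (span_act_obj \<phi> p)) (Tr n' k n) v))) =
      restr (bout Y) (Tr (n' + 1) k (n + 1)) (readout \<phi> (q n (vfst v)))"
    unfolding s(2) Res_act[OF s(1) k] using restr_readout[OF \<phi> qs(1), of "n' + 1" k] k qs(2) by simp
qed

text \<open>The inner input on [0, 1] is computed from \<open>z\<close> and the announced output
  \<open>q 0 s\<close>. It is compatible with \<open>s\<close>, so \<open>s\<close> lifts along it.
  Inertia makes the output of the lifting equal to \<open>q 0 s\<close>, which closes the feedback
  loop.\<close>

lemma total_act:
  assumes t: "total_at X p"
  shows "total_at Y (span_act_obj \<phi> p)"
  unfolding total_at_def
proof (intro ballI impI)
  fix v z assume v: "v \<in> Sec (mdom (span_act_obj \<phi> p)) 0" and z: "z \<in> sections (bin Y) 1"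
    and eq: "restr (bin Y) (Tr 0 0 1) z = inp (span_act_obj \<phi> p) 0 v"
  obtain s y where s: "s \<in> Sec (mdom p) 0" "inp p 0 s = feed \<phi> y (outp p 0 s)"
    "v = VPair s (VPair (Fam y) (Fam (outp p 0 s)))" "restr (bin Y) (Tr 0 0 1) z = y"
    using v unfolding eq by (blast elim: Sec_act)
  have b: "q 0 s \<in> sections (bout X) 1" "restr (bout X) (Tr 0 0 1) (q 0 s) = outp p 0 s"
    using q s(1) by (auto simp: inertial_at_def)
  have "restr (bin X) (Tr 0 0 1) (feed \<phi> z (q 0 s)) = inp p 0 s"
    using restr_feed[OF \<phi> z b(1), of 0 0] unfolding b(2) s(2,4) by simp
  then obtain s' where s': "s' \<in> Sec (mdom p) 1" "Res (mdom p) (Tr 0 0 1) s' = s" "inp p 1 s' = feed \<phi> z (q 0 s)"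
    using t s(1) feed_sections[OF \<phi> z b(1)] unfolding total_at_def by blast
  have "inp p 1 s' = feed \<phi> z (outp p 1 s')"
    using inertial_outp[OF q p s'(1)] s' by simp
  from Sec_actI[OF s'(1) z this] Res_act[OF s'(1), of 0 0 z] s' s
  show "\<exists>v' \<in> Sec (mdom (span_act_obj \<phi> p)) 1.
      Res (mdom (span_act_obj \<phi> p)) (Tr 0 0 1) v' = v \<and> inp (span_act_obj \<phi> p) 1 v' = z"
    by (intro bexI[of _ "VPair s' (VPair (Fam z) (Fam (outp p 1 s')))"]) simp_all
qed

text \<open>By inertia, equal initial states have equal outputs on [0, 1]. With equal external
  inputs this makes the inner inputs equal, and determinism of the inner machine applies.\<close>

lemma deterministic_act:
  assumes d: "deterministic_at p"
  shows "deterministic_at (span_act_obj \<phi> p)"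
  unfolding deterministic_at_def
proof (intro ballI impI)
  fix v v' assume v: "v \<in> Sec (mdom (span_act_obj \<phi> p)) 1" and v': "v' \<in> Sec (mdom (span_act_obj \<phi> p)) 1"
    and eq: "Res (mdom (span_act_obj \<phi> p)) (Tr 0 0 1) v = Res (mdom (span_act_obj \<phi> p)) (Tr 0 0 1) v'"
      "inp (span_act_obj \<phi> p) 1 v = inp (span_act_obj \<phi> p) 1 v'"
  obtain s y where s: "s \<in> Sec (mdom p) 1" "inp p 1 s = feed \<phi> y (outp p 1 s)"
      "v = VPair s (VPair (Fam y) (Fam (outp p 1 s)))" "inp (span_act_obj \<phi> p) 1 v = y"
    using v by (blast elim: Sec_act)
  obtain s' y' where s': "s' \<in> Sec (mdom p) 1" "inp p 1 s' = feed \<phi> y' (outp p 1 s')"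
      "v' = VPair s' (VPair (Fam y') (Fam (outp p 1 s')))" "inp (span_act_obj \<phi> p) 1 v' = y'"
    using v' by (blast elim: Sec_act)
  have R: "Res (mdom p) (Tr 0 0 1) s = Res (mdom p) (Tr 0 0 1) s'"
    using eq(1) unfolding s(3) s'(3) using Res_act[OF s(1), of 0 0 y] Res_act[OF s'(1), of 0 0 y'] by simp
  have y: "y = y'" using eq(2) s(4) s'(4) by simp
  have o: "outp p 1 s = outp p 1 s'"
    using inertial_outp[OF q p s(1)] inertial_outp[OF q p s'(1)] R by simp
  then have "inp p 1 s = inp p 1 s'" using s(2) s'(2) y by simp
  then have "s = s'" using d s(1) s'(1) R unfolding deterministic_at_def by blast
  then show "v = v'" using s(3) s'(3) y by simp
qed

end

section \<open>Closure under parallel composition\<close>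

context
  fixes X Y :: "'a sbox" and p p'
  assumes X: "X \<in> Obj (WD_cat ShN)" "Y \<in> Obj (WD_cat ShN)" and p: "p \<in> machines X" "p' \<in> machines Y"
begin

lemma Sec_muE:
  assumes "v \<in> Sec (mdom (span_mu_obj X Y p p')) n"
  obtains s s' where "v = VPair s s'" "s \<in> Sec (mdom p) n" "s' \<in> Sec (mdom p') n"
    "inp (span_mu_obj X Y p p') n v = join (bin X) (bin Y) (inp p n s) (inp p' n s')"
    "outp (span_mu_obj X Y p p') n v = join (bout X) (bout Y) (outp p n s) (outp p' n s')"
  using assms app_span_mu_obj[OF X p] by (auto simp: prod_sh_simps)

lemma Res_mu: "Res (mdom (span_mu_obj X Y p p')) t (VPair s s') = VPair (Res (mdom p) t s) (Res (mdom p') t s')"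
  by (simp add: prod_sh_simps)

lemma inertial_mu:
  assumes q: "inertial_at X p q" "inertial_at Y p' q'"
  shows "inertial_at (box_sum X Y) (span_mu_obj X Y p p')
    (\<lambda>n v. join (bout X) (bout Y) (q n (vfst v)) (q' n (vsnd v)))"
  unfolding inertial_at_def box_sum_simps
proof (intro conjI allI ballI impI)
  fix n v assume "v \<in> Sec (mdom (span_mu_obj X Y p p')) n"
  then obtain s s' where s: "v = VPair s s'" "s \<in> Sec (mdom p) n" "s' \<in> Sec (mdom p') n"
    "outp (span_mu_obj X Y p p') n v = join (bout X) (bout Y) (outp p n s) (outp p' n s')"
    by (rule Sec_muE)
  from q s(2,3) have "q n s \<in> sections (bout X) (n + 1)" "restr (bout X) (Tr n 0 (n + 1)) (q n s) = outp p n s"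
    "q' n s' \<in> sections (bout Y) (n + 1)" "restr (bout Y) (Tr n 0 (n + 1)) (q' n s') = outp p' n s'"
    by (simp_all add: inertial_at_def)
  then show "join (bout X) (bout Y) (q n (vfst v)) (q' n (vsnd v)) \<in> sections (bout X \<uplus> bout Y) (n + 1)"
    "restr (bout X \<uplus> bout Y) (Tr n 0 (n + 1)) (join (bout X) (bout Y) (q n (vfst v)) (q' n (vsnd v))) =
      outp (span_mu_obj X Y p p') n v"
    unfolding s(4) by (simp_all only: s(1) val.sel restr_join join_sections)
next
  fix n n' k v assume "v \<in> Sec (mdom (span_mu_obj X Y p p')) n" and k: "n' + k \<le> n"
  then obtain s s' where s: "v = VPair s s'" "s \<in> Sec (mdom p) n" "s' \<in> Sec (mdom p') n"
    by (blast elim: Sec_muE)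
  then show "join (bout X) (bout Y) (q n' (vfst (Res (mdom (span_mu_obj X Y p p')) (Tr n' k n) v)))
      (q' n' (vsnd (Res (mdom (span_mu_obj X Y p p')) (Tr n' k n) v))) =
    restr (bout X \<uplus> bout Y) (Tr (n' + 1) k (n + 1)) (join (bout X) (bout Y) (q n (vfst v)) (q' n (vsnd v)))"
    unfolding s(1) Res_mu restr_join using q k by (simp add: inertial_at_def)
qed

text \<open>The input splits into one part for each factor, injectivity of \<open>join\<close>
  splits the compatibility condition accordingly, and the factors are lifted separately.\<close>

lemma total_mu:
  assumes t: "total_at X p" "total_at Y p'"
  shows "total_at (box_sum X Y) (span_mu_obj X Y p p')"
  unfolding total_at_def box_sum_simps
proof (intro ballI impI)
  fix v a assume v: "v \<in> Sec (mdom (span_mu_obj X Y p p')) 0" and "a \<in> sections (bin X \<uplus> bin Y) 1"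
    and eq: "restr (bin X \<uplus> bin Y) (Tr 0 0 1) a = inp (span_mu_obj X Y p p') 0 v"
  then obtain b b' where b: "b \<in> sections (bin X) 1" "b' \<in> sections (bin Y) 1" "a = join (bin X) (bin Y) b b'"
    by (auto elim: join_cases)
  obtain s s' where s: "v = VPair s s'" "s \<in> Sec (mdom p) 0" "s' \<in> Sec (mdom p') 0"
    "inp (span_mu_obj X Y p p') 0 v = join (bin X) (bin Y) (inp p 0 s) (inp p' 0 s')"
    using v by (rule Sec_muE)
  have "restr (bin X) (Tr 0 0 1) b = inp p 0 s \<and> restr (bin Y) (Tr 0 0 1) b' = inp p' 0 s'"
  proof (rule join_inject)
    show "restr (bin X) (Tr 0 0 1) b \<in> sections (bin X) 0" "restr (bin Y) (Tr 0 0 1) b' \<in> sections (bin Y) 0"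
      using X b by (auto simp: Obj_WD intro!: restr_sections)
    show "inp p 0 s \<in> sections (bin X) 0" "inp p' 0 s' \<in> sections (bin Y) 0"
      using app_machine p s by blast+
    show "join (bin X) (bin Y) (restr (bin X) (Tr 0 0 1) b) (restr (bin Y) (Tr 0 0 1) b') =
        join (bin X) (bin Y) (inp p 0 s) (inp p' 0 s')"
      using eq unfolding b(3) s(4) restr_join .
  qed
  then obtain r r' where r: "r \<in> Sec (mdom p) 1" "Res (mdom p) (Tr 0 0 1) r = s" "inp p 1 r = b"
    "r' \<in> Sec (mdom p') 1" "Res (mdom p') (Tr 0 0 1) r' = s'" "inp p' 1 r' = b'"
    using t b s unfolding total_at_def by meson
  show "\<exists>v' \<in> Sec (mdom (span_mu_obj X Y p p')) 1.
      Res (mdom (span_mu_obj X Y p p')) (Tr 0 0 1) v' = v \<and> inp (span_mu_obj X Y p p') 1 v' = a"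
  proof (intro bexI conjI)
    show "VPair r r' \<in> Sec (mdom (span_mu_obj X Y p p')) 1" using r by (auto simp: prod_sh_simps)
    show "Res (mdom (span_mu_obj X Y p p')) (Tr 0 0 1) (VPair r r') = v"
      unfolding Res_mu by (simp only: r s(1))
    show "inp (span_mu_obj X Y p p') 1 (VPair r r') = a"
      using app_span_mu_obj(1)[OF X p r(1,4)] by (simp only: r b(3))
  qed
qed

lemma deterministic_mu:
  assumes d: "deterministic_at p" "deterministic_at p'"
  shows "deterministic_at (span_mu_obj X Y p p')"
  unfolding deterministic_at_def
proof (intro ballI impI)
  fix v w assume v: "v \<in> Sec (mdom (span_mu_obj X Y p p')) 1" and w: "w \<in> Sec (mdom (span_mu_obj X Y p p')) 1"
    and R: "Res (mdom (span_mu_obj X Y p p')) (Tr 0 0 1) v = Res (mdom (span_mu_obj X Y p p')) (Tr 0 0 1) w"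
    and eq: "inp (span_mu_obj X Y p p') 1 v = inp (span_mu_obj X Y p p') 1 w"
  obtain s s' where s: "v = VPair s s'" "s \<in> Sec (mdom p) 1" "s' \<in> Sec (mdom p') 1"
    "inp (span_mu_obj X Y p p') 1 v = join (bin X) (bin Y) (inp p 1 s) (inp p' 1 s')"
    using v by (rule Sec_muE)
  obtain r r' where r: "w = VPair r r'" "r \<in> Sec (mdom p) 1" "r' \<in> Sec (mdom p') 1"
    "inp (span_mu_obj X Y p p') 1 w = join (bin X) (bin Y) (inp p 1 r) (inp p' 1 r')"
    using w by (rule Sec_muE)
  have "inp p 1 s = inp p 1 r \<and> inp p' 1 s' = inp p' 1 r'"
    using eq s r app_machine[OF p(1)] app_machine[OF p(2)] by (intro join_inject[of _ "bin X" 1]) auto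
  with R show "v = w"
    using d s r unfolding deterministic_at_def s(1) r(1) Res_mu by simp
qed

end

section \<open>The unit and the subalgebras\<close>

text \<open>There are no output ports, so the announced output is the empty family, which as an
  extensional function is \<open>\<lambda>_. undefined\<close>.\<close>

lemma inertial_unit: "inertial_at unit_box unit_machine (\<lambda>n v _. undefined)"
  by (auto simp: inertial_at_def sections_tempty restr_def Sec_unit_machine restrict_def app_unit_machine)

lemma total_unit: "total_at unit_box unit_machine"
  using app_unit_machine(1)
  by (auto simp: total_at_def sections_tempty Sec_unit_machine Res_hat restrict_def)

lemma deterministic_unit: "deterministic_at unit_machine"
  by (auto simp: deterministic_at_def Sec_unit_machine)

lemma subalgebra_Mch_N:
  assumes "\<And>X. X \<in> Obj (WD_cat ShN) \<Longrightarrow> P X \<subseteq> machines X"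
    and "\<And>\<phi> X Y p. \<phi> \<in> hom (WD_cat ShN) X Y \<Longrightarrow> X \<in> Obj (WD_cat ShN) \<Longrightarrow> Y \<in> Obj (WD_cat ShN) \<Longrightarrow>
      p \<in> P X \<Longrightarrow> span_act_obj \<phi> p \<in> P Y"
    and "\<And>X Y p q. X \<in> Obj (WD_cat ShN) \<Longrightarrow> Y \<in> Obj (WD_cat ShN) \<Longrightarrow> p \<in> P X \<Longrightarrow> q \<in> P Y \<Longrightarrow>
      span_mu_obj X Y p q \<in> P (box_sum X Y)"
    and "unit_machine \<in> P unit_box"
  shows "subalgebra (WD ShN) (Mch_N :: ('a sbox, 'a swiring, _, _) lax_data) P"
  using assms unfolding subalgebra_def by (simp add: hom_WD Arr_WD)

lemmas Mch_closed = act_machine span_mu_obj_hom unit_machine_hom unit_box_WD_Obj box_sum_Obj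
  inertial_act total_act deterministic_act inertial_mu total_mu deterministic_mu
  inertial_unit total_unit deterministic_unit

lemma subalgebra_Mch_in: "subalgebra (WD ShN) (Mch_N :: ('a sbox, 'a swiring, _, _) lax_data) Mch_in"
  by (rule subalgebra_Mch_N) (auto simp: Mch_iff box_sum_Obj unit_box_WD_Obj intro: Mch_closed)

lemma subalgebra_Mch_t: "subalgebra (WD ShN) (Mch_N :: ('a sbox, 'a swiring, _, _) lax_data) Mch_t"
  by (rule subalgebra_Mch_N) (auto simp: Mch_iff box_sum_Obj unit_box_WD_Obj intro: Mch_closed)

lemma subalgebra_Mch_d: "subalgebra (WD ShN) (Mch_N :: ('a sbox, 'a swiring, _, _) lax_data) Mch_d"
  by (rule subalgebra_Mch_N) (auto simp: Mch_iff box_sum_Obj unit_box_WD_Obj intro: Mch_closed)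

text \<open>Each closure condition sends machines of a class to a machine of the same class, so it
  passes to intersections. This reduces machines that are both total and deterministic to the two
  single classes.\<close>

lemma subalgebra_Int:
  "subalgebra W F P \<Longrightarrow> subalgebra W F Q \<Longrightarrow> subalgebra W F (\<lambda>X. P X \<inter> Q X)"
  unfolding subalgebra_def by blast

theorem proposition4p4p3:
  shows "WD_algebra ShN (Mch_N :: ('a sbox, 'a swiring, _, _) lax_data) \<and>
    subalgebra (WD ShN) (Mch_N :: ('a sbox, 'a swiring, _, _) lax_data) Mch_in \<and>
    subalgebra (WD ShN) (Mch_N :: ('a sbox, 'a swiring, _, _) lax_data) Mch_t \<and>
    subalgebra (WD ShN) (Mch_N :: ('a sbox, 'a swiring, _, _) lax_data) Mch_d \<and>
    subalgebra (WD ShN) (Mch_N :: ('a sbox, 'a swiring, _, _) lax_data) Mch_td"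
proof (intro conjI)
  have eq: "Mch_td = (\<lambda>X. Mch_t X \<inter> Mch_d X :: 'a shmap set)" by (simp add: fun_eq_iff Mch_td_def)
  show "subalgebra (WD ShN) (Mch_N :: ('a sbox, 'a swiring, _, _) lax_data) Mch_td"
    unfolding eq by (rule subalgebra_Int[OF subalgebra_Mch_t subalgebra_Mch_d])
qed (rule WD_algebra_Mch_N subalgebra_Mch_in subalgebra_Mch_t subalgebra_Mch_d)+

end
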